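(* Let $n,s,d,\Delta\ge1$. There exists a set $H_{n,s,d,\Delta}\subseteq(\mathbb{C}_d)^n$ of size $(nsd)^{O(\Delta)}$ such that for every nonassociative, commutative arithmetic circuit $\Psi$ of size $\le s$ and product depth $\le\Delta$ computing a non-zero polynomial $f\in\mathbb{F}_{\bar{A},C}[x_1,\ldots,x_n]$ of degree $\le d$, there is a point of $H_{n,s,d,\Delta}$ at which $f$ evaluates to a non-zero element. Furthermore, $H_{n,s,d,\Delta}$ can be computed deterministically in time $(nsd)^{O(\Delta)}$.
   Context: Throughout, the field $\mathbb{F}$ is assumed to be sufficiently large. $\mathbb{F}_{\bar{A},C}[X]$ ($X=\{x_1,\ldots,x_n\}$) is the commutative, nonassociative polynomial algebra: basis the monomial $1$ and rooted full binary trees with leaves labeled by variables, identified up to swapping children at internal nodes; product of monomials $m_1,m_2$ = tree whose root has subtrees $m_1,m_2$, extended bilinearly; degree = number of leaves. An arithmetic circuit over $\mathbb{F}_{\bar{A},C}[X]$ is a DAG whose leaves are labeled by variables or field elements and whose internal gates are sum gates or fan-in-$2$ product gates (using the commutative nonassociative product); it computes the polynomial at a designated output gate. Size = number of gates; product depth = maximum number of product gates on a leaf-to-root path. Let $\mathbb{A}'_d=\mathbb{F}^{d(d+1)^2}$ with elements indexed $x[i,j,k]$, $1\le i,j\le d+1$, $1\le k\le d$, and product $z=x\circ y$ with $z[i,j,d]=0$, $z[i,j,k]=\sum_{l=1}^{d+1}x[i,l,k+1]y[l,j,k+1]$ for $1\le k\le d-1$. Let $\mathbb{A}_d=\{(a,\alpha):a\in\mathbb{A}'_d,\alpha\in\mathbb{F}\}$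 with product $(a_1,\alpha_1)\cdot(a_2,\alpha_2)=(a_1\circ a_2+\alpha_1a_2+\alpha_2a_1,\alpha_1\alpha_2)$, and $\mathbb{C}_d$ the same vector space with product $a\odot b=a\cdot b+b\cdot a$. For $f=\sum_mc_mm$ and $b\in(\mathbb{C}_d)^n$, $f(b)=\sum_mc_mm(b)$, where $1\mapsto(\mathbf0,1)$, $x_i\mapsto b_i$, and a monomial with root subtrees $m_1,m_2$ maps to $m_1(b)\odot m_2(b)$.
   Formalization: The field is additionally assumed to have characteristic different from 2; in characteristic 2 every b⊙b is zero, so the nonzero polynomial x_1·x_1 vanishes at every point of (C_d)^n and the claim fails however large the field is. *)

theory Defs
  imports "HOL-Algebra.Ring" "HOL-Library.Uprod" "HOL-Library.FuncSet"
begin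

section \<open>Monomials of the commutative nonassociative polynomial algebra\<close>

text \<open>Internal nodes carry an unordered pair of subtrees, so trees that differ by swapping
  children are equal. A variable is a positive natural number.\<close>

datatype ctree = Leaf nat | Node "ctree uprod"

text \<open>\<open>None\<close> is the monomial 1.\<close>

type_synonym mono = "ctree option"

text \<open>Application of a binary operation to an unordered pair. It is meaningful only where the
  operation commutes on the two components; the operation need not commute everywhere, because
  the products below commute only on the carrier of the field.\<close>

definition uprod_lift :: "('b \<Rightarrow> 'b \<Rightarrow> 'c) \<Rightarrow> 'b uprod \<Rightarrow> 'c" where
  "uprod_lift g p = (SOME z. \<exists>a b. p = Upair a b \<and> z = g a b)"

lemma uprod_lift_Upair:
  assumes "g a b = g b a"
  shows "uprod_lift g (Upair a b) = g a b"
  unfolding uprod_lift_def by (rule some_equality) (use assms in auto)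

primrec tree_degree :: "ctree \<Rightarrow> nat" where
  "tree_degree (Leaf v) = 1"
| "tree_degree (Node p) = uprod_lift (+) (map_uprod tree_degree p)"

lemma tree_degree_Node: "tree_degree (Node (Upair t u)) = tree_degree t + tree_degree u"
  by (simp add: uprod_lift_Upair add.commute)

fun mono_degree :: "mono \<Rightarrow> nat" where
  "mono_degree None = 0"
| "mono_degree (Some t) = tree_degree t"

fun mono_mult :: "mono \<Rightarrow> mono \<Rightarrow> mono" where
  "mono_mult None m = m"
| "mono_mult m None = m"
| "mono_mult (Some t) (Some u) = Some (Node (Upair t u))"

section \<open>Polynomials\<close>

text \<open>A polynomial is its coefficient function; all those built below have finite support.\<close>

type_synonym 'a npoly = "mono \<Rightarrow> 'a"

definition psupp :: "'a ring \<Rightarrow> 'a npoly \<Rightarrow> mono set" where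
  "psupp F f = {m. f m \<noteq> \<zero>\<^bsub>F\<^esub>}"

definition pzero :: "'a ring \<Rightarrow> 'a npoly" where
  "pzero F = (\<lambda>m. \<zero>\<^bsub>F\<^esub>)"

definition pconst :: "'a ring \<Rightarrow> 'a \<Rightarrow> 'a npoly" where
  "pconst F c = (\<lambda>m. if m = None then c else \<zero>\<^bsub>F\<^esub>)"

definition pvar :: "'a ring \<Rightarrow> nat \<Rightarrow> 'a npoly" where
  "pvar F v = (\<lambda>m. if m = Some (Leaf v) then \<one>\<^bsub>F\<^esub> else \<zero>\<^bsub>F\<^esub>)"

definition padd :: "'a ring \<Rightarrow> 'a npoly \<Rightarrow> 'a npoly \<Rightarrow> 'a npoly" where
  "padd F f g = (\<lambda>m. f m \<oplus>\<^bsub>F\<^esub> g m)"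

definition pmult :: "'a ring \<Rightarrow> 'a npoly \<Rightarrow> 'a npoly \<Rightarrow> 'a npoly" where
  "pmult F f g = (\<lambda>m. \<Oplus>\<^bsub>F\<^esub>pq \<in> {(p, q). p \<in> psupp F f \<and> q \<in> psupp F g \<and> mono_mult p q = m}.
      f (fst pq) \<otimes>\<^bsub>F\<^esub> g (snd pq))"

definition pdegree :: "'a ring \<Rightarrow> 'a npoly \<Rightarrow> nat" where
  "pdegree F f = Max (mono_degree ` psupp F f)"

section \<open>Circuits\<close>

text \<open>The gates of the DAG are listed in a topological order, so that the inputs of a gate are
  positions of earlier gates. Inputs may be repeated.\<close>

datatype 'a gate = VarG nat | ConstG 'a | SumG "nat list" | ProdG nat nat

datatype 'a circuit = Circuit (gates: "'a gate list") (root: nat)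

primrec inputs :: "'a gate \<Rightarrow> nat set" where
  "inputs (VarG v) = {}"
| "inputs (ConstG c) = {}"
| "inputs (SumG js) = set js"
| "inputs (ProdG j k) = {j, k}"

primrec gate_ok :: "'a ring \<Rightarrow> nat \<Rightarrow> 'a gate \<Rightarrow> bool" where
  "gate_ok F n (VarG v) \<longleftrightarrow> v \<in> {1..n}"
| "gate_ok F n (ConstG c) \<longleftrightarrow> c \<in> carrier F"
| "gate_ok F n (SumG js) \<longleftrightarrow> js \<noteq> []"
| "gate_ok F n (ProdG j k) \<longleftrightarrow> True"

definition is_circuit :: "'a ring \<Rightarrow> nat \<Rightarrow> 'a circuit \<Rightarrow> bool" where
  "is_circuit F n C \<longleftrightarrow>
     root C < length (gates C) \<and>
     (\<forall>i < length (gates C). gate_ok F n (gates C ! i) \<and> (\<forall>j \<in> inputs (gates C ! i). j < i))"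

definition circuit_size :: "'a circuit \<Rightarrow> nat" where
  "circuit_size C = length (gates C)"

definition leaf_to_root_path :: "'a circuit \<Rightarrow> nat list \<Rightarrow> bool" where
  "leaf_to_root_path C p \<longleftrightarrow>
     p \<noteq> [] \<and> last p = root C \<and> inputs (gates C ! hd p) = {} \<and>
     (\<forall>t. Suc t < length p \<longrightarrow> p ! t \<in> inputs (gates C ! (p ! Suc t)))"

definition product_depth :: "'a circuit \<Rightarrow> nat" where
  "product_depth C =
     Max {length (filter (\<lambda>i. \<exists>j k. gates C ! i = ProdG j k) p) | p. leaf_to_root_path C p}"

primrec gate_poly :: "'a ring \<Rightarrow> 'a npoly list \<Rightarrow> 'a gate \<Rightarrow> 'a npoly" where
  "gate_poly F ps (VarG v) = pvar F v"
| "gate_poly F ps (ConstG c) = pconst F c"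
| "gate_poly F ps (SumG js) = foldr (padd F) (map ((!) ps) js) (pzero F)"
| "gate_poly F ps (ProdG j k) = pmult F (ps ! j) (ps ! k)"

definition circuit_poly :: "'a ring \<Rightarrow> 'a circuit \<Rightarrow> 'a npoly" where
  "circuit_poly F C = foldl (\<lambda>ps g. ps @ [gate_poly F ps g]) [] (gates C) ! root C"

section \<open>The algebra \<open>\<C>\<^sub>d\<close>\<close>

type_synonym 'a vec = "nat \<times> nat \<times> nat \<Rightarrow> 'a"
type_synonym 'a elt = "'a vec \<times> 'a"

definition idx :: "nat \<Rightarrow> (nat \<times> nat \<times> nat) set" where
  "idx d = {1..d+1} \<times> {1..d+1} \<times> {1..d}"

text \<open>Coordinate vectors are extensional (undefined outside \<open>idx d\<close>), so that equality of
  functions is equality of vectors.\<close>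

definition alg_carrier :: "'a ring \<Rightarrow> nat \<Rightarrow> 'a elt set" where
  "alg_carrier F d = (idx d \<rightarrow>\<^sub>E carrier F) \<times> carrier F"

definition circ :: "'a ring \<Rightarrow> nat \<Rightarrow> 'a vec \<Rightarrow> 'a vec \<Rightarrow> 'a vec" where
  "circ F d x y = (\<lambda>(i, j, k) \<in> idx d.
     if k = d then \<zero>\<^bsub>F\<^esub>
     else (\<Oplus>\<^bsub>F\<^esub>l \<in> {1..d+1}. x (i, l, k+1) \<otimes>\<^bsub>F\<^esub> y (l, j, k+1)))"

definition algA_mult :: "'a ring \<Rightarrow> nat \<Rightarrow> 'a elt \<Rightarrow> 'a elt \<Rightarrow> 'a elt" where
  "algA_mult F d a b =
     ((\<lambda>t \<in> idx d. circ F d (fst a) (fst b) t \<oplus>\<^bsub>F\<^esub> snd a \<otimes>\<^bsub>F\<^esub> fst b t \<oplus>\<^bsub>F\<^esub> snd b \<otimes>\<^bsub>F\<^esub> fst a t),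
      snd a \<otimes>\<^bsub>F\<^esub> snd b)"

definition alg_add :: "'a ring \<Rightarrow> nat \<Rightarrow> 'a elt \<Rightarrow> 'a elt \<Rightarrow> 'a elt" where
  "alg_add F d a b = ((\<lambda>t \<in> idx d. fst a t \<oplus>\<^bsub>F\<^esub> fst b t), snd a \<oplus>\<^bsub>F\<^esub> snd b)"

definition alg_zero :: "'a ring \<Rightarrow> nat \<Rightarrow> 'a elt" where
  "alg_zero F d = ((\<lambda>t \<in> idx d. \<zero>\<^bsub>F\<^esub>), \<zero>\<^bsub>F\<^esub>)"

text \<open>In characteristic 2 every square under this product is zero, so the nonzero polynomial
  \<open>x\<^sub>1x\<^sub>1\<close> vanishes at all points. Nonvanishing results therefore need \<open>1 + 1 \<noteq> 0\<close>.\<close>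

definition algC_mult :: "'a ring \<Rightarrow> nat \<Rightarrow> 'a elt \<Rightarrow> 'a elt \<Rightarrow> 'a elt" where
  "algC_mult F d a b = alg_add F d (algA_mult F d a b) (algA_mult F d b a)"

definition points :: "'a ring \<Rightarrow> nat \<Rightarrow> nat \<Rightarrow> (nat \<Rightarrow> 'a elt) set" where
  "points F d n = {1..n} \<rightarrow>\<^sub>E alg_carrier F d"

primrec tree_eval :: "'a ring \<Rightarrow> nat \<Rightarrow> (nat \<Rightarrow> 'a elt) \<Rightarrow> ctree \<Rightarrow> 'a elt" where
  "tree_eval F d b (Leaf v) = b v"
| "tree_eval F d b (Node p) = uprod_lift (algC_mult F d) (map_uprod (tree_eval F d b) p)"

fun mono_eval :: "'a ring \<Rightarrow> nat \<Rightarrow> (nat \<Rightarrow> 'a elt) \<Rightarrow> mono \<Rightarrow> 'a elt" where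
  "mono_eval F d b None = ((\<lambda>t \<in> idx d. \<zero>\<^bsub>F\<^esub>), \<one>\<^bsub>F\<^esub>)"
| "mono_eval F d b (Some t) = tree_eval F d b t"

definition poly_eval :: "'a ring \<Rightarrow> nat \<Rightarrow> (nat \<Rightarrow> 'a elt) \<Rightarrow> 'a npoly \<Rightarrow> 'a elt" where
  "poly_eval F d b f =
     ((\<lambda>t \<in> idx d. \<Oplus>\<^bsub>F\<^esub>m \<in> psupp F f. f m \<otimes>\<^bsub>F\<^esub> fst (mono_eval F d b m) t),
      (\<Oplus>\<^bsub>F\<^esub>m \<in> psupp F f. f m \<otimes>\<^bsub>F\<^esub> snd (mono_eval F d b m)))"

lemma circ_closed:
  assumes "field F" "x \<in> idx d \<rightarrow>\<^sub>E carrier F" "y \<in> idx d \<rightarrow>\<^sub>E carrier F"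
  shows "circ F d x y \<in> idx d \<rightarrow>\<^sub>E carrier F"
proof -
  interpret field F by fact
  have c: "x (i, j, k) \<in> carrier F" "y (i, j, k) \<in> carrier F"
    if "(i, j, k) \<in> idx d" for i j k
    using PiE_mem[OF assms(2) that] PiE_mem[OF assms(3) that] by auto
  show ?thesis
    by (auto simp: circ_def idx_def intro!: finsum_closed m_closed c)
qed

lemma algA_mult_closed:
  assumes "field F" "a \<in> alg_carrier F d" "b \<in> alg_carrier F d"
  shows "algA_mult F d a b \<in> alg_carrier F d"
proof -
  interpret field F by fact
  have m: "fst a \<in> idx d \<rightarrow>\<^sub>E carrier F" "fst b \<in> idx d \<rightarrow>\<^sub>E carrier F"
    "snd a \<in> carrier F" "snd b \<in> carrier F"
    using assms by (auto simp: alg_carrier_def)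
  show ?thesis
    using circ_closed[OF assms(1) m(1,2)] m
    by (auto simp: algA_mult_def alg_carrier_def intro!: a_closed m_closed dest: PiE_mem)
qed

lemma algC_mult_closed:
  assumes "field F" "a \<in> alg_carrier F d" "b \<in> alg_carrier F d"
  shows "algC_mult F d a b \<in> alg_carrier F d"
proof -
  interpret field F by fact
  show ?thesis
    using algA_mult_closed[OF assms] algA_mult_closed[OF assms(1,3,2)]
    by (auto simp: algC_mult_def alg_add_def alg_carrier_def intro!: a_closed dest: PiE_mem)
qed

lemma algC_mult_commute:
  assumes "field F" "a \<in> alg_carrier F d" "b \<in> alg_carrier F d"
  shows "algC_mult F d a b = algC_mult F d b a"
proof -
  interpret field F by fact
  show ?thesis
    using algA_mult_closed[OF assms] algA_mult_closed[OF assms(1,3,2)]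
    by (auto simp: algC_mult_def alg_add_def alg_carrier_def a_comm
        intro!: restrict_ext a_comm dest: PiE_mem)
qed

section \<open>Deterministic algorithms over a field\<close>

text \<open>Programs for a random access machine with one memory of natural numbers and one memory of
  field elements, both with indirect addressing, and a write-only output sequence of field
  elements. Every operation and every test costs one step. On natural numbers there are only
  addition and truncated subtraction, so the bit length of a number grows by at most one bit per
  step and unit cost is polynomially equivalent to the bit cost. Field operations are counted
  as arithmetic operations. The field enters a program only through its operations, an equality
  test, and access to the elements of a given sequence of field elements; the syntax does not
  mention the field, so one program serves all fields.\<close>

datatype addr = Dir nat | Ind nat
datatype operand = Imm nat | At addr

datatype test = NLess operand operand | NEq operand operand | FEq addr addr

datatype prog =
    Skip
  | NSet addr operand
  | NAdd addr operand operand
  | NSub addr operand operand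
  | FOne addr
  | FElem addr operand
  | FAdd addr addr addr
  | FSub addr addr addr
  | FMul addr addr addr
  | Emit addr
  | Seq prog prog
  | Cond test prog prog
  | While test prog

datatype 'a state = State (nmem: "nat \<Rightarrow> nat") (fmem: "nat \<Rightarrow> 'a") (out: "'a list")

primrec loc :: "'a state \<Rightarrow> addr \<Rightarrow> nat" where
  "loc st (Dir r) = r"
| "loc st (Ind r) = nmem st r"

primrec nval :: "'a state \<Rightarrow> operand \<Rightarrow> nat" where
  "nval st (Imm k) = k"
| "nval st (At x) = nmem st (loc st x)"

definition fval :: "'a state \<Rightarrow> addr \<Rightarrow> 'a" where
  "fval st x = fmem st (loc st x)"

definition nput :: "'a state \<Rightarrow> addr \<Rightarrow> nat \<Rightarrow> 'a state" where
  "nput st x v = State ((nmem st)(loc st x := v)) (fmem st) (out st)"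

definition fput :: "'a state \<Rightarrow> addr \<Rightarrow> 'a \<Rightarrow> 'a state" where
  "fput st x v = State (nmem st) ((fmem st)(loc st x := v)) (out st)"

primrec holds :: "'a state \<Rightarrow> test \<Rightarrow> bool" where
  "holds st (NLess x y) \<longleftrightarrow> nval st x < nval st y"
| "holds st (NEq x y) \<longleftrightarrow> nval st x = nval st y"
| "holds st (FEq x y) \<longleftrightarrow> fval st x = fval st y"

text \<open>\<open>exec F e p st t st'\<close>: started in \<open>st\<close>, the program \<open>p\<close> halts in \<open>st'\<close> after \<open>t\<close> steps,
  where \<open>e\<close> is the given sequence of elements of \<open>F\<close>.\<close>

inductive exec :: "'a ring \<Rightarrow> (nat \<Rightarrow> 'a) \<Rightarrow> prog \<Rightarrow> 'a state \<Rightarrow> nat \<Rightarrow> 'a state \<Rightarrow> bool"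
  for F :: "'a ring" and e :: "nat \<Rightarrow> 'a" where
  "exec F e Skip st 1 st"
| "exec F e (NSet x u) st 1 (nput st x (nval st u))"
| "exec F e (NAdd x u v) st 1 (nput st x (nval st u + nval st v))"
| "exec F e (NSub x u v) st 1 (nput st x (nval st u - nval st v))"
| "exec F e (FOne x) st 1 (fput st x \<one>\<^bsub>F\<^esub>)"
| "exec F e (FElem x u) st 1 (fput st x (e (nval st u)))"
| "exec F e (FAdd x y z) st 1 (fput st x (fval st y \<oplus>\<^bsub>F\<^esub> fval st z))"
| "exec F e (FSub x y z) st 1 (fput st x (fval st y \<ominus>\<^bsub>F\<^esub> fval st z))"
| "exec F e (FMul x y z) st 1 (fput st x (fval st y \<otimes>\<^bsub>F\<^esub> fval st z))"
| "exec F e (Emit x) st 1 (State (nmem st) (fmem st) (out st @ [fval st x]))"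
| "\<lbrakk>exec F e p st t st'; exec F e q st' t' st''\<rbrakk> \<Longrightarrow> exec F e (Seq p q) st (t + t') st''"
| "\<lbrakk>holds st c; exec F e p st t st'\<rbrakk> \<Longrightarrow> exec F e (Cond c p q) st (t + 1) st'"
| "\<lbrakk>\<not> holds st c; exec F e q st t st'\<rbrakk> \<Longrightarrow> exec F e (Cond c p q) st (t + 1) st'"
| "\<not> holds st c \<Longrightarrow> exec F e (While c p) st 1 st"
| "\<lbrakk>holds st c; exec F e p st t st'; exec F e (While c p) st' t' st''\<rbrakk>
    \<Longrightarrow> exec F e (While c p) st (t + t' + 1) st''"

lemma exec_deterministic:
  "exec F e p st t st' \<Longrightarrow> exec F e p st u st'' \<Longrightarrow> t = u \<and> st' = st''"
proof (induction arbitrary: u st'' rule: exec.induct)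
  case (11 p st t st' q t' st2)
  from 11(5) show ?case by (cases rule: exec.cases) (use 11 in blast)+
next
  case (12 st c p t st' q)
  from 12(4) show ?case by (cases rule: exec.cases) (use 12 in blast)+
next
  case (13 st c q t st' p)
  from 13(4) show ?case by (cases rule: exec.cases) (use 13 in blast)+
next
  case (15 st c p t st' t' st2)
  from 15(6) show ?case by (cases rule: exec.cases) (use 15 in blast)+
qed (auto elim: exec.cases)

definition start :: "'a ring \<Rightarrow> nat list \<Rightarrow> 'a state" where
  "start F args = State (\<lambda>r. if r < length args then args ! r else 0) (\<lambda>r. \<zero>\<^bsub>F\<^esub>) []"

text \<open>A point is written as the list of its \<open>n * (d * (d + 1)\<^sup>2 + 1)\<close> coordinates.\<close>

definition elt_code :: "nat \<Rightarrow> 'a elt \<Rightarrow> 'a list" where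
  "elt_code d a = [fst a (i, j, k). i \<leftarrow> [1..<d+2], j \<leftarrow> [1..<d+2], k \<leftarrow> [1..<d+1]] @ [snd a]"

definition point_code :: "nat \<Rightarrow> nat \<Rightarrow> (nat \<Rightarrow> 'a elt) \<Rightarrow> 'a list" where
  "point_code d n b = concat (map (\<lambda>v. elt_code d (b v)) [1..<n+1])"

definition outputs_within ::
    "'a ring \<Rightarrow> (nat \<Rightarrow> 'a) \<Rightarrow> prog \<Rightarrow> nat list \<Rightarrow> 'a list \<Rightarrow> nat \<Rightarrow> bool" where
  "outputs_within F e p args w T \<longleftrightarrow>
     (\<exists>t st. exec F e p (start F args) t st \<and> t \<le> T \<and> out st = w)"

text \<open>The first \<open>N\<close> members of \<open>e\<close> are distinct. Such an \<open>e\<close> exists iff \<open>F\<close> has at least \<open>N\<close>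
  elements, so this is how the field is required to be sufficiently large.\<close>

definition distinct_elements :: "'a ring \<Rightarrow> nat \<Rightarrow> (nat \<Rightarrow> 'a) \<Rightarrow> bool" where
  "distinct_elements F N e \<longleftrightarrow> range e \<subseteq> carrier F \<and> inj_on e {..<N}"

lemma ex_distinct_elements_iff:
  assumes "field F"
  shows "(\<exists>e. distinct_elements F N e) \<longleftrightarrow> infinite (carrier F) \<or> N \<le> card (carrier F)"
proof
  assume "\<exists>e. distinct_elements F N e"
  then obtain e where e: "range e \<subseteq> carrier F" "inj_on e {..<N}"
    by (auto simp: distinct_elements_def)
  have "card (e ` {..<N}) = N" using e(2) by (simp add: card_image)
  moreover have "e ` {..<N} \<subseteq> carrier F" using e(1) by auto
  ultimately show "infinite (carrier F) \<or> N \<le> card (carrier F)"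
    by (metis card_mono)
next
  assume "infinite (carrier F) \<or> N \<le> card (carrier F)"
  then obtain A where A: "A \<subseteq> carrier F" "finite A" "card A = N"
    by (metis infinite_arbitrarily_large obtain_subset_with_card_n)
  from ex_bij_betw_nat_finite[OF A(2)] obtain h where h: "bij_betw h {0..<N} A"
    using A(3) by auto
  have z: "\<zero>\<^bsub>F\<^esub> \<in> carrier F"
  proof -
    interpret field F by fact
    show ?thesis by simp
  qed
  define e where "e i = (if i < N then h i else \<zero>\<^bsub>F\<^esub>)" for i
  have "inj_on e {..<N}"
    using h by (auto simp: e_def bij_betw_def inj_on_def)
  moreover have "range e \<subseteq> carrier F"
    using h A(1) z by (auto simp: e_def bij_betw_def)
  ultimately show "\<exists>e. distinct_elements F N e" by (auto simp: distinct_elements_def)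
qed

text \<open>With a constant \<open>c\<close> this is the bound (nsd) to the power O(D). The base is replaced by 2
  when \<open>n * s * d = 1\<close>, where every power of it is 1. The constant has to be chosen before the
  field: for a single finite field it could be taken so large that the field never counts as
  sufficiently large. Hence fields are ring records here, which can be quantified after \<open>c\<close>.\<close>

definition bound :: "nat \<Rightarrow> nat \<Rightarrow> nat \<Rightarrow> nat \<Rightarrow> nat \<Rightarrow> nat" where
  "bound c n s d D = max 2 (n * s * d) ^ (c * D)"

end

theory Submission
  imports Complex_Main Defs
begin

text \<open>A point whose matrices carry a power of \<open>y\<close> just above the diagonal turns the entry
  \<open>(1, D + 1)\<close> of the first layer of \<open>f(b)\<close> into a univariate polynomial in \<open>y\<close>: each plane tree
  with \<open>D\<close> leaves contributes \<open>y\<close> to the sum of the weights of its leaves, where the weight of a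
  leaf may depend on its variable, its depth and its position. It suffices to choose weights for
  which the least weight among the trees with nonzero coefficient is attained only once.

  Call a tree essential if some linear combination of the gate coefficients vanishes on all
  lighter trees but not on it. The coefficients of a tree with subtrees \<open>a\<close>, \<open>b\<close> are linear in those
  of \<open>a\<close> when \<open>b\<close> is fixed, so subtrees of essential trees are essential; and if essential trees have
  distinct weights, a triangular system bounds their number by the circuit size. So there are only
  polynomially many candidates for essential trees of height \<open>h + 1\<close> once the weights isolate those
  of height \<open>h\<close>, and one further weight of lower priority, \<open>2\<close> to the index of the leaf reduced
  modulo a suitable polynomially bounded \<open>q\<close>, separates them. The hitting set runs over all
  choices of one modulus per height, and of \<open>y\<close>.\<close>

text \<open>Exponentially many trees can have at most \<open>d\<close> leaves, so in general weights
  of size (nsd)^O(\<Delta>) cannot separate them all. Uniqueness is therefore asked only of trees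
  that could be lightest for some combination of the gates. Commutativity is the second obstacle.
  Both orders of the factors survive in \<open>algC_mult\<close>, so a monomial evaluates to a sum
  over all plane trees that represent it, all with the same coefficient. The two orders of a product
  must be told apart too, hence the dependence of a leaf weight on the position. Nodes with equal
  children produce powers of 1 + 1, which must not vanish. A tree with nonzero coefficient is at
  most as high as the product depth, so \<Delta> + 1 moduli suffice. Each is below a fixed power
  \<open>K\<close> of nsd + 1, and writing the moduli and the index of \<open>y\<close> as digits in
  base \<open>K\<close> gives a single parameter and the exponent O(\<Delta>). That a small modulus
  separates polynomially many pairs of numbers with polynomially many bits rests on an elementary
  lower bound for common multiples of 1, ..., 2m + 1.\<close>

section \<open>Separating integers by a small modulus\<close>

text \<open>The quotient is \<open>X\<close> times an entry of the Leibniz harmonic triangle, in which each entry is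
  a difference of two entries with smaller \<open>k\<close>.\<close>

lemma leibniz_triangle_Ints:
  fixes X :: nat
  assumes "\<And>q. 1 \<le> q \<Longrightarrow> q \<le> n \<Longrightarrow> q dvd X" "k \<le> m" "m < n"
  shows "real X / (real (Suc m) * real (m choose k)) \<in> \<int>"
  using assms(2,3)
proof (induction k arbitrary: m)
  case 0
  have "Suc m dvd X" using assms(1) 0 by simp
  then obtain c where "X = Suc m * c" by (auto simp: dvd_def)
  then have "real X / (real (Suc m) * real (m choose 0)) = real c"
    by (simp add: field_simps)
  then show ?case by simp
next
  case (Suc k)
  then obtain m' where m: "m = Suc m'" "k \<le> m'" by (cases m) auto
  let ?c = "real (m' choose k)"
  have c: "?c > 0" using m by simp
  have "real (m - k) * real (m choose k) = real m * ?c"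
    using binomial_absorb_comp[of m k] m(1) by (metis diff_Suc_1 of_nat_mult)
  then have a: "(real m - real k) * real (m choose k) = real m * ?c"
    using m by (simp add: of_nat_diff)
  have b: "(real k + 1) * real (m choose Suc k) = real m * ?c"
    using arg_cong[OF Suc_times_binomial[of k m'], of real] m by (simp add: algebra_simps)
  have p: "real (m choose k) > 0" "real (m choose Suc k) > 0" "real m > 0" "real m - real k > 0"
    using Suc.prems m(2) by (simp_all add: zero_less_binomial_iff del: binomial_Suc_Suc)
  have a': "1 / real (m choose k) = (real m - real k) / (real m * ?c)"
    using a p c by (simp add: field_simps)
  have b': "1 / real (m choose Suc k) = (real k + 1) / (real m * ?c)"
    using b p c by (simp add: field_simps)
  have "1 / (real (Suc m) * real (m choose k)) + 1 / (real (Suc m) * real (m choose Suc k))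
      = (1 / real (Suc m)) * (1 / real (m choose k) + 1 / real (m choose Suc k))"
    by (simp only: distrib_left times_divide_times_eq mult_1)
  also have "\<dots> = (1 / real (Suc m)) * (real (Suc m) / (real m * ?c))"
    unfolding a' b' by (simp add: add_divide_distrib[symmetric] add.commute)
  also have "\<dots> = 1 / (real m * ?c)" by simp
  finally have "1 / (real (Suc m) * real (m choose Suc k))
      = 1 / (real m * ?c) - 1 / (real (Suc m) * real (m choose k))" by linarith
  from arg_cong[OF this, of "\<lambda>t. real X * t"]
  have "real X / (real (Suc m) * real (m choose Suc k))
      = real X / (real m * ?c) - real X / (real (Suc m) * real (m choose k))"
    by (simp add: right_diff_distrib)
  moreover have "real X / (real m * ?c) \<in> \<int>"
    using Suc.IH[of m'] m Suc.prems by simp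
  moreover have "real X / (real (Suc m) * real (m choose k)) \<in> \<int>"
    using Suc.IH[of m] Suc.prems by simp
  ultimately show ?case by simp
qed

text \<open>The central entry of the triangle makes \<open>X\<close> divided by
  \<open>(2 * m + 1) * (2 * m choose m)\<close> a positive integer, and the central binomial
  coefficient is at least \<open>2 ^ m\<close>. This avoids any estimate on the distribution of
  primes.\<close>

lemma common_multiple_lower_bound:
  fixes X :: nat
  assumes "\<And>q. 1 \<le> q \<Longrightarrow> q \<le> 2 * m + 1 \<Longrightarrow> q dvd X" "X > 0" "m \<ge> 1"
  shows "2 ^ m < X"
proof -
  let ?r = "real X / (real (Suc (2 * m)) * real ((2 * m) choose m))"
  have "?r \<in> \<int>" by (rule leibniz_triangle_Ints[OF assms(1)]) auto
  then obtain z where z: "?r = real_of_int z" by (auto elim: Ints_cases)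
  have p: "real (Suc (2 * m)) * real ((2 * m) choose m) > 0" by simp
  then have "?r > 0" using assms(2) by simp
  then have "z > 0" unfolding z by simp
  then have "?r \<ge> 1" unfolding z by simp
  then have "real (Suc (2 * m)) * real ((2 * m) choose m) \<le> real X"
    using p by (simp only: le_divide_eq_1_pos)
  moreover have "(2::real) ^ m \<le> real ((2 * m) choose m)"
    using binomial_ge_n_over_k_pow_k[of m "2 * m", where ?'a = real] assms(3) by simp
  then have "2 * (2::real) ^ m \<le> real (Suc (2 * m)) * real ((2 * m) choose m)"
    using assms(3) by (intro mult_mono) auto
  ultimately have "2 * (2::real) ^ m \<le> real X" by linarith
  then have "real (2 * 2 ^ m) \<le> real X" by simp
  then have "2 * 2 ^ m \<le> X" by (simp only: of_nat_le_iff)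
  moreover have "(0::nat) < 2 ^ m" by simp
  ultimately show ?thesis by linarith
qed

text \<open>The product of the differences is positive and at most \<open>2 ^ m\<close>, hence too
  small to be a common multiple of all numbers up to \<open>2 * m + 1\<close>. A number that does
  not divide the product divides none of its factors.\<close>

lemma exists_separating_modulus:
  fixes A :: "(nat \<times> nat) set"
  assumes "finite A" "card A \<le> r" "\<And>a b. (a, b) \<in> A \<Longrightarrow> a \<noteq> b \<and> a < 2 ^ L \<and> b < 2 ^ L"
    "L * r \<le> m" "m \<ge> 1"
  shows "\<exists>q \<ge> 2. q \<le> 2 * m + 1 \<and> (\<forall>(a, b) \<in> A. a mod q \<noteq> b mod q)"
proof -
  define D where "D p = (case p of (a, b) \<Rightarrow> nat \<bar>int a - int b\<bar>)" for p :: "nat \<times> nat"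
  define X where "X = (\<Prod>p\<in>A. D p)"
  have D: "D p > 0" "D p \<le> 2 ^ L" if "p \<in> A" for p
  proof -
    obtain a b where p: "p = (a, b)" by force
    then have "a \<noteq> b" "a < 2 ^ L" "b < 2 ^ L" using assms(3) that by auto
    then have "\<bar>int a - int b\<bar> \<le> int (2 ^ L)" "\<bar>int a - int b\<bar> > 0" by linarith+
    then show "D p > 0" "D p \<le> 2 ^ L" by (simp_all only: D_def p prod.case)
  qed
  have "X > 0" unfolding X_def using D by (simp add: prod_pos)
  have "X \<le> (\<Prod>p\<in>A. 2 ^ L)" unfolding X_def using D by (intro prod_mono) auto
  also have "\<dots> = 2 ^ (L * card A)" by (simp add: power_mult)
  also have "\<dots> \<le> 2 ^ m" using assms(2,4) by (intro power_increasing) (auto intro: order.trans[OF mult_le_mono2])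
  finally have "X \<le> 2 ^ m" .
  with common_multiple_lower_bound[of m X] \<open>X > 0\<close> assms(5)
  obtain q where q: "1 \<le> q" "q \<le> 2 * m + 1" "\<not> q dvd X" by (meson not_less)
  have "a mod q \<noteq> b mod q" if ab: "(a, b) \<in> A" for a b
  proof
    assume "a mod q = b mod q"
    then have "int a mod int q = int b mod int q" by (metis of_nat_mod)
    then have "int q dvd int a - int b" by (simp add: mod_eq_dvd_iff)
    then have "int q dvd \<bar>int a - int b\<bar>" by simp
    then have "q dvd D (a, b)" by (simp add: D_def)
    then have "q dvd X" unfolding X_def using ab assms(1)
      by (meson dvd_prodI dvd_trans)
    with q show False by simp
  qed
  moreover have "q \<noteq> 1" using q(3) by auto
  ultimately show ?thesis using q by (intro exI[of _ q]) auto
qed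

text \<open>Packs the moduli of all heights and the index of a field element into one number; the
  index \<open>y\<close> is the whole part above the \<open>m\<close> digits and may be
  large.\<close>

lemma exists_digits:
  fixes g :: "nat \<Rightarrow> nat"
  assumes "\<And>h. h < m \<Longrightarrow> g h < K"
  shows "\<exists>c. c div K ^ m = y \<and> (\<forall>h < m. c div K ^ h mod K = g h)"
  using assms
proof (induction m arbitrary: g)
  case 0
  then show ?case by auto
next
  case (Suc m)
  from Suc.IH[of "g \<circ> Suc"] Suc.prems
  obtain c where c: "c div K ^ m = y" "\<And>h. h < m \<Longrightarrow> c div K ^ h mod K = g (Suc h)" by auto
  have g0: "g 0 < K" using Suc.prems by auto
  let ?c = "g 0 + K * c"
  have d: "?c div K ^ Suc h = c div K ^ h" for h
    using g0 by (simp add: div_mult2_eq)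
  show ?case
  proof (intro exI[of _ ?c] conjI allI impI)
    show "?c div K ^ Suc m = y" using d c by simp
    fix h assume "h < Suc m"
    then show "?c div K ^ h mod K = g h"
    proof (cases h)
      case (Suc j)
      then show ?thesis using c(2)[of j] d[of j] \<open>h < Suc m\<close> by (simp del: power_Suc)
    qed (use g0 in simp)
  qed
qed

section \<open>Plane trees and their weights\<close>

text \<open>The matrix product underlying the algebra is not commutative, so the value of a
  commutative monomial has one term for every way to order the children at its nodes. Plane trees
  index these terms.\<close>

datatype ptree = PLeaf nat | PNode ptree ptree

primrec forget :: "ptree \<Rightarrow> ctree" where
  "forget (PLeaf v) = Leaf v"
| "forget (PNode a b) = Node (Upair (forget a) (forget b))"

primrec psize :: "ptree \<Rightarrow> nat" where
  "psize (PLeaf v) = 1"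
| "psize (PNode a b) = psize a + psize b"

primrec pheight :: "ptree \<Rightarrow> nat" where
  "pheight (PLeaf v) = 0"
| "pheight (PNode a b) = Suc (max (pheight a) (pheight b))"

primrec pvars :: "ptree \<Rightarrow> nat set" where
  "pvars (PLeaf v) = {v}"
| "pvars (PNode a b) = pvars a \<union> pvars b"

text \<open>Each of the \<open>psym P\<close> nodes with equal children doubles the coefficient with which the
  plane tree \<open>P\<close> occurs in the evaluation of \<open>forget P\<close>.\<close>

primrec psym :: "ptree \<Rightarrow> nat" where
  "psym (PLeaf v) = 0"
| "psym (PNode a b) = psym a + psym b + (if forget a = forget b then 1 else 0)"

lemma psize_pos: "psize P > 0"
  by (induction P) auto

lemma forget_eq_invariants:
  "forget P = forget Q \<Longrightarrow>
     psize P = psize Q \<and> pheight P = pheight Q \<and> pvars P = pvars Q \<and> psym P = psym Q"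
proof (induction P arbitrary: Q)
  case (PLeaf v)
  then show ?case by (cases Q) auto
next
  case (PNode a b)
  then obtain c e where Q: "Q = PNode c e" by (cases Q) auto
  with PNode.prems have "forget a = forget c \<and> forget b = forget e \<or>
    forget a = forget e \<and> forget b = forget c" by auto
  then show ?case
  proof
    assume "forget a = forget c \<and> forget b = forget e"
    then show ?thesis using PNode.IH(1)[of c] PNode.IH(2)[of e] Q by auto
  next
    assume "forget a = forget e \<and> forget b = forget c"
    then show ?thesis using PNode.IH(1)[of e] PNode.IH(2)[of c] Q by auto
  qed
qed

lemma tree_degree_forget: "tree_degree (forget P) = psize P"
  by (induction P) (simp_all add: uprod_lift_Upair add.commute)

lemma ex_forget: "\<exists>P. forget P = T"
proof (induction T)
  case (Leaf v)
  show ?case by (rule exI[of _ "PLeaf v"]) simp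
next
  case (Node p)
  obtain t u where p: "p = Upair t u" by (cases p) auto
  with Node[of t] Node[of u] obtain P Q where "forget P = t" "forget Q = u" by auto
  then show ?case using p by (intro exI[of _ "PNode P Q"]) simp
qed

text \<open>The two images are equal if the children agree after forgetting the order, and disjoint
  otherwise. The first case is the source of the factors counted by \<open>psym\<close>.\<close>

lemma forget_fibre_PNode:
  "{Q. forget Q = forget (PNode a b)} =
     (\<lambda>(x, y). PNode x y) ` ({Q. forget Q = forget a} \<times> {Q. forget Q = forget b}) \<union>
     (\<lambda>(x, y). PNode x y) ` ({Q. forget Q = forget b} \<times> {Q. forget Q = forget a})" (is "?L = ?R")
proof
  show "?L \<subseteq> ?R"
  proof
    fix Q assume "Q \<in> ?L"
    then show "Q \<in> ?R" by (cases Q) auto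
  qed
qed auto

lemma forget_fibre_PLeaf: "{Q. forget Q = forget (PLeaf v)} = {PLeaf v}"
proof
  show "{Q. forget Q = forget (PLeaf v)} \<subseteq> {PLeaf v}"
  proof
    fix Q assume "Q \<in> {Q. forget Q = forget (PLeaf v)}"
    then show "Q \<in> {PLeaf v}" by (cases Q) auto
  qed
qed auto

lemma finite_forget_fibre: "finite {Q. forget Q = forget P}"
proof (induction P)
  case (PLeaf v)
  then show ?case unfolding forget_fibre_PLeaf by simp
next
  case (PNode a b)
  then show ?case unfolding forget_fibre_PNode by auto
qed

text \<open>\<open>wt \<omega> P k i\<close> is the weight of \<open>P\<close> when its root is in layer \<open>k\<close> and its first leaf at
  position \<open>i\<close>.\<close>

primrec wt :: "(nat \<Rightarrow> nat \<Rightarrow> nat \<Rightarrow> nat) \<Rightarrow> ptree \<Rightarrow> nat \<Rightarrow> nat \<Rightarrow> nat" where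
  "wt \<omega> (PLeaf v) k i = \<omega> v k i"
| "wt \<omega> (PNode a b) k i = wt \<omega> a (Suc k) i + wt \<omega> b (Suc k) (i + psize a)"

lemma wt_linear:
  "wt (\<lambda>v k i. K * f v k i + g v k i) P k i = K * wt f P k i + wt g P k i"
  by (induction P arbitrary: k i) (simp_all add: algebra_simps)

text \<open>Reducing leaf by leaf keeps the exponents of \<open>y\<close> small, while the reduced
  sum still determines the residue of the unreduced one.\<close>

lemma wt_mod: "wt (\<lambda>v k i. f v k i mod q) P k i mod q = wt f P k i mod q"
proof (induction P arbitrary: k i)
  case (PNode a b)
  show ?case unfolding wt.simps by (rule mod_add_cong[OF PNode.IH])
qed simp

lemma wt_le:
  assumes "\<And>v k' i'. v \<in> pvars P \<Longrightarrow> k \<le> k' \<Longrightarrow> k' < k + psize P \<Longrightarrow> i \<le> i' \<Longrightarrow> i' < i + psize P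
    \<Longrightarrow> \<omega> v k' i' \<le> B"
  shows "wt \<omega> P k i \<le> psize P * B"
  using assms
proof (induction P arbitrary: k i)
  case (PNode a b)
  have sz: "psize a > 0" "psize b > 0" by (rule psize_pos)+
  have "wt \<omega> a (Suc k) i \<le> psize a * B"
    by (rule PNode.IH(1), rule PNode.prems) (use sz in auto)
  moreover have "wt \<omega> b (Suc k) (i + psize a) \<le> psize b * B"
    by (rule PNode.IH(2), rule PNode.prems) (use sz in auto)
  ultimately show ?case by (simp add: algebra_simps)
qed simp

section \<open>Recovering a plane tree from a sum of powers of two over its leaves\<close>

primrec leaves :: "ptree \<Rightarrow> nat \<Rightarrow> (nat \<times> nat) list" where
  "leaves (PLeaf v) k = [(v, k)]"
| "leaves (PNode a b) k = leaves a (Suc k) @ leaves b (Suc k)"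

lemma length_leaves [simp]: "length (leaves P k) = psize P"
  by (induction P arbitrary: k) auto

lemma set_leaves: "(v, j) \<in> set (leaves P k) \<Longrightarrow> v \<in> pvars P \<and> k \<le> j \<and> j < k + psize P"
proof (induction P arbitrary: k)
  case (PNode a b)
  have "psize a > 0" "psize b > 0" by (rule psize_pos)+
  then show ?case using PNode by fastforce
qed auto

lemma hd_leaves_PNode: "k < snd (hd (leaves (PNode a b) k @ xs))"
proof -
  have "leaves a (Suc k) \<noteq> []" using length_leaves[of a "Suc k"] psize_pos[of a]
    by (metis less_numeral_extra(3) list.size(3))
  then have "hd (leaves (PNode a b) k @ xs) \<in> set (leaves a (Suc k))" by simp
  then show ?thesis using set_leaves[of "fst (hd (leaves (PNode a b) k @ xs))" "snd (hd (leaves (PNode a b) k @ xs))" a "Suc k"]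
    by (metis Suc_le_lessD prod.collapse)
qed

text \<open>Leaves with their depths form a prefix-free encoding: the first entry has depth
  \<open>k\<close> exactly when the tree is a single leaf. The arbitrary suffixes let the induction
  pass from the left subtree to the right one.\<close>

lemma leaves_append_cancel:
  "leaves a k @ xs = leaves b k @ ys \<Longrightarrow> a = b \<and> xs = ys"
proof (induction a arbitrary: b k xs ys)
  case (PLeaf v)
  show ?case
  proof (cases b)
    case (PNode c e)
    then show ?thesis using PLeaf hd_leaves_PNode[of k c e ys] by (metis append_Cons leaves.simps(1) less_irrefl list.sel(1) snd_conv)
  qed (use PLeaf in auto)
next
  case (PNode a1 a2)
  show ?case
  proof (cases b)
    case (PLeaf v)
    then show ?thesis using PNode.prems hd_leaves_PNode[of k a1 a2 xs] by (metis append_Cons leaves.simps(1) less_irrefl list.sel(1) snd_conv)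
  next
    case b: (PNode b1 b2)
    have "leaves a1 (Suc k) @ (leaves a2 (Suc k) @ xs) = leaves b1 (Suc k) @ (leaves b2 (Suc k) @ ys)"
      using PNode.prems b by simp
    from PNode.IH(1)[OF this] have 1: "a1 = b1" "leaves a2 (Suc k) @ xs = leaves b2 (Suc k) @ ys" by auto
    from PNode.IH(2)[OF 1(2)] 1 b show ?thesis by auto
  qed
qed

text \<open>The position \<open>i\<close> is the most significant digit, so in a sum of powers of two along the leaves
  the lowest bit identifies the first leaf.\<close>

definition lidx :: "nat \<Rightarrow> nat \<Rightarrow> nat \<Rightarrow> nat \<Rightarrow> nat" where
  "lidx R v k i = (i * R + v) * R + k"

primrec code :: "nat \<Rightarrow> (nat \<times> nat) list \<Rightarrow> nat \<Rightarrow> nat" where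
  "code R [] i = 0"
| "code R (x # xs) i = 2 ^ lidx R (fst x) (snd x) i + code R xs (Suc i)"

lemma code_append: "code R (xs @ ys) i = code R xs i + code R ys (i + length xs)"
  by (induction xs arbitrary: i) auto

lemma wt_pow2: "wt (\<lambda>v k i. 2 ^ lidx R v k i) P k i = code R (leaves P k) i"
  by (induction P arbitrary: k i) (simp_all add: code_append)

text \<open>The leaves from position \<open>i\<close> on touch only bits from
  \<open>i * R * R\<close> upwards, so the residue modulo the next power of this kind shows the leaf
  at position \<open>i\<close> alone.\<close>

lemma code_dvd: "2 ^ (i * R * R) dvd code R xs i"
proof (induction xs arbitrary: i)
  case (Cons x xs)
  have "(2::nat) ^ (i * R * R) dvd 2 ^ lidx R (fst x) (snd x) i"
    by (rule le_imp_power_dvd) (simp add: lidx_def algebra_simps)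
  moreover have "(2::nat) ^ (i * R * R) dvd 2 ^ (Suc i * R * R)"
    by (rule le_imp_power_dvd) (simp add: algebra_simps)
  then have "2 ^ (i * R * R) dvd code R xs (Suc i)"
    using Cons.IH[of "Suc i"] dvd_trans by blast
  ultimately show ?case by simp
qed simp

lemma lidx_less: "v < R \<Longrightarrow> k < R \<Longrightarrow> lidx R v k i < Suc i * R * R"
proof -
  assume a: "v < R" "k < R"
  have "v * R + k < v * R + R" using a by simp
  also have "\<dots> = Suc v * R" by simp
  also have "\<dots> \<le> R * R" using a by (intro mult_le_mono1) simp
  finally show ?thesis by (simp add: lidx_def algebra_simps)
qed

lemma lidx_inj:
  assumes "lidx R v k i = lidx R v' k' i" "k < R" "k' < R"
  shows "v = v' \<and> k = k'"
proof -
  have R: "R > 0" using assms by simp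
  have "lidx R v k i mod R = k" "lidx R v' k' i mod R = k'"
    using assms(2,3) by (simp_all add: lidx_def)
  then have k: "k = k'" using assms by simp
  then have "(i * R + v) * R = (i * R + v') * R" using assms by (simp add: lidx_def)
  then show ?thesis using k R by simp
qed

lemma code_inj:
  assumes "length xs = length ys" "\<And>x. x \<in> set xs \<union> set ys \<Longrightarrow> fst x < R \<and> snd x < R"
    "code R xs i = code R ys i"
  shows "xs = ys"
  using assms
proof (induction xs ys arbitrary: i rule: list_induct2)
  case (Cons x xs y ys)
  let ?M = "(2::nat) ^ (Suc i * R * R)"
  let ?x = "(2::nat) ^ lidx R (fst x) (snd x) i"
  let ?y = "(2::nat) ^ lidx R (fst y) (snd y) i"
  have xy: "fst x < R" "snd x < R" "fst y < R" "snd y < R" using Cons.prems(1) by auto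
  then have lt: "?x < ?M" "?y < ?M" using lidx_less by (simp_all del: mult_Suc)
  obtain A B where AB: "code R xs (Suc i) = ?M * A" "code R ys (Suc i) = ?M * B"
    using code_dvd[of "Suc i" R xs] code_dvd[of "Suc i" R ys] by (auto simp: dvd_def)
  have "?x + ?M * A = ?y + ?M * B" using Cons.prems(2) AB by simp
  then have "(?x + ?M * A) mod ?M = (?y + ?M * B) mod ?M" by simp
  then have e: "?x = ?y" using lt by (simp only: mod_mult_self2 mod_less)
  then have "lidx R (fst x) (snd x) i = lidx R (fst y) (snd y) i" by simp
  with lidx_inj[OF this] xy have "x = y" by (simp add: prod_eq_iff)
  moreover have "xs = ys"
  proof (rule Cons.IH)
    show "code R xs (Suc i) = code R ys (Suc i)" using Cons.prems(2) e by simp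
  qed (use Cons.prems(1) in auto)
  ultimately show ?case by simp
qed simp

text \<open>These weights separate all plane trees of one size, but they are exponentially large and
  useless as exponents of \<open>y\<close>. They serve only as the numbers that a small modulus has
  to keep apart.\<close>

lemma wt_pow2_inj:
  assumes "psize P = psize Q" "pvars P \<subseteq> {..<R}" "pvars Q \<subseteq> {..<R}" "k + psize P \<le> R"
    "wt (\<lambda>v k i. 2 ^ lidx R v k i) P k i = wt (\<lambda>v k i. 2 ^ lidx R v k i) Q k i"
  shows "P = Q"
proof -
  have "leaves P k = leaves Q k"
  proof (rule code_inj)
    fix x assume x: "x \<in> set (leaves P k) \<union> set (leaves Q k)"
    obtain v j where vj: "x = (v, j)" by force
    then have "v \<in> pvars P \<union> pvars Q \<and> j < k + psize P"
      using x set_leaves[of v j P k] set_leaves[of v j Q k] assms(1) by auto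
    then show "fst x < R \<and> snd x < R" using vj assms(2-4) by auto
  next
    show "length (leaves P k) = length (leaves Q k)" using assms(1) by simp
    show "code R (leaves P k) i = code R (leaves Q k) i" using assms(5) by (simp only: wt_pow2)
  qed
  then show ?thesis using leaves_append_cancel[of P k "[]" Q "[]"] by simp
qed

section \<open>Isolating weights\<close>

context field
begin

text \<open>Gaussian elimination by induction on the number of equations: equation \<open>N\<close>
  eliminates one unknown. The coefficients are generalised because the elimination changes
  them.\<close>

lemma ex_nontrivial_relation:
  assumes "finite J" "N < card J" "\<And>g j. g < N \<Longrightarrow> j \<in> J \<Longrightarrow> A g j \<in> carrier R"
  shows "\<exists>c. c \<in> J \<rightarrow> carrier R \<and> (\<exists>j \<in> J. c j \<noteq> \<zero>) \<and> (\<forall>g < N. (\<Oplus>j\<in>J. c j \<otimes> A g j) = \<zero>)"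
  using assms
proof (induction N arbitrary: J A)
  case 0
  then have "J \<noteq> {}" by auto
  then show ?case by (intro exI[of _ "\<lambda>_. \<one>"]) auto
next
  case (Suc N)
  show ?case
  proof (cases "\<forall>j\<in>J. A N j = \<zero>")
    case True
    from Suc.IH[of J A] Suc.prems obtain c where c: "c \<in> J \<rightarrow> carrier R" "\<exists>j \<in> J. c j \<noteq> \<zero>"
      "\<And>g. g < N \<Longrightarrow> (\<Oplus>j\<in>J. c j \<otimes> A g j) = \<zero>" by auto
    have "(\<Oplus>j\<in>J. c j \<otimes> A N j) = (\<Oplus>j\<in>J. \<zero>)"
      by (rule finsum_cong') (use True c in \<open>auto simp: Pi_def\<close>)
    then have "(\<Oplus>j\<in>J. c j \<otimes> A g j) = \<zero>" if "g < Suc N" for g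
      using that c(3) by (cases "g = N") auto
    then show ?thesis using c by blast
  next
    case False
    then obtain k where k: "k \<in> J" "A N k \<noteq> \<zero>" by auto
    define J' where "J' = J - {k}"
    have J: "J = insert k J'" "finite J'" "k \<notin> J'" using k Suc.prems by (auto simp: J'_def)
    have Ac: "A g j \<in> carrier R" if "g \<le> N" "j \<in> J" for g j using Suc.prems that by auto
    have kU: "A N k \<in> Units R" using k Ac field_Units by auto
    define r where "r j = inv (A N k) \<otimes> A N j" for j
    have rc: "r j \<in> carrier R" if "j \<in> J" for j using that Ac kU by (simp add: r_def)
    have "N < card J'" using J Suc.prems by auto
    \<comment> \<open>Subtracting \<open>r j\<close> times column \<open>k\<close> from column
      \<open>j\<close> clears row \<open>N\<close> outside the pivot.\<close>
    from Suc.IH[OF J(2) this, of "\<lambda>g j. A g j \<ominus> r j \<otimes> A g k"]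
    obtain c where c: "c \<in> J' \<rightarrow> carrier R" "\<exists>j \<in> J'. c j \<noteq> \<zero>"
      "\<And>g. g < N \<Longrightarrow> (\<Oplus>j\<in>J'. c j \<otimes> (A g j \<ominus> r j \<otimes> A g k)) = \<zero>"
      using Ac rc J k by auto
    define t where "t = (\<Oplus>j\<in>J'. c j \<otimes> r j)"
    have tc: "t \<in> carrier R" unfolding t_def using c rc J by (auto intro!: finsum_closed)
    \<comment> \<open>With this value of unknown \<open>k\<close>, the sums over the original
      columns equal the sums over the modified ones.\<close>
    define c' where "c' j = (if j = k then \<ominus> t else c j)" for j
    have c': "c' \<in> J \<rightarrow> carrier R" using c tc J by (auto simp: c'_def)
    have sm: "(\<Oplus>j\<in>J. c' j \<otimes> A g j) = (\<Oplus>j\<in>J'. c j \<otimes> (A g j \<ominus> r j \<otimes> A g k))"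
      if g: "g \<le> N" for g
    proof -
      have cl: "\<And>j. j \<in> J' \<Longrightarrow> c j \<in> carrier R" "\<And>j. j \<in> J' \<Longrightarrow> r j \<in> carrier R"
        "\<And>j. j \<in> J' \<Longrightarrow> A g j \<in> carrier R" "A g k \<in> carrier R"
        using c(1) rc Ac g J by auto
      have "(\<Oplus>j\<in>J'. c j \<otimes> (A g j \<ominus> r j \<otimes> A g k))
          = (\<Oplus>j\<in>J'. c j \<otimes> A g j \<oplus> (c j \<otimes> r j) \<otimes> (\<ominus> A g k))"
        by (rule finsum_cong') (use cl in \<open>auto simp: minus_eq r_distr r_minus m_assoc\<close>)
      also have "\<dots> = (\<Oplus>j\<in>J'. c j \<otimes> A g j) \<oplus> (\<Oplus>j\<in>J'. (c j \<otimes> r j) \<otimes> (\<ominus> A g k))"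
        by (rule finsum_addf) (use cl in auto)
      also have "(\<Oplus>j\<in>J'. (c j \<otimes> r j) \<otimes> (\<ominus> A g k)) = t \<otimes> (\<ominus> A g k)"
        unfolding t_def by (rule finsum_ldistr[symmetric]) (use cl J in auto)
      also have "\<dots> = (\<ominus> t) \<otimes> A g k" using tc cl by (simp add: l_minus r_minus)
      also have "(\<Oplus>j\<in>J'. c j \<otimes> A g j) = (\<Oplus>j\<in>J'. c' j \<otimes> A g j)"
        by (rule finsum_cong') (use cl J in \<open>auto simp: c'_def\<close>)
      also have "\<dots> \<oplus> (\<ominus> t) \<otimes> A g k = (\<Oplus>j\<in>J. c' j \<otimes> A g j)"
      proof -
        have f: "(\<lambda>j. c' j \<otimes> A g j) \<in> J' \<rightarrow> carrier R" using c' cl J by auto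
        have "(\<Oplus>j\<in>J. c' j \<otimes> A g j) = c' k \<otimes> A g k \<oplus> (\<Oplus>j\<in>J'. c' j \<otimes> A g j)"
          unfolding J(1) by (rule finsum_insert) (use f J c' cl in auto)
        also have "\<dots> = (\<Oplus>j\<in>J'. c' j \<otimes> A g j) \<oplus> c' k \<otimes> A g k"
          using f c' cl J by (intro a_comm finsum_closed) auto
        finally show ?thesis by (simp add: c'_def)
      qed
      finally show ?thesis by simp
    qed
    have "A N j \<ominus> r j \<otimes> A N k = \<zero>" if "j \<in> J'" for j
    proof -
      have "r j \<otimes> A N k = (inv (A N k) \<otimes> A N k) \<otimes> A N j"
        unfolding r_def using Ac that J kU by (simp add: m_ac)
      then show ?thesis using Ac that J kU by (simp add: minus_eq r_neg)
    qed
    then have "(\<Oplus>j\<in>J'. c j \<otimes> (A N j \<ominus> r j \<otimes> A N k)) = (\<Oplus>j\<in>J'. \<zero>)"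
      by (intro finsum_cong') (use c in \<open>auto simp: Pi_def\<close>)
    then have "(\<Oplus>j\<in>J. c' j \<otimes> A g j) = \<zero>" if "g < Suc N" for g
      using that sm[of g] c(3)[of g] by (cases "g = N") auto
    moreover have "\<exists>j\<in>J. c' j \<noteq> \<zero>" using c(2) J by (auto simp: c'_def)
    ultimately show ?thesis using c' by blast
  qed
qed

end

section \<open>Linear forms in the gate coefficients, and essential trees\<close>

text \<open>The linear span of \<open>V 0\<close>, ..., \<open>V (N - 1)\<close> under pointwise
  operations. Given inductively, it lets every linear property be proved by rule induction.\<close>

inductive_set forms :: "'a ring \<Rightarrow> (nat \<Rightarrow> 'b \<Rightarrow> 'a) \<Rightarrow> nat \<Rightarrow> ('b \<Rightarrow> 'a) set"
  for F :: "'a ring" and V :: "nat \<Rightarrow> 'b \<Rightarrow> 'a" and N :: nat where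
  zero: "(\<lambda>_. \<zero>\<^bsub>F\<^esub>) \<in> forms F V N"
| coord: "g < N \<Longrightarrow> V g \<in> forms F V N"
| add: "\<phi> \<in> forms F V N \<Longrightarrow> \<psi> \<in> forms F V N \<Longrightarrow> (\<lambda>P. \<phi> P \<oplus>\<^bsub>F\<^esub> \<psi> P) \<in> forms F V N"
| smult: "a \<in> carrier F \<Longrightarrow> \<phi> \<in> forms F V N \<Longrightarrow> (\<lambda>P. a \<otimes>\<^bsub>F\<^esub> \<phi> P) \<in> forms F V N"

text \<open>With a strict height bound there is no tree for \<open>h = 0\<close>, so the induction
  on heights starts with nothing to separate; product depth \<Delta> corresponds to
  \<open>h = Suc \<Delta>\<close>.\<close>

definition trees_below :: "nat \<Rightarrow> nat \<Rightarrow> nat \<Rightarrow> ptree set" where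
  "trees_below n h D = {P. pheight P < h \<and> psize P = D \<and> pvars P \<subseteq> {1..n}}"

text \<open>Only trees with equally many leaves compete. Exchanging a subtree for a competitor then
  leaves all later leaves at their positions, so the weight of the rest of the tree does not
  change.\<close>

definition essential :: "'a ring \<Rightarrow> (nat \<Rightarrow> ptree \<Rightarrow> 'a) \<Rightarrow> nat \<Rightarrow> nat \<Rightarrow> (nat \<Rightarrow> nat \<Rightarrow> nat \<Rightarrow> nat)
    \<Rightarrow> nat \<Rightarrow> nat \<Rightarrow> nat \<Rightarrow> nat \<Rightarrow> ptree set" where
  "essential F V N n \<omega> h k i D = {P \<in> trees_below n h D. \<exists>\<phi> \<in> forms F V N. \<phi> P \<noteq> \<zero>\<^bsub>F\<^esub> \<and>
     (\<forall>Q \<in> trees_below n h D. wt \<omega> Q k i < wt \<omega> P k i \<longrightarrow> \<phi> Q = \<zero>\<^bsub>F\<^esub>)}"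

text \<open>The layers and positions a tree with \<open>D\<close> leaves can occupy inside a tree with at most \<open>d\<close>
  leaves.\<close>

definition slot :: "nat \<Rightarrow> nat \<Rightarrow> nat \<Rightarrow> nat \<Rightarrow> bool" where
  "slot d k i D \<longleftrightarrow> 1 \<le> k \<and> 1 \<le> i \<and> 1 \<le> D \<and> k + D \<le> d + 1 \<and> i + D \<le> d + 1"

text \<open>Each further height contributes the summand of lowest priority. The digit
  \<open>g h\<close> stands for the modulus \<open>g h + 2\<close>, so every natural number is a
  legal digit.\<close>

primrec horner :: "nat \<Rightarrow> nat \<Rightarrow> (nat \<Rightarrow> nat) \<Rightarrow> nat \<Rightarrow> nat \<Rightarrow> nat \<Rightarrow> nat \<Rightarrow> nat" where
  "horner B K g 0 = (\<lambda>v k i. 0)"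
| "horner B K g (Suc h) = (\<lambda>v k i. K * horner B K g h v k i + 2 ^ lidx B v k i mod (g h + 2))"

lemma horner_cong: "(\<And>j. j < h \<Longrightarrow> g j = g' j) \<Longrightarrow> horner B K g h = horner B K g' h"
  by (induction h) auto

text \<open>All that the isolation argument uses of a circuit: \<open>V g P\<close> plays the
  coefficient of the plane tree \<open>P\<close> at gate \<open>g\<close>, and \<open>V_step\<close>
  says that fixing the right subtree leaves a linear combination of the same coefficients in the
  left one.\<close>

locale linear_forms = field R for R (structure) +
  fixes V :: "nat \<Rightarrow> ptree \<Rightarrow> 'a" and N :: nat
  assumes V_closed: "g < N \<Longrightarrow> V g P \<in> carrier R"
    and V_step: "g < N \<Longrightarrow> (\<lambda>Q. V g (PNode Q P)) \<in> forms R V N"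
    and V_swap: "g < N \<Longrightarrow> V g (PNode P Q) = V g (PNode Q P)"
begin

lemma forms_closed: "\<phi> \<in> forms R V N \<Longrightarrow> \<phi> P \<in> carrier R"
  by (induction rule: forms.induct) (auto simp: V_closed)

lemma forms_left: "\<phi> \<in> forms R V N \<Longrightarrow> (\<lambda>Q. \<phi> (PNode Q P)) \<in> forms R V N"
  by (induction rule: forms.induct) (auto simp: V_step intro: forms.intros)

lemma forms_swap: "\<phi> \<in> forms R V N \<Longrightarrow> \<phi> (PNode P Q) = \<phi> (PNode Q P)"
  by (induction rule: forms.induct) (simp_all add: V_swap[of _ P Q])

lemma forms_right: "\<phi> \<in> forms R V N \<Longrightarrow> (\<lambda>Q. \<phi> (PNode P Q)) \<in> forms R V N"
  using forms_left[of \<phi> P] by (simp only: forms_swap[of \<phi> P])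

lemma forms_relation:
  assumes "finite J" "c \<in> J \<rightarrow> carrier R"
    "\<And>g. g < N \<Longrightarrow> (\<Oplus>P\<in>J. c P \<otimes> V g P) = \<zero>" "\<phi> \<in> forms R V N"
  shows "(\<Oplus>P\<in>J. c P \<otimes> \<phi> P) = \<zero>"
  using assms(4)
proof (induction rule: forms.induct)
  case zero
  have "(\<Oplus>P\<in>J. c P \<otimes> \<zero>) = (\<Oplus>P\<in>J. \<zero>)" by (rule finsum_cong') (use assms in \<open>auto simp: Pi_def\<close>)
  then show ?case by simp
next
  case (coord g)
  then show ?case using assms by auto
next
  case (add \<phi> \<psi>)
  have "(\<Oplus>P\<in>J. c P \<otimes> (\<phi> P \<oplus> \<psi> P)) = (\<Oplus>P\<in>J. c P \<otimes> \<phi> P \<oplus> c P \<otimes> \<psi> P)"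
    by (rule finsum_cong') (use assms forms_closed add in \<open>auto simp: r_distr Pi_def\<close>)
  also have "\<dots> = (\<Oplus>P\<in>J. c P \<otimes> \<phi> P) \<oplus> (\<Oplus>P\<in>J. c P \<otimes> \<psi> P)"
    by (rule finsum_addf) (use assms forms_closed add in \<open>auto simp: Pi_def\<close>)
  finally show ?case using add by simp
next
  case (smult a \<phi>)
  have "(\<Oplus>P\<in>J. c P \<otimes> (a \<otimes> \<phi> P)) = (\<Oplus>P\<in>J. a \<otimes> (c P \<otimes> \<phi> P))"
    by (rule finsum_cong') (use assms forms_closed smult in \<open>auto simp: m_lcomm Pi_def\<close>)
  also have "\<dots> = a \<otimes> (\<Oplus>P\<in>J. c P \<otimes> \<phi> P)"
    by (rule finsum_rdistr[symmetric]) (use assms forms_closed smult in \<open>auto simp: Pi_def\<close>)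
  finally show ?case using smult by simp
qed

text \<open>More than \<open>N\<close> trees would satisfy a nontrivial relation valid for all
  forms. At its heaviest tree with nonzero coefficient, the form attached to that tree vanishes on
  all lighter trees, and heavier ones do not occur in the relation, so a single nonzero term would
  have to be zero.\<close>

lemma triangular_card_le:
  fixes w :: "ptree \<Rightarrow> nat"
  assumes "finite S" "inj_on w S"
    "\<And>P. P \<in> S \<Longrightarrow> \<exists>\<phi> \<in> forms R V N. \<phi> P \<noteq> \<zero> \<and> (\<forall>Q \<in> S. w Q < w P \<longrightarrow> \<phi> Q = \<zero>)"
  shows "card S \<le> N"
proof (rule ccontr)
  assume "\<not> card S \<le> N"
  with ex_nontrivial_relation[of S N V] assms(1) V_closed
  obtain c where c: "c \<in> S \<rightarrow> carrier R" "\<exists>j\<in>S. c j \<noteq> \<zero>"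
    "\<And>g. g < N \<Longrightarrow> (\<Oplus>P\<in>S. c P \<otimes> V g P) = \<zero>" by auto
  define S' where "S' = {P \<in> S. c P \<noteq> \<zero>}"
  have S': "finite S'" "S' \<noteq> {}" using c assms(1) by (auto simp: S'_def)
  then have "Max (w ` S') \<in> w ` S'" by (intro Max_in) auto
  then obtain P where P: "P \<in> S'" "w P = Max (w ` S')" by auto
  have max: "w Q \<le> w P" if "Q \<in> S'" for Q using that S' P by simp
  have PS: "P \<in> S" "c P \<noteq> \<zero>" using P by (auto simp: S'_def)
  from assms(3)[OF PS(1)] obtain \<phi> where \<phi>: "\<phi> \<in> forms R V N" "\<phi> P \<noteq> \<zero>"
    "\<And>Q. Q \<in> S \<Longrightarrow> w Q < w P \<Longrightarrow> \<phi> Q = \<zero>" by auto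
  have z: "c Q \<otimes> \<phi> Q = \<zero>" if "Q \<in> S" "Q \<noteq> P" for Q
  proof (cases "c Q = \<zero>")
    case False
    then have "w Q \<le> w P" using max that by (auto simp: S'_def)
    moreover have "w Q \<noteq> w P" using assms(2) that PS by (auto simp: inj_on_def)
    ultimately show ?thesis using \<phi>(3)[OF that(1)] c(1) that(1) by (simp add: Pi_def)
  qed (use forms_closed \<phi> in auto)
  have "(\<Oplus>Q\<in>S. c Q \<otimes> \<phi> Q) = (\<Oplus>Q\<in>S. if P = Q then c Q \<otimes> \<phi> Q else \<zero>)"
    by (rule finsum_cong') (use z c \<phi> forms_closed in \<open>auto simp: Pi_def\<close>)
  also have "\<dots> = c P \<otimes> \<phi> P"
    by (rule finsum_singleton) (use PS assms c \<phi> forms_closed in \<open>auto simp: Pi_def\<close>)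
  finally have "c P \<otimes> \<phi> P = \<zero>" using forms_relation[OF assms(1) c(1,3) \<phi>(1)] by simp
  then show False using integral[of "c P" "\<phi> P"] PS \<phi> c forms_closed by auto
qed

lemma essential_card_le:
  assumes "inj_on (\<lambda>P. wt \<omega> P k i) (essential R V N n \<omega> h k i D)"
  shows "finite (essential R V N n \<omega> h k i D) \<and> card (essential R V N n \<omega> h k i D) \<le> N"
proof (rule finite_if_finite_subsets_card_bdd)
  \<comment> \<open>The bound for finite subsets yields the finiteness of the whole set as
    well.\<close>
  fix G assume G: "G \<subseteq> essential R V N n \<omega> h k i D" "finite G"
  show "card G \<le> N"
  proof (rule triangular_card_le[OF G(2)])
    show "inj_on (\<lambda>P. wt \<omega> P k i) G" using assms G inj_on_subset by blast
    fix P assume "P \<in> G"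
    then show "\<exists>\<phi>\<in>forms R V N. \<phi> P \<noteq> \<zero> \<and> (\<forall>Q\<in>G. wt \<omega> Q k i < wt \<omega> P k i \<longrightarrow> \<phi> Q = \<zero>)"
      using G(1) unfolding essential_def by blast
  qed
qed

text \<open>As \<open>\<rho>\<close> stays below \<open>K\<close>, replacing a subtree by a \<open>\<omega>\<close>-lighter one makes the whole tree
  \<open>\<omega>'\<close>-lighter.\<close>

lemma essential_PNode:
  assumes ess: "PNode a b \<in> essential R V N n \<omega>' (Suc h) k i D"
    and \<omega>': "\<omega>' = (\<lambda>v k i. K * \<omega> v k i + \<rho> v k i)"
    and small: "\<And>P. P \<in> trees_below n (Suc h) D \<Longrightarrow> wt \<rho> P k i < K"
  shows "a \<in> essential R V N n \<omega> h (Suc k) i (psize a)"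
    and "b \<in> essential R V N n \<omega> h (Suc k) (i + psize a) (psize b)"
proof -
  from ess obtain \<phi> where \<phi>: "\<phi> \<in> forms R V N" "\<phi> (PNode a b) \<noteq> \<zero>"
    "\<And>Q. Q \<in> trees_below n (Suc h) D \<Longrightarrow> wt \<omega>' Q k i < wt \<omega>' (PNode a b) k i \<Longrightarrow> \<phi> Q = \<zero>"
    by (auto simp: essential_def)
  have ab: "PNode a b \<in> trees_below n (Suc h) D" using ess by (simp add: essential_def)
  have less: "wt \<omega>' Q k i < wt \<omega>' (PNode a b) k i"
    if "wt \<omega> Q k i < wt \<omega> (PNode a b) k i" "Q \<in> trees_below n (Suc h) D" for Q
  proof -
    have "K * wt \<omega> Q k i + wt \<rho> Q k i < K * (wt \<omega> Q k i + 1)"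
      using small[OF that(2)] by simp
    also have "\<dots> \<le> K * wt \<omega> (PNode a b) k i" using that(1) by (intro mult_le_mono2) simp
    finally show ?thesis unfolding \<omega>' wt_linear by linarith
  qed
  show "a \<in> essential R V N n \<omega> h (Suc k) i (psize a)"
  proof -
    have "\<phi> (PNode Q b) = \<zero>" if Q: "Q \<in> trees_below n h (psize a)"
      "wt \<omega> Q (Suc k) i < wt \<omega> a (Suc k) i" for Q
    proof -
      have Qt: "PNode Q b \<in> trees_below n (Suc h) D" using Q(1) ab by (auto simp: trees_below_def)
      have "psize Q = psize a" using Q(1) by (simp add: trees_below_def)
      then show ?thesis by (intro \<phi>(3)[OF Qt] less[OF _ Qt]) (use Q(2) in simp)
    qed
    moreover have "a \<in> trees_below n h (psize a)" using ab by (auto simp: trees_below_def)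
    ultimately show ?thesis unfolding essential_def
      by (intro CollectI conjI bexI[OF _ forms_left[OF \<phi>(1), of b]]) (use \<phi>(2) in auto)
  qed
  show "b \<in> essential R V N n \<omega> h (Suc k) (i + psize a) (psize b)"
  proof -
    have "\<phi> (PNode a Q) = \<zero>" if Q: "Q \<in> trees_below n h (psize b)"
      "wt \<omega> Q (Suc k) (i + psize a) < wt \<omega> b (Suc k) (i + psize a)" for Q
    proof -
      have Qt: "PNode a Q \<in> trees_below n (Suc h) D" using Q(1) ab by (auto simp: trees_below_def)
      then show ?thesis by (intro \<phi>(3)[OF Qt] less[OF _ Qt]) (use Q(2) in simp)
    qed
    moreover have "b \<in> trees_below n h (psize b)" using ab by (auto simp: trees_below_def)
    ultimately show ?thesis unfolding essential_def
      by (intro CollectI conjI bexI[OF _ forms_right[OF \<phi>(1), of a]]) (use \<phi>(2) in auto)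
  qed
qed

section \<open>Choosing the moduli, one height after the other\<close>

definition isolating :: "nat \<Rightarrow> nat \<Rightarrow> (nat \<Rightarrow> nat \<Rightarrow> nat \<Rightarrow> nat) \<Rightarrow> nat \<Rightarrow> bool" where
  "isolating n d \<omega> h \<longleftrightarrow>
     (\<forall>k i D. slot d k i D \<longrightarrow> inj_on (\<lambda>P. wt \<omega> P k i) (essential R V N n \<omega> h k i D))"

text \<open>An essential tree of the next height is a leaf or joins two essential trees of smaller
  height. For each way to split the size this gives at most \<open>N * N\<close> trees, hence at
  most \<open>B ^ 2\<close> candidates in a slot and \<open>B ^ 4\<close> pairs of them. With fewer
  than \<open>B ^ 3\<close> slots there are at most \<open>B ^ 7\<close> pairs of codes, each code
  below \<open>2 ^ B ^ 4\<close>, whence a modulus up to \<open>2 * B ^ 11 + 1\<close>.\<close>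

lemma isolating_step:
  assumes iso: "isolating n d \<omega> h" and d: "1 \<le> d" "d < B" "n < B" "n + d * N * N \<le> B * B"
  shows "\<exists>q \<ge> 2. q \<le> 2 * B ^ 11 + 1 \<and> (\<forall>K. d * q \<le> K \<longrightarrow>
    isolating n d (\<lambda>v k i. K * \<omega> v k i + 2 ^ lidx B v k i mod q) (Suc h))"
proof -
  let ?p = "\<lambda>v k i. (2::nat) ^ lidx B v k i"
  define E where "E k i D = essential R V N n \<omega> h k i D" for k i D
  have E: "finite (E k i D)" "card (E k i D) \<le> N" if "slot d k i D" for k i D
    using essential_card_le[of \<omega> k i n h D] iso that by (auto simp: isolating_def E_def)
  \<comment> \<open>These do not depend on the modulus, although the essential trees of the next height do.\<close>
  define cand where "cand k i D = PLeaf ` {1..n} \<union>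
    (\<Union>D1\<in>{1..<D}. (\<lambda>(a, b). PNode a b) ` (E (Suc k) i D1 \<times> E (Suc k) (i + D1) (D - D1)))" for k i D
  \<comment> \<open>Leaves are candidates for every \<open>D\<close>. This discards them where they
    have the wrong size, as codes are known to differ only for trees of equal size.\<close>
  define good where "good D P \<longleftrightarrow> psize P = D \<and> pvars P \<subseteq> {1..n}" for D P
  have sl: "slot d (Suc k) i D1" "slot d (Suc k) (i + D1) (D - D1)"
    if "slot d k i D" "1 \<le> D1" "D1 < D" for k i D D1
    using that by (auto simp: slot_def)
  have cand_fin: "finite (cand k i D)" if "slot d k i D" for k i D
    unfolding cand_def using E sl[OF that] by auto
  have cand_card: "card (cand k i D) \<le> B * B" if s: "slot d k i D" for k i D
  proof -
    have 1: "card ((\<lambda>(a, b). PNode a b) ` (E (Suc k) i D1 \<times> E (Suc k) (i + D1) (D - D1))) \<le> N * N"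
      if "D1 \<in> {1..<D}" for D1
    proof -
      have "card ((\<lambda>(a, b). PNode a b) ` (E (Suc k) i D1 \<times> E (Suc k) (i + D1) (D - D1)))
          \<le> card (E (Suc k) i D1 \<times> E (Suc k) (i + D1) (D - D1))"
        using E sl[OF s] that by (intro card_image_le) auto
      also have "\<dots> \<le> N * N" using E sl[OF s] that by (auto simp: card_cartesian_product intro!: mult_mono)
      finally show ?thesis .
    qed
    have "card (cand k i D) \<le> card (PLeaf ` {1..n}) +
      card (\<Union>D1\<in>{1..<D}. (\<lambda>(a, b). PNode a b) ` (E (Suc k) i D1 \<times> E (Suc k) (i + D1) (D - D1)))"
      unfolding cand_def by (rule card_Un_le)
    also have "card (PLeaf ` {1..n}) \<le> n" using card_image_le[of "{1..n}" PLeaf] by simp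
    also have "card (\<Union>D1\<in>{1..<D}. (\<lambda>(a, b). PNode a b) ` (E (Suc k) i D1 \<times> E (Suc k) (i + D1) (D - D1)))
      \<le> (\<Sum>D1\<in>{1..<D}. card ((\<lambda>(a, b). PNode a b) ` (E (Suc k) i D1 \<times> E (Suc k) (i + D1) (D - D1))))"
      by (rule card_UN_le) simp
    also have "\<dots> \<le> (\<Sum>D1\<in>{1..<D}. N * N)" by (rule sum_mono) (rule 1)
    also have "\<dots> \<le> d * N * N"
      using s by (auto simp: slot_def mult.assoc intro!: mult_le_mono1)
    finally show ?thesis using d by linarith
  qed
  define A where "A = (\<Union>(k, i, D)\<in>{1..d} \<times> {1..d} \<times> {1..d}. if slot d k i D then
     (\<lambda>(P, Q). (wt ?p P k i, wt ?p Q k i)) `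
       {(P, Q) \<in> cand k i D \<times> cand k i D. P \<noteq> Q \<and> good D P \<and> good D Q} else {})"
  have A1: "finite ((\<lambda>(P, Q). (wt ?p P k i, wt ?p Q k i)) `
      {(P, Q) \<in> cand k i D \<times> cand k i D. P \<noteq> Q \<and> good D P \<and> good D Q}) \<and>
      card ((\<lambda>(P, Q). (wt ?p P k i, wt ?p Q k i)) `
       {(P, Q) \<in> cand k i D \<times> cand k i D. P \<noteq> Q \<and> good D P \<and> good D Q}) \<le> B ^ 4"
    if s: "slot d k i D" for k i D
  proof -
    have f: "finite {(P, Q) \<in> cand k i D \<times> cand k i D. P \<noteq> Q \<and> good D P \<and> good D Q}"
      by (rule finite_subset[of _ "cand k i D \<times> cand k i D"]) (use cand_fin[OF s] in auto)
    have "card ((\<lambda>(P, Q). (wt ?p P k i, wt ?p Q k i)) `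
       {(P, Q) \<in> cand k i D \<times> cand k i D. P \<noteq> Q \<and> good D P \<and> good D Q}) \<le>
       card {(P, Q) \<in> cand k i D \<times> cand k i D. P \<noteq> Q \<and> good D P \<and> good D Q}"
      by (rule card_image_le[OF f])
    also have "\<dots> \<le> card (cand k i D \<times> cand k i D)"
      by (rule card_mono) (use cand_fin[OF s] in auto)
    also have "\<dots> \<le> (B * B) * (B * B)"
      using cand_card[OF s] by (simp only: card_cartesian_product mult_mono)
    also have "\<dots> = B ^ 4" by (simp add: eval_nat_numeral)
    finally show ?thesis using f by simp
  qed
  have Afin: "finite A" unfolding A_def using A1 by auto
  have Acard: "card A \<le> B ^ 7"
  proof -
    have "card A \<le> (\<Sum>(k, i, D)\<in>{1..d} \<times> {1..d} \<times> {1..d}. B ^ 4)"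
      unfolding A_def
      by (rule order.trans[OF card_UN_le sum_mono]) (use A1 in auto)
    also have "\<dots> = d * (d * d) * B ^ 4" by simp
    also have "\<dots> \<le> B * (B * B) * B ^ 4" using d by (intro mult_le_mono) auto
    also have "\<dots> = B ^ 7" by (simp add: eval_nat_numeral)
    finally show ?thesis .
  qed
  have B2: "B \<ge> 2" using d by simp
  have code_small: "wt ?p P k i < 2 ^ B ^ 4" if s: "slot d k i D" and P: "good D P" for k i D P
  proof -
    have "wt ?p P k i \<le> psize P * 2 ^ B ^ 3"
    proof (rule wt_le)
      fix v k' i' assume a: "v \<in> pvars P" "k' < k + psize P" "i' < i + psize P"
      then have "v < B" "k' < B" "Suc i' \<le> B" using s P d by (auto simp: slot_def good_def)
      then have "lidx B v k' i' < Suc i' * B * B" by (intro lidx_less)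
      also have "\<dots> \<le> B * B * B" using \<open>Suc i' \<le> B\<close> by (intro mult_le_mono1)
      also have "\<dots> = B ^ 3" by (simp add: eval_nat_numeral)
      finally show "?p v k' i' \<le> 2 ^ B ^ 3" by (intro power_increasing) auto
    qed
    also have "\<dots> < 2 ^ B * 2 ^ B ^ 3"
    proof (rule mult_strict_right_mono)
      have "psize P \<le> B" using s P d by (auto simp: slot_def good_def)
      then show "psize P < 2 ^ B" using less_exp[of B] by linarith
    qed simp
    also have "(2::nat) ^ B * 2 ^ B ^ 3 = 2 ^ (B + B ^ 3)" by (simp add: power_add)
    also have "\<dots> \<le> 2 ^ B ^ 4"
    proof (rule power_increasing)
      have "B ^ 1 \<le> B ^ 3" by (rule power_increasing) (use B2 in auto)
      then have "B + B ^ 3 \<le> 2 * B ^ 3" by simp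
      also have "\<dots> \<le> B * B ^ 3" using B2 by (intro mult_le_mono1)
      also have "\<dots> = B ^ 4" by (simp add: eval_nat_numeral)
      finally show "B + B ^ 3 \<le> B ^ 4" .
    qed simp
    finally show ?thesis .
  qed
  have Adiff: "x \<noteq> y \<and> x < 2 ^ B ^ 4 \<and> y < 2 ^ B ^ 4" if xy: "(x, y) \<in> A" for x y
  proof -
    from xy obtain k i D P Q where s: "slot d k i D" and PQ: "P \<noteq> Q" "good D P" "good D Q"
      and e: "x = wt ?p P k i" "y = wt ?p Q k i"
      by (auto simp: A_def split: if_splits)
    have "x \<noteq> y"
    proof
      assume "x = y"
      have "P = Q"
        by (rule wt_pow2_inj[of P Q B k i])
          (use PQ s d \<open>x = y\<close> e in \<open>auto simp: good_def slot_def\<close>)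
      with PQ show False by simp
    qed
    then show ?thesis using e code_small[OF s] PQ by auto
  qed
  have "B ^ 4 * B ^ 7 \<le> B ^ 11" by (simp add: eval_nat_numeral)
  moreover have "B ^ 11 \<ge> 1" using B2 by simp
  ultimately obtain q where q: "q \<ge> 2" "q \<le> 2 * B ^ 11 + 1" "\<forall>(a, b)\<in>A. a mod q \<noteq> b mod q"
    using exists_separating_modulus[OF Afin Acard Adiff] by blast
  have "isolating n d (\<lambda>v k i. K * \<omega> v k i + ?p v k i mod q) (Suc h)" if K: "d * q \<le> K" for K
    unfolding isolating_def
  proof (intro allI impI inj_onI)
    fix k i D P Q assume s: "slot d k i D"
    let ?\<omega> = "\<lambda>v k i. K * \<omega> v k i + ?p v k i mod q"
    let ?\<rho> = "\<lambda>v k i. ?p v k i mod q"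
    assume P: "P \<in> essential R V N n ?\<omega> (Suc h) k i D" and Q: "Q \<in> essential R V N n ?\<omega> (Suc h) k i D"
      and eq: "wt ?\<omega> P k i = wt ?\<omega> Q k i"
    \<comment> \<open>At most \<open>d\<close> leaves contribute at most \<open>q - 1\<close> each,
      so the new summand never carries over into the part multiplied by \<open>K\<close>.\<close>
    have small: "wt ?\<rho> T k i < K" if "T \<in> trees_below n (Suc h) D" for T
    proof -
      have "wt ?\<rho> T k i \<le> psize T * (q - 1)"
        by (rule wt_le) (use q in \<open>simp add: Suc_leI less_eq_Suc_le[symmetric] flip: less_Suc_eq_le\<close>)
      also have "\<dots> \<le> d * (q - 1)" using that s by (intro mult_le_mono1) (auto simp: trees_below_def slot_def)
      also have "\<dots> < d * q" using d q by simp
      finally show ?thesis using K by simp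
    qed
    have mem: "T \<in> cand k i D \<and> good D T \<and> T \<in> trees_below n (Suc h) D"
      if T: "T \<in> essential R V N n ?\<omega> (Suc h) k i D" for T
    proof -
      have tb: "T \<in> trees_below n (Suc h) D" using T by (simp add: essential_def)
      then have g: "good D T" by (simp add: trees_below_def good_def)
      have "T \<in> cand k i D"
      proof (cases T)
        case (PLeaf v)
        then show ?thesis using g by (auto simp: cand_def good_def)
      next
        case (PNode a b)
        have "a \<in> E (Suc k) i (psize a)" "b \<in> E (Suc k) (i + psize a) (psize b)"
          using essential_PNode[OF T[unfolded PNode] refl small] by (auto simp: E_def)
        moreover have "D = psize a + psize b" using g PNode by (simp add: good_def)
        moreover have "psize a > 0" "psize b > 0" by (rule psize_pos)+
        ultimately show ?thesis unfolding cand_def PNode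
          by (intro UnI2 UN_I[of "psize a"]) auto
      qed
      with g tb show ?thesis by simp
    qed
    note P' = mem[OF P] and Q' = mem[OF Q]
    \<comment> \<open>Read modulo \<open>K\<close>, equal total weights give equal new summands;
      read modulo \<open>q\<close>, these give equal residues of the binary codes, which the choice
      of \<open>q\<close> excludes for different candidates.\<close>
    have "K * wt \<omega> P k i + wt ?\<rho> P k i = K * wt \<omega> Q k i + wt ?\<rho> Q k i"
      using eq by (simp only: wt_linear)
    then have "(K * wt \<omega> P k i + wt ?\<rho> P k i) mod K = (K * wt \<omega> Q k i + wt ?\<rho> Q k i) mod K" by simp
    then have "wt ?\<rho> P k i = wt ?\<rho> Q k i" using small P' Q' by (simp only: mod_mult_self4 mod_less)
    then have m: "wt ?p P k i mod q = wt ?p Q k i mod q" using wt_mod[of ?p q] by metis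
    show "P = Q"
    proof (rule ccontr)
      assume "P \<noteq> Q"
      then have "(wt ?p P k i, wt ?p Q k i) \<in> A"
        unfolding A_def using s P' Q'
        by (intro UN_I[of "(k, i, D)"]) (auto simp: slot_def intro!: image_eqI[of _ _ "(P, Q)"])
      with q(3) m show False by auto
    qed
  qed
  with q show ?thesis by blast
qed

lemma ex_isolating_horner:
  assumes d: "1 \<le> d" "d < B" "n < B" "n + d * N * N \<le> B * B" and K: "d * (2 * B ^ 11 + 1) \<le> K"
  shows "\<exists>g. (\<forall>j. g j < K) \<and> isolating n d (horner B K g h) h"
proof (induction h)
  case 0
  have "d \<le> d * (2 * B ^ 11 + 1)" by simp
  then have "0 < K" using d K by linarith
  moreover have "isolating n d (horner B K (\<lambda>_. 0) 0) 0"
    by (simp add: isolating_def essential_def trees_below_def)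
  ultimately show ?case by auto
next
  case (Suc h)
  then obtain g where g: "\<And>j. g j < K" "isolating n d (horner B K g h) h" by auto
  from isolating_step[OF g(2) d] obtain q where q: "q \<ge> 2" "q \<le> 2 * B ^ 11 + 1"
    "d * q \<le> K \<Longrightarrow> isolating n d (\<lambda>v k i. K * horner B K g h v k i + 2 ^ lidx B v k i mod q) (Suc h)"
    by blast
  have "d * q \<le> K" using q K by (meson le_trans mult_le_mono2)
  moreover have "q \<le> d * q" using d by simp
  ultimately have qK: "q - 2 < K" using q by linarith
  \<comment> \<open>A digit is the modulus minus 2. Changing \<open>g\<close> at \<open>h\<close>
    does not affect the weights built so far, which use only smaller arguments.\<close>
  let ?g = "g(h := q - 2)"
  have "horner B K ?g h = horner B K g h" by (rule horner_cong) simp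
  then have "horner B K ?g (Suc h) = (\<lambda>v k i. K * horner B K g h v k i + 2 ^ lidx B v k i mod q)"
    using q(1) by (simp add: le_add_diff_inverse2 del: add_2_eq_Suc add_2_eq_Suc')
  then have "isolating n d (horner B K ?g (Suc h)) (Suc h)" using q(3)[OF \<open>d * q \<le> K\<close>] by (simp only:)
  moreover have "\<forall>j. ?g j < K" using g(1) qK by simp
  ultimately show ?case by blast
qed

text \<open>Every lightest tree in the support of \<open>\<phi>\<close> is essential, with
  \<open>\<phi>\<close> itself as the witness. Isolation then leaves only one such tree.\<close>

lemma isolating_unique_min:
  assumes "isolating n d \<omega> h" "slot d k i D" "\<phi> \<in> forms R V N"
    "P \<in> trees_below n h D" "\<phi> P \<noteq> \<zero>"
  shows "\<exists>Q \<in> trees_below n h D. \<phi> Q \<noteq> \<zero> \<and>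
    (\<forall>T \<in> trees_below n h D. \<phi> T \<noteq> \<zero> \<longrightarrow> T \<noteq> Q \<longrightarrow> wt \<omega> Q k i \<noteq> wt \<omega> T k i)"
proof -
  define S where "S = {T \<in> trees_below n h D. \<phi> T \<noteq> \<zero>}"
  define Q where "Q = arg_min (\<lambda>T. wt \<omega> T k i) (\<lambda>T. T \<in> S)"
  have PS: "P \<in> S" using assms by (simp add: S_def)
  have Q: "Q \<in> S" unfolding Q_def by (rule arg_min_natI[where P = "\<lambda>T. T \<in> S"]) (rule PS)
  have le: "wt \<omega> Q k i \<le> wt \<omega> T k i" if "T \<in> S" for T
    unfolding Q_def by (rule arg_min_nat_le[where P = "\<lambda>T. T \<in> S" and m = "\<lambda>T. wt \<omega> T k i"]) (rule that)
  have ess: "T \<in> essential R V N n \<omega> h k i D" if T: "T \<in> S" "wt \<omega> Q k i = wt \<omega> T k i" for T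
    unfolding essential_def using T assms(3) le by (auto simp: S_def not_less[symmetric])
  have "wt \<omega> Q k i \<noteq> wt \<omega> T k i" if "T \<in> S" "T \<noteq> Q" for T
    using that ess[OF that(1)] ess[OF Q] assms(1,2) unfolding isolating_def inj_on_def by metis
  then show ?thesis using Q by (auto simp: S_def)
qed

end

section \<open>Sparse univariate polynomials over a field\<close>

context field
begin

text \<open>Coefficients are listed from the constant term upwards; \<open>quotient y0\<close> is
  synthetic division by the linear factor with root \<open>y0\<close>, with the remainder
  dropped.\<close>

primrec horner_value :: "'a list \<Rightarrow> 'a \<Rightarrow> 'a" where
  "horner_value [] y = \<zero>"
| "horner_value (a # p) y = a \<oplus> y \<otimes> horner_value p y"

primrec quotient :: "'a \<Rightarrow> 'a list \<Rightarrow> 'a list" where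
  "quotient y0 [] = []"
| "quotient y0 (a # p) = (if p = [] then [] else horner_value p y0 # quotient y0 p)"

lemma horner_value_closed [simp]: "set p \<subseteq> carrier R \<Longrightarrow> y \<in> carrier R \<Longrightarrow> horner_value p y \<in> carrier R"
  by (induction p) auto

lemma quotient_closed: "set p \<subseteq> carrier R \<Longrightarrow> y0 \<in> carrier R \<Longrightarrow> set (quotient y0 p) \<subseteq> carrier R"
  by (induction p) auto

lemma length_quotient: "length (quotient y0 p) = length p - 1"
  by (induction p) (auto simp: Suc_pred' simp flip: length_greater_0_conv)

lemma horner_value_quotient:
  assumes "set p \<subseteq> carrier R" "y \<in> carrier R" "y0 \<in> carrier R"
  shows "horner_value p y = horner_value p y0 \<oplus> (y \<ominus> y0) \<otimes> horner_value (quotient y0 p) y"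
  using assms(1)
proof (induction p)
  case Nil
  then show ?case using assms by simp
next
  case (Cons a p)
  show ?case
  proof (cases "p = []")
    case True
    then show ?thesis using Cons assms by simp
  next
    case False
    have c: "a \<in> carrier R" "horner_value p y0 \<in> carrier R" "horner_value (quotient y0 p) y \<in> carrier R"
      "horner_value p y \<in> carrier R"
      using Cons.prems assms quotient_closed[of p y0] by auto
    have IH: "horner_value p y = horner_value p y0 \<oplus> (y \<ominus> y0) \<otimes> horner_value (quotient y0 p) y"
      using Cons by simp
    have "horner_value (a # p) y = a \<oplus> y \<otimes> (horner_value p y0 \<oplus> (y \<ominus> y0) \<otimes> horner_value (quotient y0 p) y)"
      using IH by simp
    also have "\<dots> = (a \<oplus> y0 \<otimes> horner_value p y0) \<oplus>
        (y \<ominus> y0) \<otimes> (horner_value p y0 \<oplus> y \<otimes> horner_value (quotient y0 p) y)"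
      using c(1-3) assms(2,3) by algebra
    finally show ?thesis using False by simp
  qed
qed

lemma horner_value_zero: "set p \<subseteq> {\<zero>} \<Longrightarrow> y \<in> carrier R \<Longrightarrow> horner_value p y = \<zero>"
  by (induction p) auto

lemma quotient_zero:
  assumes "set p \<subseteq> carrier R" "y0 \<in> carrier R" "set (quotient y0 p) \<subseteq> {\<zero>}"
  shows "set (tl p) \<subseteq> {\<zero>}"
  using assms(1,3)
proof (induction p)
  case (Cons a p)
  show ?case
  proof (cases p)
    case c: (Cons b q)
    have "set (tl p) \<subseteq> {\<zero>}" using Cons c by simp
    then have "set q \<subseteq> {\<zero>}" using c by simp
    moreover have "b \<oplus> y0 \<otimes> horner_value q y0 = \<zero>" using Cons.prems c by simp
    ultimately have "b = \<zero>" using horner_value_zero[of q y0] Cons.prems assms(2) c by simp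
    then show ?thesis using \<open>set q \<subseteq> {\<zero>}\<close> c by simp
  qed simp
qed simp

text \<open>Dividing off one root at a time: the other roots are roots of the quotient, since a
  field has no zero divisors.\<close>

lemma horner_value_many_roots:
  assumes "set p \<subseteq> carrier R" "finite Y" "Y \<subseteq> carrier R" "length p \<le> card Y"
    "\<And>y. y \<in> Y \<Longrightarrow> horner_value p y = \<zero>"
  shows "set p \<subseteq> {\<zero>}"
  using assms
proof (induction "length p" arbitrary: p Y)
  case (Suc l)
  then obtain a p' where p: "p = a # p'" by (cases p) auto
  from Suc.hyps(2) Suc.prems(4) have "Y \<noteq> {}" by auto
  then obtain y0 where y0: "y0 \<in> Y" by auto
  then have y0c: "y0 \<in> carrier R" using Suc.prems by auto
  have "set (quotient y0 p) \<subseteq> {\<zero>}"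
  proof (rule Suc.hyps(1))
    show "l = length (quotient y0 p)" using Suc.hyps(2) by (simp add: length_quotient)
    show "set (quotient y0 p) \<subseteq> carrier R" using quotient_closed Suc.prems y0c by blast
    show "finite (Y - {y0})" "Y - {y0} \<subseteq> carrier R" using Suc.prems by auto
    show "length (quotient y0 p) \<le> card (Y - {y0})"
      using Suc.prems y0 by (simp add: length_quotient)
    fix y assume y: "y \<in> Y - {y0}"
    then have yc: "y \<in> carrier R" using Suc.prems by auto
    have qc: "horner_value (quotient y0 p) y \<in> carrier R"
      using quotient_closed[OF Suc.prems(1) y0c] yc by simp
    have "(y \<ominus> y0) \<otimes> horner_value (quotient y0 p) y = \<zero>"
      using horner_value_quotient[OF Suc.prems(1) yc y0c] Suc.prems(5) y y0 qc yc y0c by simp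
    moreover have "y = (y \<ominus> y0) \<oplus> y0" using yc y0c by algebra
    then have "y \<ominus> y0 \<noteq> \<zero>" using y yc y0c by auto
    ultimately show "horner_value (quotient y0 p) y = \<zero>"
      using integral[of "y \<ominus> y0" "horner_value (quotient y0 p) y"] qc yc y0c by auto
  qed
  from quotient_zero[OF Suc.prems(1) y0c this] have 1: "set p' \<subseteq> {\<zero>}" using p by simp
  moreover have "a \<oplus> y0 \<otimes> horner_value p' y0 = \<zero>" using Suc.prems(5)[OF y0] p by simp
  ultimately have "a = \<zero>" using horner_value_zero[of p' y0] y0c Suc.prems(1) p by simp
  then show ?case using 1 p by simp
qed simp

lemma horner_value_add:
  assumes "\<And>t. f t \<in> carrier R" "\<And>t. g t \<in> carrier R" "y \<in> carrier R"
  shows "horner_value (map (\<lambda>t. f t \<oplus> g t) ts) y = horner_value (map f ts) y \<oplus> horner_value (map g ts) y"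
proof (induction ts)
  case (Cons t ts)
  have c: "horner_value (map f ts) y \<in> carrier R" "horner_value (map g ts) y \<in> carrier R"
    using assms by (auto intro!: horner_value_closed)
  show ?case using Cons c assms(1)[of t] assms(2)[of t] assms(3) by simp algebra
qed simp

lemma horner_value_monom:
  assumes "c \<in> carrier R" "y \<in> carrier R" "w < k"
  shows "horner_value (map (\<lambda>t. if w = t then c else \<zero>) [0..<k]) y = c \<otimes> y [^] w"
  using assms(3)
proof (induction k arbitrary: w)
  case (Suc k)
  show ?case
  proof (cases w)
    case 0
    have "horner_value (map (\<lambda>i. \<zero>) [0..<k]) y = \<zero>"
      by (rule horner_value_zero) (use assms in auto)
    then show ?thesis using 0 assms by (simp add: map_upt_Suc del: upt_Suc)
  next
    case s: (Suc w')
    then have "horner_value (map (\<lambda>t. if w' = t then c else \<zero>) [0..<k]) y = c \<otimes> y [^] w'"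
      using Suc by simp
    then show ?thesis using s assms by (simp add: map_upt_Suc m_ac del: upt_Suc)
  qed
qed simp

lemma horner_value_sparse:
  assumes "finite S" "\<And>T. T \<in> S \<Longrightarrow> c T \<in> carrier R" "\<And>T. T \<in> S \<Longrightarrow> w T < k" "y \<in> carrier R"
  shows "horner_value (map (\<lambda>t. \<Oplus>T\<in>S. if w T = t then c T else \<zero>) [0..<k]) y
    = (\<Oplus>T\<in>S. c T \<otimes> y [^] (w T :: nat))"
  using assms(1-3)
proof (induction S rule: finite_induct)
  case empty
  show ?case by (rule trans[OF horner_value_zero]) (use assms in auto)
next
  case (insert T S)
  have cl: "(\<lambda>U. if w U = t then c U else \<zero>) \<in> S \<rightarrow> carrier R" for t using insert by auto
  have "(\<Oplus>U\<in>insert T S. if w U = t then c U else \<zero>) =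
      (if w T = t then c T else \<zero>) \<oplus> (\<Oplus>U\<in>S. if w U = t then c U else \<zero>)" for t
    by (rule finsum_insert) (use insert in auto)
  then have "horner_value (map (\<lambda>t. \<Oplus>U\<in>insert T S. if w U = t then c U else \<zero>) [0..<k]) y =
      horner_value (map (\<lambda>t. (if w T = t then c T else \<zero>) \<oplus> (\<Oplus>U\<in>S. if w U = t then c U else \<zero>)) [0..<k]) y"
    by simp
  also have "\<dots> = c T \<otimes> y [^] w T \<oplus> (\<Oplus>U\<in>S. c U \<otimes> y [^] w U)"
    using insert cl assms(4) by (subst horner_value_add) (auto simp: horner_value_monom intro!: finsum_closed)
  also have "\<dots> = (\<Oplus>U\<in>insert T S. c U \<otimes> y [^] w U)"
    by (rule finsum_insert[symmetric]) (use insert assms(4) in auto)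
  finally show ?case .
qed

text \<open>No other term with nonzero coefficient shares the exponent of \<open>Q\<close>, so
  collecting equal exponents leaves \<open>c Q\<close> intact as a coefficient. A nonzero polynomial
  with \<open>k\<close> coefficients cannot vanish on \<open>k\<close> points.\<close>

lemma ex_nonroot_of_isolated_term:
  fixes w :: "'i \<Rightarrow> nat"
  assumes S: "finite S" "\<And>T. T \<in> S \<Longrightarrow> c T \<in> carrier R" "\<And>T. T \<in> S \<Longrightarrow> w T < k"
    and Q: "Q \<in> S" "c Q \<noteq> \<zero>" "\<And>T. T \<in> S \<Longrightarrow> c T \<noteq> \<zero> \<Longrightarrow> T \<noteq> Q \<Longrightarrow> w Q \<noteq> w T"
    and Y: "finite Y" "Y \<subseteq> carrier R" "k \<le> card Y"
  shows "\<exists>y \<in> Y. (\<Oplus>T\<in>S. c T \<otimes> y [^] w T) \<noteq> \<zero>"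
proof (rule ccontr)
  assume a: "\<not> ?thesis"
  let ?f = "\<lambda>t. \<Oplus>T\<in>S. if w T = t then c T else \<zero>"
  have "set (map ?f [0..<k]) \<subseteq> {\<zero>}"
  proof (rule horner_value_many_roots[OF _ Y(1,2)])
    show "set (map ?f [0..<k]) \<subseteq> carrier R" using S by (auto intro!: finsum_closed)
    fix y assume y: "y \<in> Y"
    then have yc: "y \<in> carrier R" using Y by auto
    show "horner_value (map ?f [0..<k]) y = \<zero>"
      using horner_value_sparse[OF S yc] a y by auto
  qed (use Y in simp)
  moreover have "?f (w Q) \<in> set (map ?f [0..<k])" using S(3)[OF Q(1)] by simp
  ultimately have "?f (w Q) = \<zero>" by blast
  moreover have "c T = \<zero>" if "T \<in> S" "Q \<noteq> T" "w T = w Q" for T using Q(3)[of T] that by auto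
  note zero = this
  have "?f (w Q) = (\<Oplus>T\<in>S. if Q = T then c T else \<zero>)"
    by (rule finsum_cong') (use Q(1) S zero in auto)
  moreover have "\<dots> = c Q" by (rule finsum_singleton) (use Q S in auto)
  ultimately show False using Q by simp
qed

section \<open>Products of finite sums as sums over pairs\<close>

lemma finsum_cartesian_product:
  assumes "finite X" "finite Y" "\<And>x y. x \<in> X \<Longrightarrow> y \<in> Y \<Longrightarrow> h x y \<in> carrier R"
  shows "(\<Oplus>x\<in>X. \<Oplus>y\<in>Y. h x y) = (\<Oplus>p\<in>X \<times> Y. h (fst p) (snd p))"
proof -
  have "X \<times> Y = (\<Union>x\<in>X. Pair x ` Y)" by auto
  then have "(\<Oplus>p\<in>X \<times> Y. h (fst p) (snd p)) = (\<Oplus>p\<in>(\<Union>x\<in>X. Pair x ` Y). h (fst p) (snd p))" by simp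
  also have "\<dots> = (\<Oplus>x\<in>X. \<Oplus>p\<in>Pair x ` Y. h (fst p) (snd p))"
    by (rule add.finprod_UN_disjoint) (use assms in \<open>auto simp: pairwise_def disjnt_def\<close>)
  also have "\<dots> = (\<Oplus>x\<in>X. \<Oplus>y\<in>Y. h x y)"
  proof (rule finsum_cong')
    fix x assume x: "x \<in> X"
    show "(\<Oplus>p\<in>Pair x ` Y. h (fst p) (snd p)) = (\<Oplus>y\<in>Y. h x y)"
      by (subst finsum_reindex) (use assms x in \<open>auto simp: inj_on_def\<close>)
  qed (use assms in \<open>auto intro!: finsum_closed\<close>)
  finally show ?thesis by simp
qed

text \<open>Meant for the map \<open>f\<close> that joins two plane trees at a new root: the product
  of two sums over subtrees becomes a sum over trees.\<close>

lemma finsum_mult_finsum: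
  assumes "finite X" "finite Y" "u \<in> X \<rightarrow> carrier R" "v \<in> Y \<rightarrow> carrier R"
    "inj_on f (X \<times> Y)" "\<And>x y. x \<in> X \<Longrightarrow> y \<in> Y \<Longrightarrow> g (f (x, y)) = u x \<otimes> v y"
  shows "(\<Oplus>x\<in>X. u x) \<otimes> (\<Oplus>y\<in>Y. v y) = (\<Oplus>z\<in>f ` (X \<times> Y). g z)"
proof -
  have "(\<Oplus>x\<in>X. u x) \<otimes> (\<Oplus>y\<in>Y. v y) = (\<Oplus>x\<in>X. u x \<otimes> (\<Oplus>y\<in>Y. v y))"
    by (rule finsum_ldistr) (use assms in \<open>auto intro!: finsum_closed\<close>)
  also have "\<dots> = (\<Oplus>x\<in>X. \<Oplus>y\<in>Y. u x \<otimes> v y)"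
    by (rule finsum_cong') (use assms in \<open>auto simp: Pi_def intro!: finsum_rdistr finsum_closed\<close>)
  also have "\<dots> = (\<Oplus>p\<in>X \<times> Y. u (fst p) \<otimes> v (snd p))"
    by (rule finsum_cartesian_product) (use assms in auto)
  also have "\<dots> = (\<Oplus>p\<in>X \<times> Y. g (f p))"
    by (rule finsum_cong') (use assms in \<open>auto simp: Pi_def\<close>)
  also have "\<dots> = (\<Oplus>z\<in>f ` (X \<times> Y). g z)"
    by (rule finsum_reindex[symmetric]) (use assms in \<open>auto simp: Pi_def\<close>)
  finally show ?thesis .
qed

end

section \<open>Coefficients computed by a circuit\<close>

lemma mono_mult_eq_forget:
  "mono_mult p q = Some (forget P) \<longleftrightarrow>
     (p = None \<and> q = Some (forget P)) \<or> (p = Some (forget P) \<and> q = None) \<or>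
     (\<exists>a b. P = PNode a b \<and> ((p = Some (forget a) \<and> q = Some (forget b)) \<or>
        (p = Some (forget b) \<and> q = Some (forget a))))"
  by (cases p; cases q; cases P) auto

lemma mono_cases: obtains "m = None" | P where "m = Some (forget P)"
  using ex_forget by (metis option.exhaust)

definition wf_poly :: "'a ring \<Rightarrow> nat \<Rightarrow> 'a npoly \<Rightarrow> bool" where
  "wf_poly F n f \<longleftrightarrow> (\<forall>m. f m \<in> carrier F) \<and> finite (psupp F f) \<and>
     (\<forall>P. f (Some (forget P)) \<noteq> \<zero>\<^bsub>F\<^esub> \<longrightarrow> pvars P \<subseteq> {1..n})"

text \<open>The coefficient with which the plane tree \<open>P\<close> enters the evaluation. Thanks
  to the extra factor, the coefficients of a product obey one bilinear rule, whether or not the two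
  children of a node coincide.\<close>

definition vcoeff :: "'a ring \<Rightarrow> 'a npoly \<Rightarrow> ptree \<Rightarrow> 'a" where
  "vcoeff F f P = f (Some (forget P)) \<otimes>\<^bsub>F\<^esub> (\<one>\<^bsub>F\<^esub> \<oplus>\<^bsub>F\<^esub> \<one>\<^bsub>F\<^esub>) [^]\<^bsub>F\<^esub> psym P"

locale field_ring = field R for R :: "'a ring" (structure)
begin

lemma pmult_nonzero:
  assumes "pmult R f g m \<noteq> \<zero>"
  shows "\<exists>p q. f p \<noteq> \<zero> \<and> g q \<noteq> \<zero> \<and> mono_mult p q = m"
proof (rule ccontr)
  assume "\<not> ?thesis"
  then have e: "{(p, q). p \<in> psupp R f \<and> q \<in> psupp R g \<and> mono_mult p q = m} = {}"
    by (auto simp: psupp_def)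
  show False using assms unfolding pmult_def e by simp
qed

lemma pmult_superset:
  assumes "\<And>m. f m \<in> carrier R" "\<And>m. g m \<in> carrier R" "finite X"
    "{(p, q). mono_mult p q = m} = X"
  shows "pmult R f g m = (\<Oplus>pq\<in>X. f (fst pq) \<otimes> g (snd pq))"
  unfolding pmult_def
  by (rule add.finprod_mono_neutral_cong_left) (use assms in \<open>auto simp: psupp_def\<close>)

lemma pmult_PNode:
  assumes f: "\<And>m. f m \<in> carrier R" and g: "\<And>m. g m \<in> carrier R"
  shows "pmult R f g (Some (forget (PNode a b))) =
    f None \<otimes> g (Some (forget (PNode a b))) \<oplus> f (Some (forget (PNode a b))) \<otimes> g None \<oplus>
    (if forget a = forget b then f (Some (forget a)) \<otimes> g (Some (forget b))
     else f (Some (forget a)) \<otimes> g (Some (forget b)) \<oplus> f (Some (forget b)) \<otimes> g (Some (forget a)))"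
proof -
  let ?m = "Some (forget (PNode a b))"
  let ?A = "Some (forget a)" and ?B = "Some (forget b)"
  have X: "{(p, q). mono_mult p q = ?m} = {(None, ?m), (?m, None), (?A, ?B), (?B, ?A)}"
    by (auto simp: mono_mult_eq_forget simp del: forget.simps)
  show ?thesis
  proof (cases "forget a = forget b")
    case True
    then have "{(p, q). mono_mult p q = ?m} = {(None, ?m), (?m, None), (?A, ?B)}" using X by auto
    from pmult_superset[OF f g _ this] show ?thesis using True f g by (simp add: a_ac)
  next
    case False
    from pmult_superset[OF f g _ X] show ?thesis using False f g by (simp add: a_ac)
  qed
qed

lemma vcoeff_closed: "(\<And>m. f m \<in> carrier R) \<Longrightarrow> vcoeff R f P \<in> carrier R"
  by (simp add: vcoeff_def)

text \<open>For equal children the two orders are a single pair of factors, so one of the two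
  summands is missing; the factor \<open>\<one> \<oplus> \<one>\<close> that \<open>psym\<close>
  adds at this node makes up for it.\<close>

lemma vcoeff_pmult_PNode:
  assumes f: "\<And>m. f m \<in> carrier R" and g: "\<And>m. g m \<in> carrier R"
  shows "vcoeff R (pmult R f g) (PNode a b) =
    f None \<otimes> vcoeff R g (PNode a b) \<oplus> g None \<otimes> vcoeff R f (PNode a b) \<oplus>
    (vcoeff R g b \<otimes> vcoeff R f a \<oplus> vcoeff R f b \<otimes> vcoeff R g a)"
proof -
  let ?t = "\<one> \<oplus> \<one>"
  let ?m = "Some (forget (PNode a b))"
  define x where "x = ?t [^] psym a"
  define y where "y = ?t [^] psym b"
  define s where "s = ?t [^] psym (PNode a b)"
  define fm where "fm = f ?m"
  define gm where "gm = g ?m"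
  have c: "f None \<in> carrier R" "g None \<in> carrier R" "fm \<in> carrier R" "gm \<in> carrier R"
    "f (Some (forget a)) \<in> carrier R" "g (Some (forget a)) \<in> carrier R"
    "f (Some (forget b)) \<in> carrier R" "g (Some (forget b)) \<in> carrier R"
    "x \<in> carrier R" "y \<in> carrier R" "s \<in> carrier R"
    using f g by (simp_all add: x_def y_def s_def fm_def gm_def)
  note V = vcoeff_def[where F = R, folded x_def y_def s_def]
  show ?thesis
  proof (cases "forget a = forget b")
    case True
    then have "psym a = psym b" using forget_eq_invariants by blast
    then have xy: "x = y" by (simp add: x_def y_def)
    have "s = ?t [^] (psym a + psym b) \<otimes> ?t" using True by (simp add: s_def)
    also have "\<dots> = y \<otimes> y \<otimes> (\<one> \<oplus> \<one>)"
      using \<open>psym a = psym b\<close> by (simp add: y_def flip: nat_pow_mult)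
    finally have s: "s = y \<otimes> y \<otimes> (\<one> \<oplus> \<one>)" .
    have "(f None \<otimes> gm \<oplus> fm \<otimes> g None \<oplus> f (Some (forget b)) \<otimes> g (Some (forget b))) \<otimes> s =
      f None \<otimes> (gm \<otimes> s) \<oplus> g None \<otimes> (fm \<otimes> s) \<oplus>
      ((g (Some (forget b)) \<otimes> y) \<otimes> (f (Some (forget b)) \<otimes> y) \<oplus> (f (Some (forget b)) \<otimes> y) \<otimes> (g (Some (forget b)) \<otimes> y))"
      unfolding s using c by algebra
    then show ?thesis
      unfolding vcoeff_def pmult_PNode[OF f g] x_def[symmetric] y_def[symmetric] s_def[symmetric]
        fm_def[symmetric] gm_def[symmetric] using True xy by simp
  next
    case False
    then have s: "s = x \<otimes> y" by (simp add: s_def x_def y_def nat_pow_mult)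
    have "(f None \<otimes> gm \<oplus> fm \<otimes> g None \<oplus> (f (Some (forget a)) \<otimes> g (Some (forget b)) \<oplus> f (Some (forget b)) \<otimes> g (Some (forget a)))) \<otimes> s =
      f None \<otimes> (gm \<otimes> s) \<oplus> g None \<otimes> (fm \<otimes> s) \<oplus>
      ((g (Some (forget b)) \<otimes> y) \<otimes> (f (Some (forget a)) \<otimes> x) \<oplus> (f (Some (forget b)) \<otimes> y) \<otimes> (g (Some (forget a)) \<otimes> x))"
      unfolding s using c by algebra
    then show ?thesis
      unfolding vcoeff_def pmult_PNode[OF f g] x_def[symmetric] y_def[symmetric] s_def[symmetric]
        fm_def[symmetric] gm_def[symmetric] using False by simp
  qed
qed

lemma wf_poly_pmult:
  assumes "wf_poly R n f" "wf_poly R n g"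
  shows "wf_poly R n (pmult R f g)"
  unfolding wf_poly_def
proof (intro conjI allI impI)
  fix m show "pmult R f g m \<in> carrier R" unfolding pmult_def
    by (rule finsum_closed) (use assms in \<open>auto simp: wf_poly_def\<close>)
next
  have "psupp R (pmult R f g) \<subseteq> (\<lambda>(p, q). mono_mult p q) ` (psupp R f \<times> psupp R g)"
  proof
    fix m assume "m \<in> psupp R (pmult R f g)"
    then show "m \<in> (\<lambda>(p, q). mono_mult p q) ` (psupp R f \<times> psupp R g)"
      using pmult_nonzero[of f g m] unfolding psupp_def by force
  qed
  then show "finite (psupp R (pmult R f g))"
    using assms by (auto simp: wf_poly_def intro: finite_subset)
next
  fix P assume "pmult R f g (Some (forget P)) \<noteq> \<zero>"
  from pmult_nonzero[OF this] obtain p q where pq: "f p \<noteq> \<zero>" "g q \<noteq> \<zero>" "mono_mult p q = Some (forget P)"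
    by auto
  from pq(3) show "pvars P \<subseteq> {1..n}" unfolding mono_mult_eq_forget
    using pq(1,2) assms unfolding wf_poly_def by fastforce
qed

lemma wf_poly_padd:
  assumes "wf_poly R n f" "wf_poly R n g"
  shows "wf_poly R n (padd R f g)"
  unfolding wf_poly_def
proof (intro conjI allI impI)
  fix m show "padd R f g m \<in> carrier R" using assms by (auto simp: wf_poly_def padd_def)
next
  have "psupp R (padd R f g) \<subseteq> psupp R f \<union> psupp R g"
    using assms by (auto simp: wf_poly_def padd_def psupp_def)
  then show "finite (psupp R (padd R f g))"
    using assms by (auto simp: wf_poly_def intro: finite_subset)
next
  fix P assume "padd R f g (Some (forget P)) \<noteq> \<zero>"
  then have "f (Some (forget P)) \<noteq> \<zero> \<or> g (Some (forget P)) \<noteq> \<zero>"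
    using assms by (auto simp: wf_poly_def padd_def)
  then show "pvars P \<subseteq> {1..n}" using assms by (auto simp: wf_poly_def)
qed

lemma wf_poly_pzero: "wf_poly R n (pzero R)"
  by (simp add: wf_poly_def pzero_def psupp_def)

lemma wf_poly_pconst: "c \<in> carrier R \<Longrightarrow> wf_poly R n (pconst R c)"
  by (auto simp: wf_poly_def pconst_def psupp_def intro: finite_subset[of _ "{None}"])

lemma wf_poly_pvar:
  assumes "v \<in> {1..n}"
  shows "wf_poly R n (pvar R v)"
  unfolding wf_poly_def
proof (intro conjI allI impI)
  show "pvar R v m \<in> carrier R" for m by (simp add: pvar_def)
  show "finite (psupp R (pvar R v))"
    by (rule finite_subset[of _ "{Some (Leaf v)}"]) (auto simp: psupp_def pvar_def)
  fix P assume "pvar R v (Some (forget P)) \<noteq> \<zero>"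
  then have "forget P = Leaf v" by (simp add: pvar_def split: if_splits)
  then show "pvars P \<subseteq> {1..n}" using assms by (cases P) auto
qed

end

section \<open>The polynomials at the gates of a fixed circuit\<close>

lemma gate_poly_cong: "(\<And>j. j \<in> inputs g \<Longrightarrow> ps ! j = ps' ! j) \<Longrightarrow> gate_poly F ps g = gate_poly F ps' g"
  by (cases g) (auto intro!: arg_cong[where f = "\<lambda>l. foldr (padd F) l (pzero F)"])

definition gate_polys :: "'a ring \<Rightarrow> 'a gate list \<Rightarrow> 'a npoly list" where
  "gate_polys F gs = foldl (\<lambda>ps g. ps @ [gate_poly F ps g]) [] gs"

lemma gate_polys_snoc: "gate_polys F (gs @ [g]) = gate_polys F gs @ [gate_poly F (gate_polys F gs) g]"
  by (simp add: gate_polys_def)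

lemma length_gate_polys: "length (gate_polys F gs) = length gs"
  by (induction gs rule: rev_induct) (simp add: gate_polys_def, simp add: gate_polys_snoc)

lemma gate_polys_nth:
  assumes "\<And>i. i < length gs \<Longrightarrow> \<forall>j \<in> inputs (gs ! i). j < i" "i < length gs"
  shows "gate_polys F gs ! i = gate_poly F (gate_polys F gs) (gs ! i)"
  using assms
proof (induction gs rule: rev_induct)
  case (snoc g gs)
  let ?G = "gate_polys F gs"
  have inp: "\<forall>j \<in> inputs (gs ! i). j < i" if "i < length gs" for i
    using snoc.prems(1)[of i] that by (simp add: nth_append)
  have inpg: "\<forall>j \<in> inputs g. j < length gs" using snoc.prems(1)[of "length gs"] by simp
  have "gate_polys F (gs @ [g]) ! i = gate_poly F ?G ((gs @ [g]) ! i)"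
    using snoc.prems(2) snoc.IH inp
    by (cases "i < length gs") (auto simp: gate_polys_snoc nth_append length_gate_polys less_Suc_eq)
  also have "\<dots> = gate_poly F (gate_polys F (gs @ [g])) ((gs @ [g]) ! i)"
  proof (rule gate_poly_cong)
    fix j assume "j \<in> inputs ((gs @ [g]) ! i)"
    then have "j < length gs"
      using snoc.prems(2) inp inpg by (cases "i < length gs") (fastforce simp: nth_append less_Suc_eq)+
    then show "?G ! j = gate_polys F (gs @ [g]) ! j" by (simp add: gate_polys_snoc nth_append length_gate_polys)
  qed
  finally show ?case .
qed simp

definition prod_count :: "'a circuit \<Rightarrow> nat list \<Rightarrow> nat" where
  "prod_count C p = length (filter (\<lambda>i. \<exists>j k. gates C ! i = ProdG j k) p)"

locale field_circuit = field_ring R for R (structure) +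
  fixes n :: nat and C :: "'a circuit"
  assumes circuit: "is_circuit R n C"
begin

abbreviation "len \<equiv> length (gates C)"
abbreviation "gp i \<equiv> gate_polys R (gates C) ! i"

lemma inputs_less: "i < len \<Longrightarrow> j \<in> inputs (gates C ! i) \<Longrightarrow> j < i"
  using circuit by (simp add: is_circuit_def)

lemma gp_eq: "i < len \<Longrightarrow> gp i = gate_poly R (gate_polys R (gates C)) (gates C ! i)"
  using inputs_less by (intro gate_polys_nth) auto

lemma gp_SumG: "i < len \<Longrightarrow> gates C ! i = SumG js \<Longrightarrow> gp i = foldr (padd R) (map gp js) (pzero R)"
  using gp_eq by simp

lemma gp_ProdG: "i < len \<Longrightarrow> gates C ! i = ProdG j k \<Longrightarrow> gp i = pmult R (gp j) (gp k)"
  using gp_eq by simp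

lemma circuit_poly_eq: "circuit_poly R C = gp (root C)"
  by (simp add: circuit_poly_def gate_polys_def)

lemma root_less: "root C < len"
  using circuit by (simp add: is_circuit_def)

lemma wf_gp: "i < len \<Longrightarrow> wf_poly R n (gp i)"
proof (induction i rule: less_induct)
  case (less i)
  have ok: "gate_ok R n (gates C ! i)" using circuit less.prems by (simp add: is_circuit_def)
  have IH: "wf_poly R n (gp j)" if "j \<in> inputs (gates C ! i)" for j
    using less inputs_less[OF less.prems that] by auto
  show ?case
  proof (cases "gates C ! i")
    case (SumG js)
    have "wf_poly R n (foldr (padd R) (map gp ks) (pzero R))" if "set ks \<subseteq> set js" for ks
      using that by (induction ks) (use IH SumG in \<open>auto intro: wf_poly_padd wf_poly_pzero\<close>)
    then show ?thesis using gp_SumG[OF less.prems SumG] by auto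
  next
    case (ProdG j k)
    then show ?thesis using gp_ProdG[OF less.prems ProdG] IH by (auto intro: wf_poly_pmult)
  qed (use ok gp_eq[OF less.prems] in \<open>auto intro: wf_poly_pvar wf_poly_pconst\<close>)
qed

lemma gp_closed: "i < len \<Longrightarrow> gp i m \<in> carrier R"
  using wf_gp by (simp add: wf_poly_def)

text \<open>Induction along the gates. At a product gate the coefficient of \<open>PNode Q P\<close>
  is made of the coefficients of the same tree at the inputs, scaled by constant terms, and of the
  coefficients of \<open>Q\<close> at the inputs, scaled by those of \<open>P\<close>. With
  \<open>P\<close> fixed, all scalars are constants.\<close>

lemma coord_PNode_form:
  "i < len \<Longrightarrow> (\<lambda>Q. vcoeff R (gp i) (PNode Q P)) \<in> forms R (\<lambda>g. vcoeff R (gp g)) len"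
proof (induction i rule: less_induct)
  case (less i)
  have IH: "j < len \<and> (\<lambda>Q. vcoeff R (gp j) (PNode Q P)) \<in> forms R (\<lambda>g. vcoeff R (gp g)) len"
    if "j \<in> inputs (gates C ! i)" for j
    using less inputs_less[OF less.prems that] by auto
  have zero: "(\<lambda>Q. vcoeff R f (PNode Q P)) \<in> forms R (\<lambda>g. vcoeff R (gp g)) len"
    if "\<And>Q. f (Some (forget (PNode Q P))) = \<zero>" for f
    using forms.zero[of R "\<lambda>g. vcoeff R (gp g)" len] that by (simp add: vcoeff_def)
  show ?case
  proof (cases "gates C ! i")
    case (VarG v)
    then have "gp i = pvar R v" using gp_eq[OF less.prems] by simp
    then show ?thesis by (intro zero) (simp add: pvar_def)
  next
    case (ConstG c)
    then have "gp i = pconst R c" using gp_eq[OF less.prems] by simp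
    then show ?thesis by (intro zero) (simp add: pconst_def)
  next
    case (SumG js)
    have "wf_poly R n (foldr (padd R) (map gp ks) (pzero R)) \<and>
      (\<lambda>Q. vcoeff R (foldr (padd R) (map gp ks) (pzero R)) (PNode Q P)) \<in> forms R (\<lambda>g. vcoeff R (gp g)) len"
      if "set ks \<subseteq> set js" for ks
      using that
    proof (induction ks)
      case Nil
      show ?case using zero[of "pzero R"] wf_poly_pzero by (simp add: pzero_def)
    next
      case (Cons k ks)
      let ?S = "foldr (padd R) (map gp ks) (pzero R)"
      have IH1: "wf_poly R n ?S" "(\<lambda>Q. vcoeff R ?S (PNode Q P)) \<in> forms R (\<lambda>g. vcoeff R (gp g)) len"
        using Cons by auto
      have k: "k < len" "(\<lambda>Q. vcoeff R (gp k) (PNode Q P)) \<in> forms R (\<lambda>g. vcoeff R (gp g)) len"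
        using IH[of k] SumG Cons.prems by auto
      have "(\<lambda>Q. vcoeff R (padd R (gp k) ?S) (PNode Q P)) =
          (\<lambda>Q. vcoeff R (gp k) (PNode Q P) \<oplus> vcoeff R ?S (PNode Q P))"
        using IH1(1) gp_closed[OF k(1)] by (auto simp: vcoeff_def padd_def wf_poly_def l_distr)
      then show ?case using forms.add[OF k(2) IH1(2)] wf_poly_padd[OF wf_gp[OF k(1)] IH1(1)] by simp
    qed
    from conjunct2[OF this[OF order.refl]] show ?thesis unfolding gp_SumG[OF less.prems SumG] .
  next
    case (ProdG j k)
    have j: "j < len" "(\<lambda>Q. vcoeff R (gp j) (PNode Q P)) \<in> forms R (\<lambda>g. vcoeff R (gp g)) len"
      and k: "k < len" "(\<lambda>Q. vcoeff R (gp k) (PNode Q P)) \<in> forms R (\<lambda>g. vcoeff R (gp g)) len"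
      using IH ProdG by auto
    let ?V = "\<lambda>g. vcoeff R (gp g)"
    have c: "?V j \<in> forms R ?V len" "?V k \<in> forms R ?V len"
      using forms.coord[where V = ?V and F = R, OF j(1)] forms.coord[where V = ?V and F = R, OF k(1)] by simp_all
    show ?thesis unfolding gp_ProdG[OF less.prems ProdG]
        vcoeff_pmult_PNode[OF gp_closed[OF j(1)] gp_closed[OF k(1)]]
      by (rule forms.add[OF forms.add[OF forms.smult[OF gp_closed[OF j(1)] k(2)]
            forms.smult[OF gp_closed[OF k(1)] j(2)]]
          forms.add[OF forms.smult[OF vcoeff_closed[OF gp_closed[OF k(1)]] c(1)]
            forms.smult[OF vcoeff_closed[OF gp_closed[OF j(1)]] c(2)]]])
  qed
qed

sublocale linear_forms R "\<lambda>g. vcoeff R (gp g)" len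
proof
  fix g P Q assume g: "g < len"
  show "vcoeff R (gp g) P \<in> carrier R" using gp_closed[OF g] by (rule vcoeff_closed)
  show "(\<lambda>Q. vcoeff R (gp g) (PNode Q P)) \<in> forms R (\<lambda>g. vcoeff R (gp g)) len"
    by (rule coord_PNode_form[OF g])
  have "forget (PNode P Q) = forget (PNode Q P)" by (simp add: Upair_inject)
  moreover from forget_eq_invariants[OF this] have "psym (PNode P Q) = psym (PNode Q P)" by blast
  ultimately show "vcoeff R (gp g) (PNode P Q) = vcoeff R (gp g) (PNode Q P)"
    unfolding vcoeff_def by metis
qed

section \<open>Heights of trees and product depth\<close>

text \<open>Moving the root to another gate turns paths that end at an inner gate into leaf-to-root
  paths, so that paths can be built gate by gate.\<close>

lemma path_snoc:
  assumes "leaf_to_root_path (Circuit (gates C) j) p" "j \<in> inputs (gates C ! i)"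
  shows "leaf_to_root_path (Circuit (gates C) i) (p @ [i])"
  unfolding leaf_to_root_path_def
proof (intro conjI allI impI)
  have p: "p \<noteq> []" "last p = j" "inputs (gates C ! hd p) = {}"
    "\<And>t. Suc t < length p \<Longrightarrow> p ! t \<in> inputs (gates C ! (p ! Suc t))"
    using assms(1) by (auto simp: leaf_to_root_path_def)
  show "inputs (gates (Circuit (gates C) i) ! hd (p @ [i])) = {}" using p by simp
  fix t assume t: "Suc t < length (p @ [i])"
  show "(p @ [i]) ! t \<in> inputs (gates (Circuit (gates C) i) ! ((p @ [i]) ! Suc t))"
  proof (cases "Suc t < length p")
    case True
    then show ?thesis using p(4)[of t] by (simp add: nth_append)
  next
    case False
    then have "Suc t = length p" using t by simp
    moreover have "p ! t = j" using p(1,2) \<open>Suc t = length p\<close> by (metis diff_Suc_1 last_conv_nth)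
    ultimately show ?thesis using assms(2) by (simp add: nth_append)
  qed
qed simp_all

text \<open>The path follows a tree with nonzero coefficient down the circuit. At a product gate it
  turns to the input that supplies the higher subtree, or to the input that holds the whole tree
  when the other factor is a constant term.\<close>

lemma ex_path_pheight:
  "i < len \<Longrightarrow> gp i (Some (forget P)) \<noteq> \<zero> \<Longrightarrow>
     \<exists>p. leaf_to_root_path (Circuit (gates C) i) p \<and> pheight P \<le> prod_count C p"
proof (induction i arbitrary: P rule: less_induct)
  case (less i)
  have step: "\<exists>p. leaf_to_root_path (Circuit (gates C) i) p \<and>
      pheight Q + (if \<exists>j k. gates C ! i = ProdG j k then 1 else 0) \<le> prod_count C p"
    if j: "j \<in> inputs (gates C ! i)" "gp j (Some (forget Q)) \<noteq> \<zero>" for j Q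
  proof -
    have "j < i" using inputs_less[OF less.prems(1) j(1)] .
    from less.IH[OF this _ j(2)] this less.prems(1) obtain p
      where p: "leaf_to_root_path (Circuit (gates C) j) p" "pheight Q \<le> prod_count C p" by auto
    then show ?thesis using path_snoc[OF p(1) j(1)]
      by (intro exI[of _ "p @ [i]"]) (auto simp: prod_count_def)
  qed
  show ?case
  proof (cases "gates C ! i")
    case (VarG v)
    then have "forget P = Leaf v" using gp_eq[OF less.prems(1)] less.prems(2) by (simp add: pvar_def split: if_splits)
    then have "pheight P = 0" by (cases P) auto
    then show ?thesis using VarG by (intro exI[of _ "[i]"]) (simp add: leaf_to_root_path_def)
  next
    case (ConstG c)
    then show ?thesis using gp_eq[OF less.prems(1)] less.prems(2) by (simp add: pconst_def)
  next
    case (SumG js)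
    have "(\<exists>k \<in> set ks. gp k (Some (forget P)) \<noteq> \<zero>)"
      if "foldr (padd R) (map gp ks) (pzero R) (Some (forget P)) \<noteq> \<zero>" "set ks \<subseteq> set js" for ks
      using that
    proof (induction ks)
      case (Cons k ks)
      show ?case
      proof (rule ccontr)
        assume a: "\<not> ?case"
        then have "foldr (padd R) (map gp ks) (pzero R) (Some (forget P)) = \<zero>" using Cons by auto
        moreover have "padd R (gp k) (foldr (padd R) (map gp ks) (pzero R)) (Some (forget P)) =
            gp k (Some (forget P)) \<oplus> foldr (padd R) (map gp ks) (pzero R) (Some (forget P))"
          by (simp only: padd_def)
        ultimately show False using a Cons.prems(1) by simp
      qed
    qed (simp add: pzero_def)
    then obtain k where k: "k \<in> set js" "gp k (Some (forget P)) \<noteq> \<zero>"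
      using less.prems gp_SumG[OF less.prems(1) SumG] by auto
    show ?thesis using step[of k P] k SumG by auto
  next
    case (ProdG j k)
    have "pmult R (gp j) (gp k) (Some (forget P)) \<noteq> \<zero>"
      using less.prems gp_ProdG[OF less.prems(1) ProdG] by simp
    from pmult_nonzero[OF this] obtain p q where pq: "gp j p \<noteq> \<zero>" "gp k q \<noteq> \<zero>"
      "mono_mult p q = Some (forget P)" by auto
    have sj: "\<exists>p. leaf_to_root_path (Circuit (gates C) i) p \<and> Suc (pheight Q) \<le> prod_count C p"
      if "gp j (Some (forget Q)) \<noteq> \<zero>" for Q using step[of j Q] that ProdG by auto
    have sk: "\<exists>p. leaf_to_root_path (Circuit (gates C) i) p \<and> Suc (pheight Q) \<le> prod_count C p"
      if "gp k (Some (forget Q)) \<noteq> \<zero>" for Q using step[of k Q] that ProdG by auto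
    from pq(3) consider "q = Some (forget P)" | "p = Some (forget P)"
      | a b where "P = PNode a b" "p = Some (forget a)" "q = Some (forget b)"
      | a b where "P = PNode a b" "p = Some (forget b)" "q = Some (forget a)"
      unfolding mono_mult_eq_forget by blast
    then show ?thesis
    proof cases
      case 1
      then show ?thesis using sk[of P] pq by (meson Suc_leD)
    next
      case 2
      then show ?thesis using sj[of P] pq by (meson Suc_leD)
    next
      case 3
      then show ?thesis using sj[of a] sk[of b] pq
        by (cases "pheight a \<le> pheight b") (auto simp: max_def)
    next
      case 4
      then show ?thesis using sj[of b] sk[of a] pq
        by (cases "pheight a \<le> pheight b") (auto simp: max_def)
    qed
  qed
qed

text \<open>Gate positions increase strictly along a path. This bounds the length of all paths, so
  the \<open>Max\<close> in \<open>product_depth\<close> ranges over a finite set.\<close>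

lemma path_bound:
  assumes p: "leaf_to_root_path C p" and t: "t < length p"
  shows "p ! t + (length p - Suc t) \<le> root C"
  using t
proof (induction "length p - Suc t" arbitrary: t)
  case 0
  then have "t = length p - 1" by simp
  then show ?case using p by (auto simp: leaf_to_root_path_def last_conv_nth)
next
  case (Suc l)
  then have t: "Suc t < length p" by simp
  have IH: "p ! Suc t + (length p - Suc (Suc t)) \<le> root C" using Suc t by simp
  moreover have "p ! t \<in> inputs (gates C ! (p ! Suc t))" using p t by (simp add: leaf_to_root_path_def)
  moreover have "p ! Suc t < len" using IH root_less by simp
  ultimately have "p ! t < p ! Suc t" using inputs_less by blast
  then show ?case using IH t by simp
qed

lemma prod_count_le_product_depth:
  assumes "leaf_to_root_path C p"
  shows "prod_count C p \<le> product_depth C"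
proof -
  have "{length (filter (\<lambda>i. \<exists>j k. gates C ! i = ProdG j k) p) | p. leaf_to_root_path C p} \<subseteq> {..Suc (root C)}"
  proof
    fix x assume "x \<in> {length (filter (\<lambda>i. \<exists>j k. gates C ! i = ProdG j k) p) | p. leaf_to_root_path C p}"
    then obtain q where q: "leaf_to_root_path C q"
      and x: "x = length (filter (\<lambda>i. \<exists>j k. gates C ! i = ProdG j k) q)" by auto
    have "length q \<le> Suc (root C)" using path_bound[OF q, of 0] q by (auto simp: leaf_to_root_path_def)
    then show "x \<in> {..Suc (root C)}"
      unfolding x using length_filter_le le_trans by blast
  qed
  then have "finite {length (filter (\<lambda>i. \<exists>j k. gates C ! i = ProdG j k) p) | p. leaf_to_root_path C p}"
    by (rule finite_subset) simp
  then show ?thesis unfolding product_depth_def prod_count_def by (rule Max_ge) (use assms in auto)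
qed

lemma pheight_le_product_depth:
  assumes "circuit_poly R C (Some (forget P)) \<noteq> \<zero>"
  shows "pheight P \<le> product_depth C"
  using ex_path_pheight[OF root_less, of P] assms prod_count_le_product_depth
  by (auto simp: circuit_poly_eq intro: le_trans)

end

section \<open>Evaluation at the points of the hitting set\<close>

text \<open>A product of \<open>D\<close> matrices supported just above the diagonal is supported on
  the \<open>D\<close>-th superdiagonal. Trees with different numbers of leaves therefore never meet
  in one entry. The zero scalar part reduces the products of the algebra to
  \<open>circ\<close>.\<close>

definition diag_point :: "'a ring \<Rightarrow> nat \<Rightarrow> nat \<Rightarrow> (nat \<Rightarrow> nat \<Rightarrow> nat \<Rightarrow> nat) \<Rightarrow> 'a \<Rightarrow> nat \<Rightarrow> 'a elt" where
  "diag_point F d n \<omega> y = (\<lambda>v\<in>{1..n}.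
     ((\<lambda>(i, j, k)\<in>idx d. if j = Suc i then y [^]\<^bsub>F\<^esub> \<omega> v k i else \<zero>\<^bsub>F\<^esub>), \<zero>\<^bsub>F\<^esub>))"

definition fibre_sum :: "'a ring \<Rightarrow> (nat \<Rightarrow> nat \<Rightarrow> nat \<Rightarrow> nat) \<Rightarrow> 'a \<Rightarrow> ptree \<Rightarrow> nat \<Rightarrow> nat \<Rightarrow> 'a" where
  "fibre_sum F \<omega> y P k i = (\<Oplus>\<^bsub>F\<^esub>Q\<in>{Q. forget Q = forget P}.
     (\<one>\<^bsub>F\<^esub> \<oplus>\<^bsub>F\<^esub> \<one>\<^bsub>F\<^esub>) [^]\<^bsub>F\<^esub> psym Q \<otimes>\<^bsub>F\<^esub> y [^]\<^bsub>F\<^esub> wt \<omega> Q k i)"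

text \<open>The summand 2 on the left makes the induction close: multiplied by \<open>K\<close> it
  leaves room for the next summand, which is at most \<open>K\<close>, and for 2 again.\<close>

lemma horner_le:
  assumes "2 \<le> K" "\<And>j. g j < K"
  shows "horner B K g h v k i + 2 \<le> 2 * K ^ h"
proof (induction h)
  case (Suc h)
  have "2 ^ lidx B v k i mod (g h + 2) < g h + 2" by simp
  then have 1: "2 ^ lidx B v k i mod (g h + 2) \<le> K" using assms(2)[of h] by linarith
  have "K * (horner B K g h v k i + 2) \<le> K * (2 * K ^ h)" using Suc by (rule mult_le_mono2)
  then have "K * horner B K g h v k i + 2 * K \<le> 2 * K ^ Suc h" by (simp add: algebra_simps)
  then show ?case using 1 assms(1) by simp
qed simp

context field_ring
begin

lemma diag_point_in_points: "y \<in> carrier R \<Longrightarrow> diag_point R d n \<omega> y \<in> points R d n"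
  by (auto simp: diag_point_def points_def alg_carrier_def)

lemma fibre_sum_closed: "y \<in> carrier R \<Longrightarrow> fibre_sum R \<omega> y P k i \<in> carrier R"
  unfolding fibre_sum_def by (intro finsum_closed) auto

text \<open>Different children: the fibre splits into two disjoint product sets, one for each order.
  Equal children: there is only one product set, but each of its trees carries one more factor
  \<open>\<one> \<oplus> \<one>\<close>, which splits into the two equal summands.\<close>

lemma fibre_sum_PNode:
  assumes y: "y \<in> carrier R"
  shows "fibre_sum R \<omega> y (PNode a b) k i =
    fibre_sum R \<omega> y a (Suc k) i \<otimes> fibre_sum R \<omega> y b (Suc k) (i + psize a) \<oplus>
    fibre_sum R \<omega> y b (Suc k) i \<otimes> fibre_sum R \<omega> y a (Suc k) (i + psize b)"
proof -
  let ?t = "\<one> \<oplus> \<one>"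
  let ?N = "\<lambda>(x, y). PNode x y"
  define fib where "fib P = {Q. forget Q = forget P}" for P
  define trm where "trm k i Q = ?t [^] psym Q \<otimes> y [^] wt \<omega> Q k i" for k i Q
  have fs: "fibre_sum R \<omega> y P k i = (\<Oplus>Q\<in>fib P. trm k i Q)" for P k i
    by (simp add: fibre_sum_def fib_def trm_def)
  have tc: "trm k i Q \<in> carrier R" for k i Q using y by (simp add: trm_def)
  have fin: "finite (fib P)" for P unfolding fib_def by (rule finite_forget_fibre)
  have inj: "inj_on ?N X" for X by (auto simp: inj_on_def)
  have sz: "psize Q = psize P" if "Q \<in> fib P" for P Q
    using forget_eq_invariants[of Q P] that by (simp add: fib_def)
  have fibN: "fib (PNode a b) = ?N ` (fib a \<times> fib b) \<union> ?N ` (fib b \<times> fib a)"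
    unfolding fib_def by (rule forget_fibre_PNode)
  show ?thesis
  proof (cases "forget a = forget b")
    case False
    have e: "(\<Oplus>x\<in>fib p. trm (Suc k) i x) \<otimes> (\<Oplus>y\<in>fib q. trm (Suc k) (i + psize p) y) =
        (\<Oplus>z\<in>?N ` (fib p \<times> fib q). trm k i z)" if "forget p \<noteq> forget q" for p q
    proof (rule finsum_mult_finsum[OF fin fin _ _ inj])
      fix x z assume xz: "x \<in> fib p" "z \<in> fib q"
      then have "forget x \<noteq> forget z" using that by (auto simp: fib_def)
      then show "trm k i (?N (x, z)) = trm (Suc k) i x \<otimes> trm (Suc k) (i + psize p) z"
        using sz[OF xz(1)] y by (simp add: trm_def nat_pow_mult[symmetric] m_ac)
    qed (use tc in auto)
    have d: "?N ` (fib a \<times> fib b) \<inter> ?N ` (fib b \<times> fib a) = {}"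
      using False by (auto simp: fib_def)
    have "(\<Oplus>z\<in>fib (PNode a b). trm k i z) = (\<Oplus>z\<in>?N ` (fib a \<times> fib b). trm k i z) \<oplus>
        (\<Oplus>z\<in>?N ` (fib b \<times> fib a). trm k i z)"
      unfolding fibN by (rule finsum_Un_disjoint) (use d fin tc in auto)
    then show ?thesis unfolding fs using e[OF False] e[OF False[symmetric]] by simp
  next
    case True
    have ab: "fib a = fib b" "psize a = psize b"
      using True forget_eq_invariants[OF True] by (auto simp: fib_def)
    let ?A = "\<Oplus>x\<in>fib b. trm (Suc k) i x" and ?B = "\<Oplus>z\<in>fib b. trm (Suc k) (i + psize b) z"
    have AB: "?A \<in> carrier R" "?B \<in> carrier R" using tc by (auto intro!: finsum_closed)
    have "(\<Oplus>x\<in>fib b. ?t \<otimes> trm (Suc k) i x) \<otimes> ?B = (\<Oplus>z\<in>?N ` (fib b \<times> fib b). trm k i z)"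
    proof (rule finsum_mult_finsum[OF fin fin _ _ inj])
      fix x z assume xz: "x \<in> fib b" "z \<in> fib b"
      then have "forget x = forget z" by (auto simp: fib_def)
      then show "trm k i (?N (x, z)) = ?t \<otimes> trm (Suc k) i x \<otimes> trm (Suc k) (i + psize b) z"
        using sz[OF xz(1)] y by (simp add: trm_def nat_pow_mult[symmetric] m_ac)
    qed (use tc in auto)
    moreover have "(\<Oplus>x\<in>fib b. ?t \<otimes> trm (Suc k) i x) = ?t \<otimes> ?A"
      by (rule finsum_rdistr[symmetric]) (use fin tc in auto)
    ultimately have "(\<Oplus>z\<in>fib (PNode a b). trm k i z) = ?t \<otimes> ?A \<otimes> ?B"
      using fibN ab by simp
    also have "\<dots> = ?A \<otimes> ?B \<oplus> ?A \<otimes> ?B" using AB by algebra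
    finally show ?thesis unfolding fs using ab by simp
  qed
qed

lemma circ_diagonal:
  assumes t: "(i, j, k) \<in> idx d" "k < d" and ab: "1 \<le> b"
    and x: "\<And>i j. (i, j, Suc k) \<in> idx d \<Longrightarrow> x (i, j, Suc k) = (if j = i + a then X i else \<zero>)"
    and y: "\<And>i j. (i, j, Suc k) \<in> idx d \<Longrightarrow> y (i, j, Suc k) = (if j = i + b then Y i else \<zero>)"
    and c: "\<And>i. X i \<in> carrier R" "\<And>i. Y i \<in> carrier R"
  shows "circ R d x y (i, j, k) = (if j = i + a + b then X i \<otimes> Y (i + a) else \<zero>)"
proof -
  have "circ R d x y (i, j, k) = (\<Oplus>l\<in>{1..d+1}. x (i, l, Suc k) \<otimes> y (l, j, Suc k))"
    using t by (simp add: circ_def)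
  also have "\<dots> = (\<Oplus>l\<in>{1..d+1}. if i + a = l then X i \<otimes> (if j = l + b then Y l else \<zero>) else \<zero>)"
  proof (rule finsum_cong')
    fix l assume "l \<in> {1..d+1}"
    then have "(i, l, Suc k) \<in> idx d" "(l, j, Suc k) \<in> idx d" using t by (auto simp: idx_def)
    then show "x (i, l, Suc k) \<otimes> y (l, j, Suc k) =
        (if i + a = l then X i \<otimes> (if j = l + b then Y l else \<zero>) else \<zero>)"
      using x[of i l] y[of l j] c by auto
  qed (use c in auto)
  also have "\<dots> = (if j = i + a + b then X i \<otimes> Y (i + a) else \<zero>)"
  proof (cases "i + a \<in> {1..d+1}")
    case True
    have "(\<Oplus>l\<in>{1..d+1}. if i + a = l then X i \<otimes> (if j = l + b then Y l else \<zero>) else \<zero>) =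
        X i \<otimes> (if j = i + a + b then Y (i + a) else \<zero>)"
      by (rule finsum_singleton) (use True c in auto)
    then show ?thesis using c by auto
  next
    case False
    \<comment> \<open>If the middle index lies outside the matrix, so does the column
      \<open>i + a + b\<close>.\<close>
    then have "j \<noteq> i + a + b" using t by (auto simp: idx_def)
    moreover have "(\<Oplus>l\<in>{1..d+1}. if i + a = l then X i \<otimes> (if j = l + b then Y l else \<zero>) else \<zero>) =
        (\<Oplus>l\<in>{1..d+1}. \<zero>)"
      by (rule finsum_cong') (use False in auto)
    ultimately show ?thesis by simp
  qed
  finally show ?thesis .
qed

text \<open>\<open>circ\<close> takes its entries from the next layer and puts zero into the last
  one. Every step down the tree loses at least one leaf, which pays for the layer used up; this is
  why \<open>k + psize P \<le> d + 1\<close> guarantees that no leaf falls below the last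
  layer.\<close>

lemma tree_eval_diag_point:
  assumes y: "y \<in> carrier R" and P: "pvars P \<subseteq> {1..n}"
  shows "tree_eval R d (diag_point R d n \<omega> y) (forget P) \<in> alg_carrier R d \<and>
    snd (tree_eval R d (diag_point R d n \<omega> y) (forget P)) = \<zero> \<and>
    (\<forall>i j k. (i, j, k) \<in> idx d \<longrightarrow> k + psize P \<le> d + 1 \<longrightarrow>
      fst (tree_eval R d (diag_point R d n \<omega> y) (forget P)) (i, j, k) =
        (if j = i + psize P then fibre_sum R \<omega> y P k i else \<zero>))"
  using P
proof (induction P)
  case (PLeaf v)
  have "diag_point R d n \<omega> y v \<in> alg_carrier R d"
    using diag_point_in_points[OF y, of d n \<omega>] PLeaf by (auto simp: points_def)
  moreover have "fibre_sum R \<omega> y (PLeaf v) k i = y [^] \<omega> v k i" for k i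
    unfolding fibre_sum_def forget_fibre_PLeaf using y by simp
  ultimately show ?case using PLeaf by (auto simp: diag_point_def)
next
  case (PNode a b)
  let ?e = "tree_eval R d (diag_point R d n \<omega> y)"
  let ?A = "?e (forget a)" and ?B = "?e (forget b)"
  have F: "field R" ..
  have A: "?A \<in> alg_carrier R d" "snd ?A = \<zero>"
    and Ac: "\<And>i j k. (i, j, k) \<in> idx d \<Longrightarrow> k + psize a \<le> d + 1 \<Longrightarrow>
      fst ?A (i, j, k) = (if j = i + psize a then fibre_sum R \<omega> y a k i else \<zero>)"
    using PNode by auto
  have B: "?B \<in> alg_carrier R d" "snd ?B = \<zero>"
    and Bc: "\<And>i j k. (i, j, k) \<in> idx d \<Longrightarrow> k + psize b \<le> d + 1 \<Longrightarrow>
      fst ?B (i, j, k) = (if j = i + psize b then fibre_sum R \<omega> y b k i else \<zero>)"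
    using PNode by auto
  have e: "?e (forget (PNode a b)) = algC_mult R d ?A ?B"
    using algC_mult_commute[OF F A(1) B(1)] by (simp add: uprod_lift_Upair)
  have fc: "fst ?A t \<in> carrier R" "fst ?B t \<in> carrier R" "circ R d (fst ?A) (fst ?B) t \<in> carrier R"
    "circ R d (fst ?B) (fst ?A) t \<in> carrier R" if "t \<in> idx d" for t
  proof -
    have "fst ?A \<in> idx d \<rightarrow>\<^sub>E carrier R" "fst ?B \<in> idx d \<rightarrow>\<^sub>E carrier R"
      using A B by (auto simp: alg_carrier_def)
    with circ_closed[OF F this] circ_closed[OF F this(2,1)] that
    show "fst ?A t \<in> carrier R" "fst ?B t \<in> carrier R" "circ R d (fst ?A) (fst ?B) t \<in> carrier R"
    "circ R d (fst ?B) (fst ?A) t \<in> carrier R" by (blast intro: PiE_mem)+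
  qed
  have fst_e: "fst (algC_mult R d ?A ?B) t = circ R d (fst ?A) (fst ?B) t \<oplus> circ R d (fst ?B) (fst ?A) t"
    if "t \<in> idx d" for t
    using that fc[OF that] A(2) B(2) by (simp add: algC_mult_def alg_add_def algA_mult_def)
  have "snd (algC_mult R d ?A ?B) = \<zero>"
    using A(2) B(2) by (simp add: algC_mult_def alg_add_def algA_mult_def)
  moreover have "fst (algC_mult R d ?A ?B) (i, j, k) =
      (if j = i + psize (PNode a b) then fibre_sum R \<omega> y (PNode a b) k i else \<zero>)"
    if t: "(i, j, k) \<in> idx d" "k + psize (PNode a b) \<le> d + 1" for i j k
  proof -
    have ps: "1 \<le> psize a" "1 \<le> psize b" using psize_pos[of a] psize_pos[of b] by auto
    then have kd: "k < d" "Suc k + psize a \<le> d + 1" "Suc k + psize b \<le> d + 1" using t(2) by auto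
    have 1: "circ R d (fst ?A) (fst ?B) (i, j, k) = (if j = i + psize a + psize b
        then fibre_sum R \<omega> y a (Suc k) i \<otimes> fibre_sum R \<omega> y b (Suc k) (i + psize a) else \<zero>)"
      by (rule circ_diagonal[OF t(1) kd(1) ps(2)]) (use Ac Bc kd y fibre_sum_closed in auto)
    have 2: "circ R d (fst ?B) (fst ?A) (i, j, k) = (if j = i + psize b + psize a
        then fibre_sum R \<omega> y b (Suc k) i \<otimes> fibre_sum R \<omega> y a (Suc k) (i + psize b) else \<zero>)"
      by (rule circ_diagonal[OF t(1) kd(1) ps(1)]) (use Ac Bc kd y fibre_sum_closed in auto)
    show ?thesis unfolding fst_e[OF t(1)] 1 2 fibre_sum_PNode[OF y] by (simp add: ac_simps)
  qed
  ultimately show ?case unfolding e using algC_mult_closed[OF F A(1) B(1)] by blast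
qed

text \<open>Monomials of other degrees vanish at this entry. The remaining ones contribute sums over
  their fibres, and the fibres partition the plane trees with \<open>D\<close> leaves.\<close>

lemma fst_poly_eval_diag_point:
  assumes y: "y \<in> carrier R" and f: "wf_poly R n f" and D: "1 \<le> D" "D \<le> d"
    and deg: "\<And>P. f (Some (forget P)) \<noteq> \<zero> \<Longrightarrow> psize P \<le> d"
  shows "fst (poly_eval R d (diag_point R d n \<omega> y) f) (1, Suc D, 1) =
    (\<Oplus>Q\<in>{Q. Some (forget Q) \<in> psupp R f \<and> psize Q = D}. vcoeff R f Q \<otimes> y [^] wt \<omega> Q 1 1)"
    (is "?L = ?R")
    and "finite {Q. Some (forget Q) \<in> psupp R f \<and> psize Q = D}"
proof -
  let ?S = "\<lambda>m. {Q. Some (forget Q) = m \<and> psize Q = D}"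
  let ?e = "\<lambda>m. fst (mono_eval R d (diag_point R d n \<omega> y) m) (1, Suc D, 1)"
  let ?g = "\<lambda>Q. vcoeff R f Q \<otimes> y [^] wt \<omega> Q 1 1"
  have fc: "f m \<in> carrier R" for m using f by (simp add: wf_poly_def)
  have fin: "finite (psupp R f)" using f by (simp add: wf_poly_def)
  have t: "(1, Suc D, 1) \<in> idx d" using D by (simp add: idx_def)
  have gc: "?g Q \<in> carrier R" for Q using y fc by (simp add: vcoeff_def)
  have fS: "finite (?S m)" for m
  proof (cases m rule: mono_cases)
    case (2 P)
    show ?thesis by (rule finite_subset[OF _ finite_forget_fibre[of P]]) (use 2 in auto)
  qed simp
  have U: "{Q. Some (forget Q) \<in> psupp R f \<and> psize Q = D} = (\<Union>m\<in>psupp R f. ?S m)" by auto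
  then show "finite {Q. Some (forget Q) \<in> psupp R f \<and> psize Q = D}" using fin fS by auto
  have "?L = (\<Oplus>m\<in>psupp R f. f m \<otimes> ?e m)" using t by (simp add: poly_eval_def)
  also have "\<dots> = (\<Oplus>m\<in>psupp R f. \<Oplus>Q\<in>?S m. ?g Q)"
  proof (rule finsum_cong')
    fix m assume m: "m \<in> psupp R f"
    show "f m \<otimes> ?e m = (\<Oplus>Q\<in>?S m. ?g Q)"
    proof (cases m rule: mono_cases)
      case 1
      then show ?thesis using t fc by simp
    next
      case (2 P)
      have P: "f (Some (forget P)) \<noteq> \<zero>" using m 2 by (simp add: psupp_def)
      then have "pvars P \<subseteq> {1..n}" using f by (simp add: wf_poly_def)
      from tree_eval_diag_point[OF y this, of d \<omega>] t deg[OF P]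
      have e: "?e m = (if D = psize P then fibre_sum R \<omega> y P 1 1 else \<zero>)" using 2 by auto
      have sz: "psize Q = psize P" if "forget Q = forget P" for Q
        using forget_eq_invariants[OF that] by blast
      show ?thesis
      proof (cases "D = psize P")
        case True
        then have S: "?S m = {Q. forget Q = forget P}" using 2 by (auto dest: sz)
        have "f m \<otimes> ?e m = (\<Oplus>Q\<in>{Q. forget Q = forget P}.
            f m \<otimes> ((\<one> \<oplus> \<one>) [^] psym Q \<otimes> y [^] wt \<omega> Q 1 1))"
          unfolding e using True
          by (simp add: fibre_sum_def) (rule finsum_rdistr, use fc y finite_forget_fibre in auto)
        also have "\<dots> = (\<Oplus>Q\<in>?S m. ?g Q)" unfolding S
          by (rule finsum_cong') (use 2 fc y in \<open>auto simp: vcoeff_def m_assoc\<close>)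
        finally show ?thesis .
      next
        case False
        then have S: "?S m = {}" using 2 by (auto dest: sz)
        show ?thesis unfolding e S using False fc by simp
      qed
    qed
  qed (use gc in \<open>auto intro!: finsum_closed\<close>)
  also have "\<dots> = ?R" unfolding U
    by (rule add.finprod_UN_disjoint[symmetric]) (use fin fS gc in \<open>auto simp: pairwise_def disjnt_def\<close>)
  finally show "?L = ?R" .
qed

lemma snd_poly_eval_diag_point:
  assumes y: "y \<in> carrier R" and f: "wf_poly R n f"
  shows "snd (poly_eval R d (diag_point R d n \<omega> y) f) = f None"
proof -
  let ?e = "\<lambda>m. snd (mono_eval R d (diag_point R d n \<omega> y) m)"
  have fc: "f m \<in> carrier R" for m using f by (simp add: wf_poly_def)
  have fin: "finite (psupp R f)" using f by (simp add: wf_poly_def)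
  have e: "f m \<otimes> ?e m = (if None = m then f m else \<zero>)" if m: "m \<in> psupp R f" for m
  proof (cases m rule: mono_cases)
    case (2 P)
    then have "pvars P \<subseteq> {1..n}" using m f by (simp add: wf_poly_def psupp_def)
    from tree_eval_diag_point[OF y this, of d \<omega>] 2 fc show ?thesis by simp
  qed (use fc in simp)
  have "snd (poly_eval R d (diag_point R d n \<omega> y) f) = (\<Oplus>m\<in>psupp R f. f m \<otimes> ?e m)"
    by (simp add: poly_eval_def)
  also have "\<dots> = (\<Oplus>m\<in>psupp R f. if None = m then f m else \<zero>)"
    by (rule finsum_cong') (use e fc in auto)
  also have "\<dots> = f None"
  proof (cases "None \<in> psupp R f")
    case True
    show ?thesis by (rule finsum_singleton) (use True fin fc in auto)
  next
    case False
    have "(\<Oplus>m\<in>psupp R f. if None = m then f m else \<zero>) = (\<Oplus>m\<in>psupp R f. \<zero>)"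
      by (rule finsum_cong') (use False in auto)
    then show ?thesis using False by (simp add: psupp_def)
  qed
  finally show ?thesis .
qed

end

section \<open>Existence of good moduli for a circuit\<close>

context field_circuit
begin

text \<open>A constant term shows in the scalar part of the value. Otherwise a single matrix entry
  shows one homogeneous component, as a polynomial in \<open>y\<close> in which the exponent of some
  term occurs only once.\<close>

lemma ex_hitting_digits:
  assumes two: "\<one> \<oplus> \<one> \<noteq> \<zero>"
    and d: "1 \<le> d" "d < B" "n < B" "n + d * len * len \<le> B * B"
    and K: "d * (2 * B ^ 11 + 1) \<le> K" "2 * d < K"
    and depth: "product_depth C \<le> \<Delta>"
    and nz: "circuit_poly R C \<noteq> pzero R" and deg: "pdegree R (circuit_poly R C) \<le> d"
  shows "\<exists>g. (\<forall>j. g j < K) \<and> (\<forall>Y. finite Y \<longrightarrow> Y \<subseteq> carrier R \<longrightarrow> K ^ (\<Delta> + 2) \<le> card Y \<longrightarrow>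
    (\<exists>y \<in> Y. poly_eval R d (diag_point R d n (horner B K g (Suc \<Delta>)) y) (circuit_poly R C) \<noteq> alg_zero R d))"
proof -
  let ?f = "circuit_poly R C"
  have f: "wf_poly R n ?f" using wf_gp[OF root_less] by (simp add: circuit_poly_eq)
  have fc: "?f m \<in> carrier R" for m using f by (simp add: wf_poly_def)
  have size: "psize P \<le> d" if "?f (Some (forget P)) \<noteq> \<zero>" for P
  proof -
    have "mono_degree (Some (forget P)) \<le> pdegree R ?f" unfolding pdegree_def
      by (intro Max_ge imageI) (use that f in \<open>auto simp: psupp_def wf_poly_def\<close>)
    then show ?thesis using deg by (simp add: tree_degree_forget)
  qed
  from ex_isolating_horner[OF d K(1), of "Suc \<Delta>"] obtain g
    where g: "\<And>j. g j < K" "isolating n d (horner B K g (Suc \<Delta>)) (Suc \<Delta>)" by auto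
  let ?\<omega> = "horner B K g (Suc \<Delta>)"
  show ?thesis
  proof (intro exI[of _ g] conjI allI impI)
    fix Y assume Y: "finite Y" "Y \<subseteq> carrier R" "K ^ (\<Delta> + 2) \<le> card Y"
    show "\<exists>y \<in> Y. poly_eval R d (diag_point R d n ?\<omega> y) ?f \<noteq> alg_zero R d"
    proof (cases "?f None = \<zero>")
      case False
      \<comment> \<open>The scalar part does not depend on \<open>y\<close>, so any element of
        \<open>Y\<close> serves.\<close>
      have "K ^ (\<Delta> + 2) > 0" using K by simp
      then have "Y \<noteq> {}" using Y by auto
      then obtain y where y: "y \<in> Y" by auto
      then have "snd (poly_eval R d (diag_point R d n ?\<omega> y) ?f) \<noteq> \<zero>"
        using snd_poly_eval_diag_point[OF _ f] False Y by auto
      then show ?thesis using y by (intro bexI[of _ y]) (auto simp: alg_zero_def)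
    next
      case True
      from nz obtain m where "?f m \<noteq> \<zero>" by (auto simp: pzero_def)
      with True obtain P where P: "?f (Some (forget P)) \<noteq> \<zero>"
        by (cases m rule: mono_cases) auto
      \<comment> \<open>Any degree that occurs will do, as the entry \<open>(1, Suc D, 1)\<close>
        ignores all others.\<close>
      define D where "D = psize P"
      have D: "1 \<le> D" "D \<le> d" using psize_pos[of P] size[OF P] by (auto simp: D_def)
      have slot: "slot d 1 1 D" using D by (simp add: slot_def)
      have tb: "Q \<in> trees_below n (Suc \<Delta>) D" if "?f (Some (forget Q)) \<noteq> \<zero>" "psize Q = D" for Q
        using that pheight_le_product_depth[OF that(1)] depth f
        by (auto simp: trees_below_def wf_poly_def)
      \<comment> \<open>Here characteristic 2 is excluded: the factors from nodes with equal
        children must not vanish.\<close>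
      have nz': "vcoeff R ?f Q \<noteq> \<zero> \<longleftrightarrow> ?f (Some (forget Q)) \<noteq> \<zero>" for Q
      proof -
        have "(\<one> \<oplus> \<one>) [^] k \<noteq> \<zero>" for k :: nat
          by (induction k) (simp_all add: two integral_iff)
        then show ?thesis unfolding vcoeff_def using fc by (simp add: integral_iff)
      qed
      have \<phi>: "vcoeff R ?f \<in> forms R (\<lambda>g. vcoeff R (gp g)) len"
        using forms.coord[where V = "\<lambda>g. vcoeff R (gp g)" and F = R, OF root_less]
        by (simp add: circuit_poly_eq)
      from isolating_unique_min[OF g(2) slot \<phi> tb[OF P]] P nz' obtain Q
        where Q: "Q \<in> trees_below n (Suc \<Delta>) D" "vcoeff R ?f Q \<noteq> \<zero>"
          "\<And>T. T \<in> trees_below n (Suc \<Delta>) D \<Longrightarrow> vcoeff R ?f T \<noteq> \<zero> \<Longrightarrow> T \<noteq> Q \<Longrightarrow> wt ?\<omega> Q 1 1 \<noteq> wt ?\<omega> T 1 1"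
        unfolding D_def by blast
      define S where "S = {Q. Some (forget Q) \<in> psupp R ?f \<and> psize Q = D}"
      have S: "Q \<in> S" "S \<subseteq> trees_below n (Suc \<Delta>) D"
        using Q nz' tb by (auto simp: S_def psupp_def trees_below_def)
      have "\<exists>y \<in> Y. (\<Oplus>T\<in>S. vcoeff R ?f T \<otimes> y [^] wt ?\<omega> T 1 1) \<noteq> \<zero>"
      proof (rule ex_nonroot_of_isolated_term)
        show "Q \<in> S" "vcoeff R ?f Q \<noteq> \<zero>" by (fact S(1), fact Q(2))
        show "finite Y" "Y \<subseteq> carrier R" "K ^ (\<Delta> + 2) \<le> card Y" by (fact Y)+
        show "finite S" unfolding S_def
          using fst_poly_eval_diag_point(2)[OF zero_closed f D size] .
        show "vcoeff R ?f T \<in> carrier R" for T using fc by (rule vcoeff_closed)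
        show "wt ?\<omega> Q 1 1 \<noteq> wt ?\<omega> T 1 1" if "T \<in> S" "vcoeff R ?f T \<noteq> \<zero>" "T \<noteq> Q" for T
          using Q(3) that S by auto
        fix T assume "T \<in> S"
        then have "psize T = D" by (simp add: S_def)
        have K2: "2 \<le> K" using d K(2) by simp
        \<comment> \<open>Each of at most \<open>d\<close> leaves weighs at most
          \<open>2 * K ^ Suc \<Delta>\<close>, and \<open>2 * d < K\<close>; hence the exponent
          \<open>\<Delta> + 2\<close> in the required number of field elements.\<close>
        have "wt ?\<omega> T 1 1 \<le> psize T * (2 * K ^ Suc \<Delta>)"
          by (rule wt_le) (use horner_le[OF K2, of g B "Suc \<Delta>"] g(1) in \<open>meson add_leD1\<close>)
        also have "\<dots> = (2 * D) * K ^ Suc \<Delta>" using \<open>psize T = D\<close> by simp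
        also have "\<dots> < K * K ^ Suc \<Delta>" using D K(2) by (intro mult_strict_right_mono) auto
        also have "\<dots> = K ^ (\<Delta> + 2)" by simp
        finally show "wt ?\<omega> T 1 1 < K ^ (\<Delta> + 2)" .
      qed
      then obtain y where y: "y \<in> Y" "(\<Oplus>T\<in>S. vcoeff R ?f T \<otimes> y [^] wt ?\<omega> T 1 1) \<noteq> \<zero>" by auto
      then have "fst (poly_eval R d (diag_point R d n ?\<omega> y) ?f) (1, Suc D, 1) \<noteq> \<zero>"
        using fst_poly_eval_diag_point(1)[OF _ f D size, of y ?\<omega>] Y by (auto simp: S_def)
      moreover have "(1, Suc D, 1) \<in> idx d" using D by (simp add: idx_def)
      ultimately show ?thesis using y(1)
        by (intro bexI[of _ y]) (auto simp: alg_zero_def)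
    qed
  qed (rule g(1))
qed

end

section \<open>Running times of programs\<close>

definition runs :: "'a ring \<Rightarrow> (nat \<Rightarrow> 'a) \<Rightarrow> prog \<Rightarrow> nat \<Rightarrow> 'a state \<Rightarrow> ('a state \<Rightarrow> bool) \<Rightarrow> bool" where
  "runs F e p T st Q \<longleftrightarrow> (\<exists>t st'. exec F e p st t st' \<and> t \<le> T \<and> Q st')"

lemma runs_weaken: "runs F e p T st Q \<Longrightarrow> T \<le> T' \<Longrightarrow> (\<And>st'. Q st' \<Longrightarrow> Q' st') \<Longrightarrow> runs F e p T' st Q'"
  unfolding runs_def by (meson le_trans)

text \<open>Unlike \<open>runs\<close>, the postcondition sees the exact time, so rewriting executes
  a program symbolically and adds up its steps.\<close>

definition wp :: "'a ring \<Rightarrow> (nat \<Rightarrow> 'a) \<Rightarrow> prog \<Rightarrow> 'a state \<Rightarrow> (nat \<Rightarrow> 'a state \<Rightarrow> bool) \<Rightarrow> bool" where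
  "wp F e p st Q \<longleftrightarrow> (\<exists>t st'. exec F e p st t st' \<and> Q t st')"

lemma runs_iff_wp: "runs F e p T st Q \<longleftrightarrow> wp F e p st (\<lambda>t st'. t \<le> T \<and> Q st')"
  by (auto simp: runs_def wp_def)

lemma wp_if_runs: "runs F e p T st Q' \<Longrightarrow> (\<And>t st'. t \<le> T \<Longrightarrow> Q' st' \<Longrightarrow> Q t st') \<Longrightarrow> wp F e p st Q"
  by (auto simp: runs_def wp_def)

text \<open>Determinism makes these equivalences rather than implications, hence usable as rewrite
  rules.\<close>

lemma wp_basic:
  "wp F e Skip st Q \<longleftrightarrow> Q 1 st"
  "wp F e (NSet x u) st Q \<longleftrightarrow> Q 1 (nput st x (nval st u))"
  "wp F e (NAdd x u v) st Q \<longleftrightarrow> Q 1 (nput st x (nval st u + nval st v))"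
  "wp F e (NSub x u v) st Q \<longleftrightarrow> Q 1 (nput st x (nval st u - nval st v))"
  "wp F e (FOne y) st Q \<longleftrightarrow> Q 1 (fput st y \<one>\<^bsub>F\<^esub>)"
  "wp F e (FElem y u) st Q \<longleftrightarrow> Q 1 (fput st y (e (nval st u)))"
  "wp F e (FMul y z z') st Q \<longleftrightarrow> Q 1 (fput st y (fval st z \<otimes>\<^bsub>F\<^esub> fval st z'))"
  "wp F e (Emit y) st Q \<longleftrightarrow> Q 1 (State (nmem st) (fmem st) (out st @ [fval st y]))"
  unfolding wp_def by (blast intro: exec.intros dest: exec_deterministic[OF exec.intros(1)]
      exec_deterministic[OF exec.intros(2)] exec_deterministic[OF exec.intros(3)]
      exec_deterministic[OF exec.intros(4)] exec_deterministic[OF exec.intros(5)]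
      exec_deterministic[OF exec.intros(6)] exec_deterministic[OF exec.intros(9)]
      exec_deterministic[OF exec.intros(10)])+

lemma wp_Seq: "wp F e (Seq p q) st Q \<longleftrightarrow> wp F e p st (\<lambda>t st'. wp F e q st' (\<lambda>t' st''. Q (t + t') st''))"
  unfolding wp_def by (blast intro: exec.intros(11) elim: exec.cases[of F e "Seq p q"])

lemma wp_Cond: "wp F e (Cond c p q) st Q \<longleftrightarrow>
    (if holds st c then wp F e p st (\<lambda>t. Q (t + 1)) else wp F e q st (\<lambda>t. Q (t + 1)))"
proof (cases "holds st c")
  case True
  then show ?thesis unfolding wp_def if_P[OF True]
    by (blast intro: exec.intros(12) elim: exec.cases[of F e "Cond c p q"])
next
  case False
  then show ?thesis unfolding wp_def if_not_P[OF False]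
    by (blast intro: exec.intros(13) elim: exec.cases[of F e "Cond c p q"])
qed

lemmas wp_simps = wp_basic wp_Seq wp_Cond

lemma runs_While:
  assumes "I 0 st"
    and "\<And>j st. j < m \<Longrightarrow> I j st \<Longrightarrow> holds st c \<and> runs F e p T st (I (Suc j))"
    and "\<And>st. I m st \<Longrightarrow> \<not> holds st c \<and> Q st"
  shows "runs F e (While c p) (m * (T + 1) + 1) st Q"
proof -
  have "runs F e (While c p) (l * (T + 1) + 1) st Q" if "I j st" "j + l = m" for l j st
    using that
  proof (induction l arbitrary: j st)
    case 0
    then have "\<not> holds st c \<and> Q st" using assms(3) by simp
    then show ?case unfolding runs_def using exec.intros(14)[of st c F e p] by auto
  next
    case (Suc l)
    then have "holds st c" "runs F e p T st (I (Suc j))" using assms(2)[of j st] by auto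
    then obtain t st' where p: "holds st c" "exec F e p st t st'" "t \<le> T" "I (Suc j) st'"
      by (auto simp: runs_def)
    from Suc.IH[OF p(4)] Suc.prems obtain t' st'' where
      "exec F e (While c p) st' t' st''" "t' \<le> l * (T + 1) + 1" "Q st''" by (auto simp: runs_def)
    moreover from exec.intros(15)[OF p(1,2) this(1)]
    have "exec F e (While c p) st (t + t' + 1) st''" .
    ultimately show ?case unfolding runs_def using p(3)
      by (intro exI[of _ "t + t' + 1"] exI[of _ st'']) auto
  qed
  from this[OF assms(1), of m] show ?thesis by simp
qed

definition for_loop :: "nat \<Rightarrow> nat \<Rightarrow> prog \<Rightarrow> prog" where
  "for_loop i b p = Seq (NSet (Dir i) (Imm 0)) (While (NLess (At (Dir i)) (At (Dir b)))
     (Seq p (NAdd (Dir i) (At (Dir i)) (Imm 1))))"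

lemma runs_for_loop:
  assumes ib: "i \<noteq> b" and b: "nmem st b = m" and J0: "J 0 (nput st (Dir i) 0)"
    and step: "\<And>j st. j < m \<Longrightarrow> nmem st i = j \<Longrightarrow> nmem st b = m \<Longrightarrow> J j st \<Longrightarrow>
      runs F e p T st (\<lambda>st'. nmem st' i = j \<and> nmem st' b = m \<and> J (Suc j) (nput st' (Dir i) (Suc j)))"
    and fin: "\<And>st. J m st \<Longrightarrow> nmem st i = m \<Longrightarrow> Q st"
  shows "runs F e (for_loop i b p) (m * (T + 2) + 2) st Q"
proof -
  have "runs F e (While (NLess (At (Dir i)) (At (Dir b))) (Seq p (NAdd (Dir i) (At (Dir i)) (Imm 1))))
      (m * (T + 1 + 1) + 1) (nput st (Dir i) 0) Q"
  proof (rule runs_While[where I = "\<lambda>j st. nmem st i = j \<and> nmem st b = m \<and> J j st"])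
    show "nmem (nput st (Dir i) 0) i = 0 \<and> nmem (nput st (Dir i) 0) b = m \<and> J 0 (nput st (Dir i) 0)"
      using ib b J0 by (simp add: nput_def)
  next
    fix j st assume j: "j < m" and I: "nmem st i = j \<and> nmem st b = m \<and> J j st"
    have "runs F e (Seq p (NAdd (Dir i) (At (Dir i)) (Imm 1))) (T + 1) st
        (\<lambda>st'. nmem st' i = Suc j \<and> nmem st' b = m \<and> J (Suc j) st')"
      unfolding runs_iff_wp wp_simps
      by (rule wp_if_runs[OF step[of j st]]) (use j I ib in \<open>auto simp: nput_def\<close>)
    then show "holds st (NLess (At (Dir i)) (At (Dir b))) \<and>
        runs F e (Seq p (NAdd (Dir i) (At (Dir i)) (Imm 1))) (T + 1) st
        (\<lambda>st'. nmem st' i = Suc j \<and> nmem st' b = m \<and> J (Suc j) st')"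
      using j I by simp
  qed (use fin in simp)
  then show ?thesis unfolding for_loop_def runs_iff_wp wp_simps nval.simps
    by (rule wp_if_runs[unfolded runs_iff_wp]) auto
qed

lemma out_nput: "out (nput st x v) = out st"
  by (simp add: nput_def)

text \<open>The form needed for nested loops: \<open>E\<close> records the registers that stay
  fixed, and the output of a round depends only on the counter.\<close>

lemma runs_for_loop_emit:
  assumes ib: "i \<noteq> b" and E: "E st"
    and body: "\<And>j st. j < m \<Longrightarrow> E st \<Longrightarrow> nmem st i = j \<Longrightarrow>
      runs F e p T st (\<lambda>st'. E st' \<and> nmem st' i = j \<and> out st' = out st @ f j)"
    and stable: "\<And>st x. E st \<Longrightarrow> E (nput st (Dir i) x)"
    and Eb: "\<And>st. E st \<Longrightarrow> nmem st b = m"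
  shows "runs F e (for_loop i b p) (m * (T + 2) + 2) st
    (\<lambda>st'. E st' \<and> out st' = out st @ concat (map f [0..<m]))"
proof (rule runs_for_loop[OF ib Eb[OF E], where J = "\<lambda>j st'. E st' \<and> out st' = out st @ concat (map f [0..<j])"])
  show "E (nput st (Dir i) 0) \<and> out (nput st (Dir i) 0) = out st @ concat (map f [0..<0])"
    using stable[OF E] by (simp add: nput_def)
next
  fix j st1 assume j: "j < m" "nmem st1 i = j" "E st1 \<and> out st1 = out st @ concat (map f [0..<j])"
  show "runs F e p T st1 (\<lambda>st'. nmem st' i = j \<and> nmem st' b = m \<and> E (nput st' (Dir i) (Suc j)) \<and>
      out (nput st' (Dir i) (Suc j)) = out st @ concat (map f [0..<Suc j]))"
    by (rule runs_weaken[OF body[of j st1]]) (use j stable Eb in \<open>auto simp: out_nput\<close>)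
qed simp

section \<open>Arithmetic subroutines of the machine\<close>

text \<open>The machine only adds and subtracts, so a product takes time linear in the value of
  register \<open>b\<close>. This is affordable because \<open>b\<close> never holds more than
  \<open>K\<close> here.\<close>

definition mul_prog :: "nat \<Rightarrow> nat \<Rightarrow> nat \<Rightarrow> nat \<Rightarrow> prog" where
  "mul_prog r a b i = Seq (NSet (Dir r) (Imm 0)) (for_loop i b (NAdd (Dir r) (At (Dir r)) (At (Dir a))))"

lemma runs_mul_prog:
  assumes "r \<noteq> i" "r \<noteq> a" "r \<noteq> b" "i \<noteq> a" "i \<noteq> b"
    and "Q (State (N(r := N a * N b, i := N b)) G os)"
  shows "runs F e (mul_prog r a b i) (3 * N b + 3) (State N G os) Q"
proof -
  have "runs F e (for_loop i b (NAdd (Dir r) (At (Dir r)) (At (Dir a)))) (N b * (1 + 2) + 2)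
      (State (N(r := 0)) G os) Q"
    by (rule runs_for_loop[where J = "\<lambda>j st. st = State (N(r := N a * j, i := j)) G os"])
      (use assms in \<open>auto simp: nput_def runs_iff_wp wp_simps\<close>)
  then show ?thesis unfolding mul_prog_def runs_iff_wp wp_simps nput_def loc.simps state.sel nval.simps
    by (rule wp_if_runs[unfolded runs_iff_wp]) auto
qed

fun seq :: "prog list \<Rightarrow> prog" where
  "seq [] = Skip"
| "seq [p] = p"
| "seq (p # ps) = Seq p (seq ps)"

text \<open>One step of \<open>horner\<close>. Register 19 holds the rest of the parameter and is
  divided by \<open>K\<close>; 23 is the modulus, 24 the power of two modulo it, 20 the weight so
  far. Register 14 holds \<open>K - 1\<close> since only strict comparison is available. The power
  itself is never formed: doubling alternates with reduction.\<close>

definition digit_prog :: prog where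
  "digit_prog = seq
    [NSet (Dir 22) (Imm 0),
     While (NLess (At (Dir 14)) (At (Dir 19)))
       (Seq (NSub (Dir 19) (At (Dir 19)) (At (Dir 5))) (NAdd (Dir 22) (At (Dir 22)) (Imm 1))),
     NAdd (Dir 23) (At (Dir 19)) (Imm 2),
     NSet (Dir 24) (Imm 1),
     for_loop 25 18 (Seq (NAdd (Dir 24) (At (Dir 24)) (At (Dir 24)))
       (Cond (NLess (At (Dir 24)) (At (Dir 23))) Skip (NSub (Dir 24) (At (Dir 24)) (At (Dir 23))))),
     mul_prog 26 20 5 27,
     NAdd (Dir 20) (At (Dir 26)) (At (Dir 24)),
     NSet (Dir 19) (At (Dir 22))]"

lemma runs_divmod:
  assumes K: "N 14 = K - 1" "N 5 = K" "1 \<le> K" and x: "N 19 = x"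
    and Q: "Q (State (N(19 := x mod K, 22 := x div K)) G os)"
  shows "runs F e (While (NLess (At (Dir 14)) (At (Dir 19)))
       (Seq (NSub (Dir 19) (At (Dir 19)) (At (Dir 5))) (NAdd (Dir 22) (At (Dir 22)) (Imm 1))))
     (x div K * 3 + 1) (State (N(22 := 0)) G os) Q"
proof -
  have le: "j * K \<le> x" if "j \<le> x div K" for j
    using that K by (metis div_le_mono div_mult_self_is_m le_trans less_eq_div_iff_mult_less_eq less_le_trans zero_less_one)
  have "runs F e (While (NLess (At (Dir 14)) (At (Dir 19)))
       (Seq (NSub (Dir 19) (At (Dir 19)) (At (Dir 5))) (NAdd (Dir 22) (At (Dir 22)) (Imm 1))))
     (x div K * (1 + 1 + 1) + 1) (State (N(22 := 0)) G os) Q"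
  proof (rule runs_While[where I = "\<lambda>j st. st = State (N(19 := x - j * K, 22 := j)) G os"])
    show "State (N(22 := 0)) G os = State (N(19 := x - 0 * K, 22 := 0)) G os" using x by auto
  next
    fix j and st :: "'a state" assume j: "j < x div K" "st = State (N(19 := x - j * K, 22 := j)) G os"
    then have "Suc j * K \<le> x" using le[of "Suc j"] by simp
    then have "K - 1 < x - j * K" using K(3) by simp
    then show "holds st (NLess (At (Dir 14)) (At (Dir 19))) \<and>
      runs F e (Seq (NSub (Dir 19) (At (Dir 19)) (At (Dir 5))) (NAdd (Dir 22) (At (Dir 22)) (Imm 1))) (1 + 1) st
        (\<lambda>st. st = State (N(19 := x - Suc j * K, 22 := Suc j)) G os)"
      using j K by (auto simp: runs_iff_wp wp_simps nput_def fun_eq_iff)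
  next
    fix st :: "'a state" assume "st = State (N(19 := x - x div K * K, 22 := x div K)) G os"
    moreover have "x - x div K * K = x mod K" by (simp add: minus_div_mult_eq_mod)
    moreover have "\<not> K - 1 < x mod K" using mod_less_divisor[of K x] K(3) by linarith
    ultimately show "\<not> holds st (NLess (At (Dir 14)) (At (Dir 19))) \<and> Q st" using Q K by simp
  qed
  then show ?thesis by (rule runs_weaken) auto
qed

text \<open>The double of a residue is below \<open>2 * q\<close>, so one subtraction reduces
  it.\<close>

lemma double_mod:
  assumes "2 \<le> q"
  shows "(2 ^ Suc j mod q :: nat) = (if 2 ^ j mod q + 2 ^ j mod q < q then 2 ^ j mod q + 2 ^ j mod q
    else 2 ^ j mod q + 2 ^ j mod q - q)"
proof -
  define r where "r = (2::nat) ^ j mod q"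
  have "2 ^ Suc j mod q = (r + r) mod q" by (simp add: r_def mod_add_eq mult_2)
  moreover have "r < q" using assms by (simp add: r_def)
  ultimately show ?thesis unfolding r_def[symmetric] by (auto simp: mod_if)
qed

lemma runs_pow2_mod:
  assumes q: "N 23 = q" "2 \<le> q" and i: "N 18 = l"
    and Q: "Q (State (N(24 := 2 ^ l mod q, 25 := l)) G os)"
  shows "runs F e (for_loop 25 18 (Seq (NAdd (Dir 24) (At (Dir 24)) (At (Dir 24)))
       (Cond (NLess (At (Dir 24)) (At (Dir 23))) Skip (NSub (Dir 24) (At (Dir 24)) (At (Dir 23))))))
     (l * 5 + 2) (State (N(24 := 1)) G os) Q"
proof -
  have "runs F e (for_loop 25 18 (Seq (NAdd (Dir 24) (At (Dir 24)) (At (Dir 24)))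
       (Cond (NLess (At (Dir 24)) (At (Dir 23))) Skip (NSub (Dir 24) (At (Dir 24)) (At (Dir 23))))))
     (l * ((1 + (1 + 1)) + 2) + 2) (State (N(24 := 1)) G os) Q"
  proof (rule runs_for_loop[where J = "\<lambda>j st. st = State (N(24 := 2 ^ j mod q, 25 := j)) G os"])
    show "nput (State (N(24 := 1)) G os) (Dir 25) 0 = State (N(24 := 2 ^ 0 mod q, 25 := 0)) G os"
      using q by (simp add: nput_def)
  next
    fix j and st :: "'a state" assume st: "st = State (N(24 := 2 ^ j mod q, 25 := j)) G os"
    show "runs F e (Seq (NAdd (Dir 24) (At (Dir 24)) (At (Dir 24)))
         (Cond (NLess (At (Dir 24)) (At (Dir 23))) Skip (NSub (Dir 24) (At (Dir 24)) (At (Dir 23)))))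
       (1 + (1 + 1)) st (\<lambda>st'. nmem st' 25 = j \<and> nmem st' 18 = l \<and>
         nput st' (Dir 25) (Suc j) = State (N(24 := 2 ^ Suc j mod q, 25 := Suc j)) G os)"
      unfolding double_mod[OF q(2)] st using q i
      by (auto simp: runs_iff_wp wp_simps nput_def fun_eq_iff)
  qed (use i Q in auto)
  then show ?thesis by (rule runs_weaken) auto
qed

text \<open>Register 21 is listed among the unchanged ones because it counts the rounds of the
  enclosing loop.\<close>

lemma runs_digit_prog:
  assumes K: "N 14 = K - 1" "N 5 = K" "1 \<le> K" and x: "N 19 = x" and w: "N 20 = w" and l: "N 18 = l"
    and Q: "\<And>N'. N' 19 = x div K \<Longrightarrow> N' 20 = K * w + 2 ^ l mod (x mod K + 2) \<Longrightarrow>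
      (\<And>r. r < 19 \<or> r = 21 \<Longrightarrow> N' r = N r) \<Longrightarrow> Q (State N' G os)"
  shows "runs F e digit_prog (3 * x + 5 * l + 3 * K + 11) (State N G os) Q"
proof -
  let ?N1 = "N(19 := x mod K, 22 := x div K)"
  let ?q = "x mod K + 2"
  let ?N2 = "?N1(23 := ?q)"
  let ?N3 = "?N2(24 := 2 ^ l mod ?q, 25 := l)"
  have e: "?N1 19 + 2 = ?q" by simp
  have "x div K \<le> x" by simp
  then have t: "x div K * 3 + 1 + (5 * l + 2) + (3 * K + 3) + 5 \<le> 3 * x + 5 * l + 3 * K + 11" by linarith
  show ?thesis
    unfolding digit_prog_def seq.simps runs_iff_wp wp_simps nput_def loc.simps state.sel nval.simps
    apply (rule wp_if_runs[OF runs_divmod[where Q = "\<lambda>st. st = State ?N1 G os", OF K x refl]])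
    apply hypsubst
    unfolding state.sel e
    apply (rule wp_if_runs[OF runs_pow2_mod[where N = ?N2 and q = ?q and l = l and Q = "\<lambda>st. st = State ?N3 G os"]])
        apply simp
       apply simp
      apply (simp add: l)
     apply simp
    apply hypsubst
    apply (rule wp_if_runs[OF runs_mul_prog[where N = ?N3 and r = 26 and a = 20 and b = 5 and i = 27 and
          Q = "\<lambda>st. st = State (?N3(26 := K * w, 27 := K)) G os"]])
          apply (simp_all add: w K mult.commute)
    apply (intro conjI)
    using t apply linarith
    apply (rule Q)
      apply auto
    done
qed

section \<open>The program that lists the hitting set\<close>

text \<open>Registers below 15 keep their values during the loops: 0 to 3 hold the arguments,
  4 to 6 hold \<open>B = nsd + 1\<close>, \<open>K = B\<^sup>1\<^sup>6\<close> and the number of points, 7 to 11 the counters of point,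
  variable, row, column and layer, 12 to 14 hold \<open>d + 1\<close>, \<open>\<Delta> + 1\<close> and \<open>K - 1\<close>. Counters start at 0,
  hence the successors in the arguments of the weights. Field register 0 stays 0.\<close>

definition weight_prog :: prog where
  "weight_prog = seq
    [mul_prog 16 15 4 17,
     NAdd (Dir 16) (At (Dir 16)) (At (Dir 8)),
     NAdd (Dir 16) (At (Dir 16)) (Imm 1),
     mul_prog 18 16 4 17,
     NAdd (Dir 18) (At (Dir 18)) (At (Dir 11)),
     NAdd (Dir 18) (At (Dir 18)) (Imm 1),
     NSet (Dir 19) (At (Dir 7)),
     NSet (Dir 20) (Imm 0),
     for_loop 21 13 digit_prog]"

definition power_prog :: prog where
  "power_prog = seq
    [FElem (Dir 1) (At (Dir 19)),
     FOne (Dir 2),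
     for_loop 21 20 (FMul (Dir 2) (Dir 2) (Dir 1)),
     Emit (Dir 2)]"

definition coord_prog :: prog where
  "coord_prog = seq
    [NAdd (Dir 15) (At (Dir 9)) (Imm 1),
     Cond (NEq (At (Dir 10)) (At (Dir 15))) (Seq weight_prog power_prog) (Emit (Dir 0))]"

text \<open>A parameter \<open>c\<close> encodes in base \<open>K\<close> one modulus for each height, and the index of \<open>y\<close> above.\<close>

definition param_weight :: "nat \<Rightarrow> nat \<Rightarrow> nat \<Rightarrow> nat \<Rightarrow> nat \<Rightarrow> nat \<Rightarrow> nat \<Rightarrow> nat" where
  "param_weight B K c = horner B K (\<lambda>h. c div K ^ h mod K)"

lemma runs_digit_loop:
  assumes K: "N 14 = K - 1" "N 5 = K" "1 \<le> K" and m: "N 13 = m"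
    and x: "N 19 = c" and w: "N 20 = 0" and l: "N 18 = lidx B v k i"
    and Q: "\<And>N'. N' 19 = c div K ^ m \<Longrightarrow> N' 20 = param_weight B K c m v k i \<Longrightarrow>
      (\<And>r. r < 15 \<Longrightarrow> N' r = N r) \<Longrightarrow> Q (State N' G os)"
  shows "runs F e (for_loop 21 13 digit_prog) (m * (3 * c + 5 * lidx B v k i + 3 * K + 13) + 2)
    (State N G os) Q"
proof -
  let ?T = "3 * c + 5 * lidx B v k i + 3 * K + 11"
  define J where "J h st \<longleftrightarrow> (\<exists>N'. st = State N' G os \<and> N' 19 = c div K ^ h \<and>
      N' 20 = param_weight B K c h v k i \<and> N' 18 = lidx B v k i \<and> (\<forall>r < 15. N' r = N r))" for h st
  have "runs F e (for_loop 21 13 digit_prog) (m * (?T + 2) + 2) (State N G os) Q"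
  proof (rule runs_for_loop[where J = J])
    show "J 0 (nput (State N G os) (Dir 21) 0)"
      using x w l by (auto simp: J_def nput_def param_weight_def)
    show "Q st" if "J m st" for st using that Q by (auto simp: J_def)
    fix h st assume h: "nmem st 21 = h" "nmem st 13 = m" "J h st"
    from h(3) obtain N' where N': "st = State N' G os" "N' 19 = c div K ^ h"
      "N' 20 = param_weight B K c h v k i" "N' 18 = lidx B v k i" "\<And>r. r < 15 \<Longrightarrow> N' r = N r"
      unfolding J_def by auto
    have "runs F e digit_prog (3 * (c div K ^ h) + 5 * lidx B v k i + 3 * K + 11) (State N' G os)
        (\<lambda>st'. nmem st' 21 = h \<and> nmem st' 13 = m \<and> J (Suc h) (nput st' (Dir 21) (Suc h)))"
    proof (rule runs_digit_prog[OF _ _ K(3) N'(2,3,4)])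
      show "N' 14 = K - 1" "N' 5 = K" using K N'(5) by auto
      fix N2 assume N2: "N2 19 = c div K ^ h div K"
        "N2 20 = K * param_weight B K c h v k i + 2 ^ lidx B v k i mod (c div K ^ h mod K + 2)"
        "\<And>r. r < 19 \<or> r = 21 \<Longrightarrow> N2 r = N' r"
      have "c div K ^ h div K = c div K ^ Suc h" by (metis div_mult2_eq power_Suc2)
      then show "nmem (State N2 G os) 21 = h \<and> nmem (State N2 G os) 13 = m \<and>
          J (Suc h) (nput (State N2 G os) (Dir 21) (Suc h))"
        using N2 N' h m by (auto simp: J_def nput_def param_weight_def)
    qed
    then show "runs F e digit_prog ?T st
        (\<lambda>st'. nmem st' 21 = h \<and> nmem st' 13 = m \<and> J (Suc h) (nput st' (Dir 21) (Suc h)))"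
      unfolding N'(1) by (rule runs_weaken) (simp_all add: div_le_dividend)
  qed (use m in auto)
  then show ?thesis by (simp add: algebra_simps)
qed

lemma runs_weight_prog:
  assumes env: "N 14 = K - 1" "N 5 = K" "1 \<le> K" "N 13 = m" "N 4 = B"
    and pos: "N 15 = Suc i" "N 7 = c" "N 8 = v" "N 11 = k"
    and Q: "\<And>N'. N' 19 = c div K ^ m \<Longrightarrow> N' 20 = param_weight B K c m (Suc v) (Suc k) (Suc i) \<Longrightarrow>
      (\<And>r. r < 15 \<Longrightarrow> N' r = N r) \<Longrightarrow> Q (State N' G os)"
  shows "runs F e weight_prog
    (6 * B + m * (3 * c + 5 * lidx B (Suc v) (Suc k) (Suc i) + 3 * K + 13) + 14) (State N G os) Q"
proof -
  let ?l = "lidx B (Suc v) (Suc k) (Suc i)"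
  let ?N1 = "N(16 := Suc i * B, 17 := B)"
  let ?N2 = "?N1(16 := Suc i * B + Suc v)"
  let ?N3 = "?N2(18 := (Suc i * B + Suc v) * B, 17 := B)"
  let ?N4 = "?N3(18 := ?l, 19 := c, 20 := 0)"
  show ?thesis
    unfolding weight_prog_def seq.simps runs_iff_wp wp_simps nput_def loc.simps state.sel nval.simps
    apply (rule wp_if_runs[OF runs_mul_prog[where Q = "\<lambda>st. st = State ?N1 G os"]])
          apply (simp_all only: env pos)
          apply simp_all
    apply (rule wp_if_runs[OF runs_mul_prog[where Q = "\<lambda>st. st = State ?N3 G os"]])
          apply (simp_all add: env pos fun_upd_twist)
    apply (rule wp_if_runs[OF runs_digit_loop[where B = B and v = "Suc v" and k = "Suc k" and i = "Suc i"
            and K = K and m = m and c = c and Q = Q]])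
            using env(3) apply (simp_all add: env lidx_def Q)
    done
qed

lemma runs_power_prog:
  assumes x: "N 19 = x" and w: "N 20 = w"
    and Q: "\<And>N' G'. (\<And>r. r < 15 \<Longrightarrow> N' r = N r) \<Longrightarrow> G' 0 = G 0 \<Longrightarrow>
      Q (State N' G' (os @ [e x [^]\<^bsub>F\<^esub> w]))"
  shows "runs F e power_prog (3 * w + 5) (State N G os) Q"
proof -
  let ?G = "G(1 := e x, 2 := \<one>\<^bsub>F\<^esub>)"
  have "runs F e (for_loop 21 20 (FMul (Dir 2) (Dir 2) (Dir 1))) (w * (1 + 2) + 2) (State N ?G os)
      (\<lambda>st. st = State (N(21 := w)) (?G(2 := e x [^]\<^bsub>F\<^esub> w)) os)"
  proof (rule runs_for_loop[where J = "\<lambda>h st. st = State (N(21 := h)) (?G(2 := e x [^]\<^bsub>F\<^esub> h)) os"])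
    show "nput (State N ?G os) (Dir 21) 0 = State (N(21 := 0)) (?G(2 := e x [^]\<^bsub>F\<^esub> (0::nat))) os"
      by (simp add: nput_def nat_pow_def)
  qed (use w in \<open>auto simp: runs_iff_wp wp_simps nput_def fput_def fval_def nat_pow_def\<close>)
  then show ?thesis
    unfolding power_prog_def seq.simps runs_iff_wp wp_simps fput_def loc.simps state.sel nval.simps x
    by (rule wp_if_runs[unfolded runs_iff_wp]) (auto simp: fval_def intro!: Q)
qed

lemma runs_coord_prog:
  assumes env: "N 14 = K - 1" "N 5 = K" "1 \<le> K" "N 13 = m" "N 4 = B"
    and pos: "N 7 = c" "N 8 = v" "N 9 = i" "N 10 = j" "N 11 = k"
    and Q: "\<And>N' G'. (\<And>r. r < 15 \<Longrightarrow> N' r = N r) \<Longrightarrow> G' 0 = G 0 \<Longrightarrow>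
      Q (State N' G' (os @ [if j = Suc i then
          e (c div K ^ m) [^]\<^bsub>F\<^esub> param_weight B K c m (Suc v) (Suc k) (Suc i) else G 0]))"
  shows "runs F e coord_prog
    (6 * B + m * (3 * c + 5 * lidx B (Suc v) (Suc k) (Suc i) + 3 * K + 13) +
      3 * param_weight B K c m (Suc v) (Suc k) (Suc i) + 21) (State N G os) Q"
proof (cases "j = Suc i")
  case True
  let ?W = "param_weight B K c m (Suc v) (Suc k) (Suc i)"
  let ?T = "6 * B + m * (3 * c + 5 * lidx B (Suc v) (Suc k) (Suc i) + 3 * K + 13) + 14"
  have "runs F e weight_prog ?T (State (N(15 := Suc i)) G os)
      (\<lambda>st. \<exists>N'. st = State N' G os \<and> N' 19 = c div K ^ m \<and> N' 20 = ?W \<and> (\<forall>r < 15. N' r = N r))"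
    by (rule runs_weight_prog) (use env pos in auto)
  then obtain t1 N' where 1: "exec F e weight_prog (State (N(15 := Suc i)) G os) t1 (State N' G os)"
    "t1 \<le> ?T" "N' 19 = c div K ^ m" "N' 20 = ?W" "\<And>r. r < 15 \<Longrightarrow> N' r = N r"
    unfolding runs_def by blast
  have "runs F e power_prog (3 * ?W + 5) (State N' G os) Q"
    by (rule runs_power_prog[OF 1(3,4)]) (use True 1(5) Q in auto)
  then obtain t2 st2 where 2: "exec F e power_prog (State N' G os) t2 st2" "t2 \<le> 3 * ?W + 5" "Q st2"
    unfolding runs_def by blast
  have "runs F e (Seq weight_prog power_prog) (?T + (3 * ?W + 5)) (State (N(15 := Suc i)) G os) Q"
    unfolding runs_def using exec.intros(11)[OF 1(1) 2(1)] 1(2) 2(2,3) add_mono by blast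
  then show ?thesis
    unfolding coord_prog_def seq.simps runs_iff_wp
    by (subst wp_Seq) (use True pos in \<open>auto simp: wp_basic wp_Cond nput_def elim!: wp_if_runs[unfolded runs_iff_wp]\<close>)
next
  case False
  show ?thesis
    unfolding coord_prog_def seq.simps runs_iff_wp wp_simps nput_def loc.simps state.sel nval.simps holds.simps
    using False pos by (auto simp: fval_def intro!: Q[unfolded if_not_P[OF False]])
qed

section \<open>Enumeration of all parameters and the cost of the nested loops\<close>

text \<open>\<open>K = B ^ 16\<close> is reached by four squarings. Register 18 becomes
  \<open>2 * \<Delta> + 3\<close>, the number of base-\<open>K\<close> digits of a parameter:
  \<open>\<Delta> + 1\<close> for the moduli and \<open>\<Delta> + 2\<close> for the index of
  \<open>y\<close>.\<close>

definition init_prog :: prog where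
  "init_prog = seq
    [mul_prog 15 0 1 16, mul_prog 17 15 2 16, NAdd (Dir 4) (At (Dir 17)) (Imm 1),
     mul_prog 15 4 4 16, mul_prog 17 15 15 16, mul_prog 15 17 17 16, mul_prog 5 15 15 16,
     seq [NAdd (Dir 12) (At (Dir 2)) (Imm 1), NAdd (Dir 13) (At (Dir 3)) (Imm 1),
       NSub (Dir 14) (At (Dir 5)) (Imm 1), NAdd (Dir 18) (At (Dir 3)) (At (Dir 3)),
       NAdd (Dir 18) (At (Dir 18)) (Imm 3)],
     NSet (Dir 6) (Imm 1),
     for_loop 19 18 (Seq (mul_prog 15 6 5 16) (NSet (Dir 6) (At (Dir 15))))]"

definition hitting_prog :: prog where
  "hitting_prog = Seq init_prog
    (for_loop 7 6
      (for_loop 8 0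
        (Seq (for_loop 9 12 (for_loop 10 12 (for_loop 11 2 coord_prog))) (Emit (Dir 0)))))"

definition layout :: "nat \<Rightarrow> nat \<Rightarrow> nat \<Rightarrow> nat \<Rightarrow> nat \<Rightarrow> nat \<Rightarrow> 'a \<Rightarrow> 'a state \<Rightarrow> bool" where
  "layout n d B K C m z st \<longleftrightarrow> nmem st 0 = n \<and> nmem st 2 = d \<and> nmem st 4 = B \<and> nmem st 5 = K \<and>
     nmem st 6 = C \<and> nmem st 12 = d + 1 \<and> nmem st 13 = m \<and> nmem st 14 = K - 1 \<and> fmem st 0 = z"

lemma runs_power_loop:
  assumes N: "N 5 = K" "N 18 = p"
    and Q: "\<And>N'. N' 6 = K ^ p \<Longrightarrow> (\<And>r. r < 15 \<Longrightarrow> r \<noteq> 6 \<Longrightarrow> N' r = N r) \<Longrightarrow> Q (State N' G os)"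
  shows "runs F e (for_loop 19 18 (Seq (mul_prog 15 6 5 16) (NSet (Dir 6) (At (Dir 15)))))
    (p * (3 * K + 6) + 2) (State (N(6 := 1)) G os) Q"
proof -
  define J where "J h st \<longleftrightarrow> (\<exists>N'. st = State N' G os \<and> N' 6 = K ^ h \<and> N' 18 = p \<and>
      (\<forall>r < 15. r \<noteq> 6 \<longrightarrow> N' r = N r))" for h st
  have "runs F e (for_loop 19 18 (Seq (mul_prog 15 6 5 16) (NSet (Dir 6) (At (Dir 15)))))
      (p * ((3 * K + 4) + 2) + 2) (State (N(6 := 1)) G os) Q"
  proof (rule runs_for_loop[where J = J])
    show "J 0 (nput (State (N(6 := 1)) G os) (Dir 19) 0)"
      using N by (auto simp: J_def nput_def)
    show "Q st" if "J p st" for st using that Q by (auto simp: J_def)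
    fix h st assume h: "nmem st 19 = h" "nmem st 18 = p" "J h st"
    from h(3) obtain N' where N': "st = State N' G os" "N' 6 = K ^ h" "N' 18 = p"
      "\<And>r. r < 15 \<Longrightarrow> r \<noteq> 6 \<Longrightarrow> N' r = N r"
      unfolding J_def by auto
    have K: "N' 5 = K" using N N' by simp
    have "runs F e (mul_prog 15 6 5 16) (3 * N' 5 + 3) (State N' G os)
      (\<lambda>st. st = State (N'(15 := K ^ h * K, 16 := K)) G os)"
      by (rule runs_mul_prog) (use N' K in auto)
    then show "runs F e (Seq (mul_prog 15 6 5 16) (NSet (Dir 6) (At (Dir 15)))) (3 * K + 4) st
        (\<lambda>st'. nmem st' 19 = h \<and> nmem st' 18 = p \<and> J (Suc h) (nput st' (Dir 19) (Suc h)))"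
      unfolding N'(1) runs_iff_wp wp_simps
      by (rule wp_if_runs[unfolded runs_iff_wp]) (use N' K h in \<open>auto simp: nput_def J_def\<close>)
  qed (use N in auto)
  then show ?thesis by (simp add: algebra_simps)
qed

lemma runs_chain:
  assumes "runs F e p T st (\<lambda>st1. st1 = st')" "runs F e q T' st' Q"
  shows "runs F e (Seq p q) (T + T') st Q"
proof -
  from assms(1) obtain t where "exec F e p st t st'" "t \<le> T" unfolding runs_def by blast
  moreover from assms(2) obtain t' st2 where "exec F e q st' t' st2" "t' \<le> T'" "Q st2"
    unfolding runs_def by blast
  ultimately show ?thesis unfolding runs_def using exec.intros(11) add_mono by blast
qed

lemma runs_init_prog:
  assumes B: "B = n * s * d + 1" and K: "K = B ^ 16"
  shows "runs F e init_prog
    (3 * s + 3 * d + 3 * B + 3 * B ^ 2 + 3 * B ^ 4 + 3 * B ^ 8 + (2 * \<Delta> + 3) * (3 * K + 6) + 40)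
    (start F [n, s, d, \<Delta>])
    (\<lambda>st. layout n d B K (K ^ (2 * \<Delta> + 3)) (\<Delta> + 1) \<zero>\<^bsub>F\<^esub> st \<and> out st = [])"
proof -
  let ?N = "\<lambda>r. if r < length [n, s, d, \<Delta>] then [n, s, d, \<Delta>] ! r else 0"
  let ?G = "\<lambda>r. \<zero>\<^bsub>F\<^esub>"
  have N0: "?N 0 = n" "?N 1 = s" "?N 2 = d" "?N 3 = \<Delta>" by simp_all
  obtain N where N: "N = ?N" by blast
  let ?N1 = "N(15 := n * s, 16 := s)"
  let ?N2 = "?N1(17 := n * s * d, 16 := d)"
  let ?N3 = "?N2(4 := B)"
  let ?N4 = "?N3(15 := B ^ 2, 16 := B)"
  let ?N5 = "?N4(17 := B ^ 4, 16 := B ^ 2)"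
  let ?N6 = "?N5(15 := B ^ 8, 16 := B ^ 4)"
  let ?N7 = "?N6(5 := K, 16 := B ^ 8)"
  let ?N8 = "?N7(12 := d + 1, 13 := \<Delta> + 1, 14 := K - 1, 18 := 2 * \<Delta> + 3)"
  have p: "B * B = B ^ 2" "B ^ 2 * B ^ 2 = B ^ 4" "B ^ 4 * B ^ 4 = B ^ 8" "B ^ 8 * B ^ 8 = K"
    unfolding K by (simp_all flip: power_add) (simp add: power2_eq_square)
  have M: "runs F e (mul_prog r a b i) (3 * y + 3) (State N' ?G [])
      (\<lambda>st. st = State (N'(r := z, i := y)) ?G [])"
    if "r \<noteq> i" "r \<noteq> a" "r \<noteq> b" "i \<noteq> a" "i \<noteq> b" "N' a = x" "N' b = y" "x * y = z" for N' r a b i x y z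
    using runs_mul_prog[of r i a b "\<lambda>st. st = State (N'(r := z, i := y)) ?G []" N' ?G "[]" F e] that
    by simp
  have s: "start F [n, s, d, \<Delta>] = State N ?G []" by (simp add: start_def N)
  have N0': "N 0 = n" "N 1 = s" "N 2 = d" "N 3 = \<Delta>" using N0 unfolding N .
  have m: "runs F e (mul_prog 15 0 1 16) (3 * s + 3) (State N ?G []) (\<lambda>st. st = State ?N1 ?G [])"
    "runs F e (mul_prog 17 15 2 16) (3 * d + 3) (State ?N1 ?G []) (\<lambda>st. st = State ?N2 ?G [])"
    "runs F e (mul_prog 15 4 4 16) (3 * B + 3) (State ?N3 ?G []) (\<lambda>st. st = State ?N4 ?G [])"
    "runs F e (mul_prog 17 15 15 16) (3 * B ^ 2 + 3) (State ?N4 ?G []) (\<lambda>st. st = State ?N5 ?G [])"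
    "runs F e (mul_prog 15 17 17 16) (3 * B ^ 4 + 3) (State ?N5 ?G []) (\<lambda>st. st = State ?N6 ?G [])"
    "runs F e (mul_prog 5 15 15 16) (3 * B ^ 8 + 3) (State ?N6 ?G []) (\<lambda>st. st = State ?N7 ?G [])"
    subgoal by (rule M[of 15 16 0 1 N n s]) (simp_all add: N0' N0'(2)[unfolded One_nat_def])
    subgoal by (rule M[of 17 16 15 2 ?N1 "n * s" d]) (simp_all add: N0')
    subgoal by (rule M[of 15 16 4 4 ?N3 B B]) (simp_all add: p)
    subgoal by (rule M[of 17 16 15 15 ?N4 "B ^ 2" "B ^ 2"]) (simp_all add: p)
    subgoal by (rule M[of 15 16 17 17 ?N5 "B ^ 4" "B ^ 4"]) (simp_all add: p)
    subgoal by (rule M[of 5 16 15 15 ?N6 "B ^ 8" "B ^ 8"]) (simp_all add: K)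
    done
  have b: "runs F e (NAdd (Dir 4) (At (Dir 17)) (Imm 1)) 1 (State ?N2 ?G []) (\<lambda>st. st = State ?N3 ?G [])"
    "runs F e (seq [NAdd (Dir 12) (At (Dir 2)) (Imm 1), NAdd (Dir 13) (At (Dir 3)) (Imm 1),
       NSub (Dir 14) (At (Dir 5)) (Imm 1), NAdd (Dir 18) (At (Dir 3)) (At (Dir 3)),
       NAdd (Dir 18) (At (Dir 18)) (Imm 3)]) 5 (State ?N7 ?G []) (\<lambda>st. st = State ?N8 ?G [])"
    by (auto simp: runs_iff_wp wp_simps nput_def B N0' fun_eq_iff)
  have l: "runs F e (for_loop 19 18 (Seq (mul_prog 15 6 5 16) (NSet (Dir 6) (At (Dir 15)))))
      ((2 * \<Delta> + 3) * (3 * K + 6) + 2) (State (?N8(6 := 1)) ?G [])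
      (\<lambda>st. layout n d B K (K ^ (2 * \<Delta> + 3)) (\<Delta> + 1) \<zero>\<^bsub>F\<^esub> st \<and> out st = [])"
    by (rule runs_power_loop) (auto simp: layout_def N0')
  then have l': "runs F e (Seq (NSet (Dir 6) (Imm 1))
      (for_loop 19 18 (Seq (mul_prog 15 6 5 16) (NSet (Dir 6) (At (Dir 15))))))
      (1 + ((2 * \<Delta> + 3) * (3 * K + 6) + 2)) (State ?N8 ?G [])
      (\<lambda>st. layout n d B K (K ^ (2 * \<Delta> + 3)) (\<Delta> + 1) \<zero>\<^bsub>F\<^esub> st \<and> out st = [])"
    by (intro runs_chain[where st' = "State (?N8(6 := 1)) ?G []"])
      (simp_all add: runs_iff_wp wp_simps nput_def)
  have "runs F e init_prog
    (3 * s + 3 + (3 * d + 3 + (1 + (3 * B + 3 + (3 * B ^ 2 + 3 + (3 * B ^ 4 + 3 + (3 * B ^ 8 + 3 +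
      (5 + (1 + ((2 * \<Delta> + 3) * (3 * K + 6) + 2))))))))))
    (State N ?G [])
    (\<lambda>st. layout n d B K (K ^ (2 * \<Delta> + 3)) (\<Delta> + 1) \<zero>\<^bsub>F\<^esub> st \<and> out st = [])"
    unfolding init_prog_def seq.simps
    by (rule runs_chain[OF m(1)] runs_chain[OF m(2)] runs_chain[OF b(1)] runs_chain[OF m(3)]
        runs_chain[OF m(4)] runs_chain[OF m(5)] runs_chain[OF m(6)] runs_chain[OF b(2)[unfolded seq.simps]] l')+
  then show ?thesis unfolding s by (rule runs_weaken) simp_all
qed

lemma layout_nput: "7 \<le> r \<Longrightarrow> r < 12 \<Longrightarrow> layout n d B K C m z (nput st (Dir r) x) = layout n d B K C m z st"
  by (simp add: layout_def nput_def)

definition coord_out :: "'a ring \<Rightarrow> (nat \<Rightarrow> 'a) \<Rightarrow> nat \<Rightarrow> nat \<Rightarrow> nat \<Rightarrow> 'a \<Rightarrow>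
    nat \<Rightarrow> nat \<Rightarrow> nat \<Rightarrow> nat \<Rightarrow> nat \<Rightarrow> 'a" where
  "coord_out F e B K m z c v i j k = (if j = Suc i
     then e (c div K ^ m) [^]\<^bsub>F\<^esub> param_weight B K c m (Suc v) (Suc k) (Suc i) else z)"

lemma runs_coord_prog_layout:
  assumes st: "layout n d B K C m z st" "nmem st 7 = c" "nmem st 8 = v" "nmem st 9 = i" "nmem st 10 = j"
    "nmem st 11 = k"
    and K: "1 \<le> K"
    and T: "6 * B + m * (3 * c + 5 * lidx B (Suc v) (Suc k) (Suc i) + 3 * K + 13) +
      3 * param_weight B K c m (Suc v) (Suc k) (Suc i) + 21 \<le> T"
  shows "runs F e coord_prog T st (\<lambda>st'. (layout n d B K C m z st' \<and> nmem st' 7 = c \<and> nmem st' 8 = v \<and>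
    nmem st' 9 = i \<and> nmem st' 10 = j) \<and> nmem st' 11 = k \<and> out st' = out st @ [coord_out F e B K m z c v i j k])"
proof -
  obtain N G os where s: "st = State N G os" by (cases st)
  show ?thesis unfolding s
    by (rule runs_weaken[OF runs_coord_prog[where K = K and m = m and B = B and c = c and v = v and i = i
          and j = j and k = k] T])
      (use st K in \<open>auto simp: s layout_def coord_out_def\<close>)
qed

text \<open>A loop of at most \<open>Z\<close> rounds raises the exponent by 2, so five nested loops
  turn \<open>Z ^ 3\<close> for one coordinate into \<open>Z ^ 13\<close>. The second version allows
  for the additional \<open>Emit\<close> of the scalar part of each algebra element.\<close>

lemma loop_time:
  fixes Z :: nat
  assumes "100 \<le> Z" "m \<le> Z" "T \<le> Z ^ a"
  shows "m * (T + 2) + 2 \<le> Z ^ (a + 2)" "m * ((T + 1) + 2) + 2 \<le> Z ^ (a + 2)"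
proof -
  have "1 \<le> Z ^ a" using assms by simp
  have "m * ((T + 1) + 2) + 2 \<le> Z * ((Z ^ a + 1) + 2) + 2" using assms by (intro add_mono mult_le_mono) auto
  also have "\<dots> \<le> Z * (Z * Z ^ a)"
  proof -
    have "(Z ^ a + 1) + 2 + 1 \<le> 100 * Z ^ a" using \<open>1 \<le> Z ^ a\<close> by simp
    also have "\<dots> \<le> Z * Z ^ a" using assms by simp
    finally have "Z * ((Z ^ a + 1) + 2 + 1) \<le> Z * (Z * Z ^ a)" by (rule mult_le_mono2)
    then show ?thesis using assms by (simp add: algebra_simps)
  qed
  finally show 1: "m * ((T + 1) + 2) + 2 \<le> Z ^ (a + 2)" by simp
  have "m * (T + 2) \<le> m * ((T + 1) + 2)" by (rule mult_le_mono2) simp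
  with 1 show "m * (T + 2) + 2 \<le> Z ^ (a + 2)" by linarith
qed

lemma runs_hitting_loops:
  fixes Z :: nat
  assumes st: "layout n d B K C m z st"
    and Z: "100 \<le> Z" "n \<le> Z" "d + 1 \<le> Z" "C \<le> Z" and K: "1 \<le> K"
    and T: "\<And>c v i j k. c < C \<Longrightarrow> v < n \<Longrightarrow> i < d + 1 \<Longrightarrow> k < d \<Longrightarrow>
      6 * B + m * (3 * c + 5 * lidx B (Suc v) (Suc k) (Suc i) + 3 * K + 13) +
      3 * param_weight B K c m (Suc v) (Suc k) (Suc i) + 21 \<le> Z ^ 3"
  shows "runs F e (for_loop 7 6 (for_loop 8 0
      (Seq (for_loop 9 12 (for_loop 10 12 (for_loop 11 2 coord_prog))) (Emit (Dir 0))))) (Z ^ 13) st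
    (\<lambda>st'. out st' = out st @ concat (map (\<lambda>c. concat (map (\<lambda>v.
      concat (map (\<lambda>i. concat (map (\<lambda>j. concat (map (\<lambda>k. [coord_out F e B K m z c v i j k])
        [0..<d])) [0..<d + 1])) [0..<d + 1]) @ [z]) [0..<n])) [0..<C]))"
proof -
  \<comment> \<open>From \<open>E1\<close> to \<open>E4\<close>, each invariant fixes the counter of
    one more enclosing loop.\<close>
  let ?L = "layout n d B K C m z"
  define E1 where "E1 c st \<longleftrightarrow> ?L st \<and> nmem st 7 = c" for c st
  define E2 where "E2 c v st \<longleftrightarrow> E1 c st \<and> nmem st 8 = v" for c v st
  define E3 where "E3 c v i st \<longleftrightarrow> E2 c v st \<and> nmem st 9 = i" for c v i st
  define E4 where "E4 c v i j st \<longleftrightarrow> E3 c v i st \<and> nmem st 10 = j" for c v i j st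
  note E = E1_def E2_def E3_def E4_def
  let ?fk = "\<lambda>c v i j k. [coord_out F e B K m z c v i j k]"
  let ?fj = "\<lambda>c v i j. concat (map (?fk c v i j) [0..<d])"
  let ?fi = "\<lambda>c v i. concat (map (?fj c v i) [0..<d + 1])"
  let ?fv = "\<lambda>c v. concat (map (?fi c v) [0..<d + 1]) @ [z]"
  let ?fc = "\<lambda>c. concat (map (?fv c) [0..<n])"
  let ?pj = "for_loop 11 2 coord_prog"
  let ?pi = "for_loop 10 12 ?pj"
  let ?pv = "Seq (for_loop 9 12 ?pi) (Emit (Dir 0))"
  have k: "runs F e ?pj (Z ^ 5) st (\<lambda>st'. E4 c v i j st' \<and> out st' = out st @ ?fj c v i j)"
    if c: "c < C" "v < n" "i < d + 1" "j < d + 1" and s: "E4 c v i j st" for c v i j st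
  proof -
    have "runs F e ?pj (d * (Z ^ 3 + 2) + 2) st (\<lambda>st'. E4 c v i j st' \<and> out st' = out st @ ?fj c v i j)"
    proof (rule runs_for_loop_emit[where E = "E4 c v i j" and f = "?fk c v i j", OF _ s])
      fix k st assume k: "k < d" "E4 c v i j st" "nmem st 11 = k"
      have "runs F e coord_prog (Z ^ 3) st (\<lambda>st'. (?L st' \<and> nmem st' 7 = c \<and> nmem st' 8 = v \<and>
        nmem st' 9 = i \<and> nmem st' 10 = j) \<and> nmem st' 11 = k \<and> out st' = out st @ ?fk c v i j k)"
        by (rule runs_coord_prog_layout) (use k K T[OF c(1-3) k(1)] in \<open>auto simp: E\<close>)
      then show "runs F e coord_prog (Z ^ 3) st (\<lambda>st'. E4 c v i j st' \<and> nmem st' 11 = k \<and> out st' = out st @ ?fk c v i j k)"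
        by (rule runs_weaken) (auto simp: E)
    qed (auto simp: E layout_nput, auto simp: nput_def layout_def)
    then show ?thesis by (rule runs_weaken) (use loop_time(1)[of Z d "Z ^ 3" 3] Z in auto)
  qed
  have j: "runs F e ?pi (Z ^ 7) st (\<lambda>st'. E3 c v i st' \<and> out st' = out st @ ?fi c v i)"
    if c: "c < C" "v < n" "i < d + 1" and s: "E3 c v i st" for c v i st
  proof -
    have "runs F e ?pi ((d + 1) * (Z ^ 5 + 2) + 2) st (\<lambda>st'. E3 c v i st' \<and> out st' = out st @ ?fi c v i)"
    proof (rule runs_for_loop_emit[where E = "E3 c v i" and f = "?fj c v i", OF _ s])
      fix j st assume j: "j < d + 1" "E3 c v i st" "nmem st 10 = j"
      show "runs F e ?pj (Z ^ 5) st (\<lambda>st'. E3 c v i st' \<and> nmem st' 10 = j \<and> out st' = out st @ ?fj c v i j)"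
        by (rule runs_weaken[OF k[OF c j(1)]]) (use j in \<open>auto simp: E\<close>)
    qed (auto simp: E layout_nput, auto simp: nput_def layout_def)
    then show ?thesis by (rule runs_weaken) (use loop_time(1)[of Z "d + 1" "Z ^ 5" 5] Z in auto)
  qed
  have i: "runs F e ?pv (Z ^ 9 + 1) st (\<lambda>st'. E2 c v st' \<and> out st' = out st @ ?fv c v)"
    if c: "c < C" "v < n" and s: "E2 c v st" for c v st
  proof -
    have "runs F e (for_loop 9 12 ?pi) ((d + 1) * (Z ^ 7 + 2) + 2) st
        (\<lambda>st'. E2 c v st' \<and> out st' = out st @ concat (map (?fi c v) [0..<d + 1]))"
    proof (rule runs_for_loop_emit[where E = "E2 c v" and f = "?fi c v", OF _ s])
      fix i st assume i: "i < d + 1" "E2 c v st" "nmem st 9 = i"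
      show "runs F e ?pi (Z ^ 7) st (\<lambda>st'. E2 c v st' \<and> nmem st' 9 = i \<and> out st' = out st @ ?fi c v i)"
        by (rule runs_weaken[OF j[OF c i(1)]]) (use i in \<open>auto simp: E\<close>)
    qed (auto simp: E layout_nput, auto simp: nput_def layout_def)
    then show ?thesis unfolding runs_iff_wp wp_simps
      by (rule wp_if_runs[unfolded runs_iff_wp])
        (use loop_time(1)[of Z "d + 1" "Z ^ 7" 7] Z in \<open>auto simp: E layout_def fval_def\<close>)
  qed
  have v: "runs F e (for_loop 8 0 ?pv) (Z ^ 11) st (\<lambda>st'. E1 c st' \<and> out st' = out st @ ?fc c)"
    if c: "c < C" and s: "E1 c st" for c st
  proof -
    have "runs F e (for_loop 8 0 ?pv) (n * (Z ^ 9 + 1 + 2) + 2) st (\<lambda>st'. E1 c st' \<and> out st' = out st @ ?fc c)"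
    proof (rule runs_for_loop_emit[where E = "E1 c" and f = "?fv c", OF _ s])
      fix v st assume v: "v < n" "E1 c st" "nmem st 8 = v"
      show "runs F e ?pv (Z ^ 9 + 1) st (\<lambda>st'. E1 c st' \<and> nmem st' 8 = v \<and> out st' = out st @ ?fv c v)"
        by (rule runs_weaken[OF i[OF c v(1)]]) (use v in \<open>auto simp: E\<close>)
    qed (auto simp: E layout_nput, auto simp: nput_def layout_def)
    then show ?thesis by (rule runs_weaken) (use loop_time(2)[of Z n "Z ^ 9" 9] Z in auto)
  qed
  have "runs F e (for_loop 7 6 (for_loop 8 0 ?pv)) (C * (Z ^ 11 + 2) + 2) st
      (\<lambda>st'. ?L st' \<and> out st' = out st @ concat (map ?fc [0..<C]))"
  proof (rule runs_for_loop_emit[where E = "?L" and f = "?fc", OF _ st])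
    fix c st assume c: "c < C" "?L st" "nmem st 7 = c"
    show "runs F e (for_loop 8 0 ?pv) (Z ^ 11) st (\<lambda>st'. ?L st' \<and> nmem st' 7 = c \<and> out st' = out st @ ?fc c)"
      by (rule runs_weaken[OF v[OF c(1)]]) (use c in \<open>auto simp: E\<close>)
  qed (auto simp: layout_nput, auto simp: layout_def)
  then show ?thesis by (rule runs_weaken) (use loop_time(1)[of Z C "Z ^ 11" 11] Z in auto)
qed

section \<open>Correctness and running time of the listed hitting set\<close>

definition hitting_point :: "'a ring \<Rightarrow> (nat \<Rightarrow> 'a) \<Rightarrow> nat \<Rightarrow> nat \<Rightarrow> nat \<Rightarrow> nat \<Rightarrow> nat \<Rightarrow> nat \<Rightarrow> nat \<Rightarrow> 'a elt" where
  "hitting_point F e d n B K m c = diag_point F d n (param_weight B K c m) (e (c div K ^ m))"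

lemma map_from_1: "map f [1..<Suc k] = map (\<lambda>i. f (Suc i)) [0..<k]"
  unfolding One_nat_def map_Suc_upt[symmetric] by (simp add: comp_def)

text \<open>The loops run in the order in which \<open>elt_code\<close> lists the coordinates, row,
  column, layer and then the scalar part; only the ranges have to be shifted to start at 0.\<close>

lemma point_code_hitting_point:
  "point_code d n (hitting_point F e d n B K m c) =
    concat (map (\<lambda>v. concat (map (\<lambda>i. concat (map (\<lambda>j. concat (map
      (\<lambda>k. [coord_out F e B K m \<zero>\<^bsub>F\<^esub> c v i j k]) [0..<d])) [0..<d + 1])) [0..<d + 1]) @ [\<zero>\<^bsub>F\<^esub>]) [0..<n])"
proof -
  have "elt_code d (hitting_point F e d n B K m c (Suc v)) =
      concat (map (\<lambda>i. concat (map (\<lambda>j. concat (map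
        (\<lambda>k. [coord_out F e B K m \<zero>\<^bsub>F\<^esub> c v i j k]) [0..<d])) [0..<d + 1])) [0..<d + 1]) @ [\<zero>\<^bsub>F\<^esub>]"
    if "v < n" for v
  proof -
    have 1: "fst (hitting_point F e d n B K m c (Suc v)) (Suc i, Suc j, Suc k) = coord_out F e B K m \<zero>\<^bsub>F\<^esub> c v i j k"
      if "i < d + 1" "j < d + 1" "k < d" for i j k
      using that \<open>v < n\<close> by (simp add: hitting_point_def diag_point_def coord_out_def idx_def)
    have 2: "snd (hitting_point F e d n B K m c (Suc v)) = \<zero>\<^bsub>F\<^esub>"
      using that by (simp add: hitting_point_def diag_point_def)
    have 3: "[1..<d + 2] = [1..<Suc (d + 1)]" "[1..<d + 1] = [1..<Suc d]" by simp_all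
    show ?thesis
      unfolding elt_code_def 2 3 map_from_1 concat_map_singleton
      by (intro arg_cong2[where f = "(@)"] arg_cong[where f = concat] map_cong refl) (use 1 in auto)
  qed
  then show ?thesis
    unfolding point_code_def Suc_eq_plus1[symmetric] map_from_1 by (intro arg_cong[where f = concat] map_cong) auto
qed

text \<open>The constants are compared here. \<open>B * B\<close> bounds
  \<open>n + d * s * s\<close>, hence the number of candidates. Up to \<open>d\<close> leaves, each
  reduced by a modulus of at most \<open>2 * B ^ 11 + 1\<close>, need \<open>K\<close> of about
  \<open>B ^ 14\<close>; the rest of \<open>B ^ 16\<close> is slack.\<close>

lemma (in field_circuit) hitting_point_hits:
  assumes two: "\<one> \<oplus> \<one> \<noteq> \<zero>" and pos: "1 \<le> n" "1 \<le> s" "1 \<le> d"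
    and B: "B = n * s * d + 1" and K: "K = B ^ 16"
    and size: "len \<le> s" and depth: "product_depth C \<le> \<Delta>"
    and nz: "circuit_poly R C \<noteq> pzero R" and deg: "pdegree R (circuit_poly R C) \<le> d"
    and e: "range e \<subseteq> carrier R" "inj_on e {..<K ^ (\<Delta> + 2)}"
  shows "\<exists>c < K ^ (2 * \<Delta> + 3).
    poly_eval R d (hitting_point R e d n B K (\<Delta> + 1) c) (circuit_poly R C) \<noteq> alg_zero R d"
proof -
  let ?M = "n * s * d"
  have M: "n \<le> ?M" "s \<le> ?M" "d \<le> ?M" "d * s \<le> ?M" using pos by simp_all
  have dB: "d < B" "n < B" "2 \<le> B" using M pos B by linarith+
  have 1: "n + d * len * len \<le> B * B"
  proof -
    have "d * len * len \<le> (d * s) * s" by (rule mult_le_mono[OF mult_le_mono[OF le_refl size] size])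
    also have "\<dots> \<le> ?M * ?M" by (rule mult_le_mono[OF M(4,2)])
    finally have "n + d * len * len \<le> ?M + ?M * ?M" using M by linarith
    also have "\<dots> \<le> B * B" unfolding B by simp
    finally show ?thesis .
  qed
  have B2: "4 \<le> B ^ 2" using dB power_mono[of 2 B 2] by simp
  have 2: "d * (2 * B ^ 11 + 1) \<le> K"
  proof -
    have "1 \<le> B ^ 11" using dB by simp
    then have "2 * B ^ 11 + 1 \<le> B ^ 2 * B ^ 11" using mult_le_mono1[OF B2, of "B ^ 11"] by linarith
    then have "d * (2 * B ^ 11 + 1) \<le> B * (B ^ 2 * B ^ 11)" using dB by (intro mult_le_mono) auto
    also have "\<dots> = B ^ 14" by (simp add: eval_nat_numeral)
    also have "\<dots> \<le> K" unfolding K using dB by (intro power_increasing) auto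
    finally show ?thesis .
  qed
  have 3: "2 * d < K"
  proof -
    have "2 * d < B * B" using dB by (intro mult_le_less_imp_less) auto
    also have "\<dots> = B ^ 2" by (simp add: power2_eq_square)
    also have "\<dots> \<le> K" unfolding K using dB by (intro power_increasing) auto
    finally show ?thesis .
  qed
  from ex_hitting_digits[OF two pos(3) dB(1,2) 1 2 3 depth nz deg] obtain g
    where g: "\<And>j. g j < K"
      and hit: "\<And>Y. finite Y \<Longrightarrow> Y \<subseteq> carrier R \<Longrightarrow> K ^ (\<Delta> + 2) \<le> card Y \<Longrightarrow>
        \<exists>y \<in> Y. poly_eval R d (diag_point R d n (horner B K g (Suc \<Delta>)) y) (circuit_poly R C) \<noteq> alg_zero R d"
    by blast
  have "\<exists>y \<in> e ` {..<K ^ (\<Delta> + 2)}. poly_eval R d (diag_point R d n (horner B K g (Suc \<Delta>)) y)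
      (circuit_poly R C) \<noteq> alg_zero R d"
    by (rule hit) (use e in \<open>auto simp: card_image\<close>)
  then obtain x where x: "x < K ^ (\<Delta> + 2)"
    "poly_eval R d (diag_point R d n (horner B K g (Suc \<Delta>)) (e x)) (circuit_poly R C) \<noteq> alg_zero R d"
    by auto
  from exists_digits[of "Suc \<Delta>" g K x] g obtain c
    where c: "c div K ^ Suc \<Delta> = x" "\<And>h. h < Suc \<Delta> \<Longrightarrow> c div K ^ h mod K = g h" by blast
  have "param_weight B K c (Suc \<Delta>) = horner B K g (Suc \<Delta>)"
    unfolding param_weight_def by (rule horner_cong) (rule c(2))
  then have "poly_eval R d (hitting_point R e d n B K (\<Delta> + 1) c) (circuit_poly R C) \<noteq> alg_zero R d"
    using x(2) c(1) by (simp add: hitting_point_def)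
  \<comment> \<open>The index of \<open>y\<close> is below \<open>K ^ (\<Delta> + 2)\<close> and
    sits above \<open>\<Delta> + 1\<close> digits.\<close>
  moreover have "c < K ^ (2 * \<Delta> + 3)"
  proof -
    have "0 < K ^ Suc \<Delta>" using 3 by simp
    then have "c < K ^ (\<Delta> + 2) * K ^ Suc \<Delta>"
      using c(1) x(1) by (simp only: div_less_iff_less_mult flip: c(1))
    also have "\<dots> = K ^ (\<Delta> + 2 + Suc \<Delta>)" by (simp only: power_add)
    also have "\<Delta> + 2 + Suc \<Delta> = 2 * \<Delta> + 3" by simp
    finally show ?thesis .
  qed
  ultimately show ?thesis by blast
qed

text \<open>All costs are measured by the number \<open>Z\<close> of points, which bounds
  \<open>K\<close>, the number of heights and every weight. A coordinate then costs at most
  \<open>Z ^ 3\<close>, the loops \<open>Z ^ 13\<close> and the initialisation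
  \<open>Z ^ 4\<close>.\<close>

lemma runs_hitting_prog:
  assumes pos: "1 \<le> n" "1 \<le> s" "1 \<le> d" and B: "B = n * s * d + 1" and K: "K = B ^ 16"
    and Z: "Z = K ^ (2 * \<Delta> + 3)"
  shows "runs F e hitting_prog (Z ^ 14) (start F [n, s, d, \<Delta>])
    (\<lambda>st. out st = concat (map (point_code d n) (map (hitting_point F e d n B K (\<Delta> + 1)) [0..<Z])))"
proof -
  let ?M = "n * s * d"
  have M: "n \<le> ?M" "s \<le> ?M" "d \<le> ?M" using pos by simp_all
  have dB: "d < B" "n < B" "s < B" "2 \<le> B" using M pos B by linarith+
  have B16: "B \<le> K" "2 ^ 16 \<le> K" "B ^ 8 \<le> K" "B ^ 4 \<le> K" "B ^ 2 \<le> K" "B ^ 5 \<le> K"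
  proof -
    show "B \<le> K" unfolding K using dB power_increasing[of 1 16 B] by simp
    show "2 ^ 16 \<le> K" unfolding K by (rule power_mono) (use dB in auto)
  qed (use dB in \<open>auto simp: K intro!: power_increasing\<close>)
  have K2: "2 \<le> K" using B16(2) by simp
  have KZ: "K ^ j \<le> Z" if "j \<le> 2 * \<Delta> + 3" for j
    unfolding Z using that K2 by (intro power_increasing) auto
  have K1: "K \<le> Z" using KZ[of 1] by simp
  have Z100: "100 \<le> Z" using K1 B16(2) by simp
  have D: "\<Delta> + 1 \<le> Z"
  proof -
    have "\<Delta> + 1 < 2 ^ (\<Delta> + 1)" by (rule less_exp)
    also have "\<dots> \<le> K ^ (\<Delta> + 1)" using K2 by (intro power_mono) auto
    also have "\<dots> \<le> Z" by (rule KZ) simp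
    finally show ?thesis by simp
  qed
  have Z3: "11 * (Z * Z) + 22 * Z + 21 \<le> Z ^ 3"
  proof -
    have "22 * Z \<le> Z * Z" "21 \<le> Z * Z" using Z100 by (simp_all add: le_trans[OF _ mult_le_mono[OF Z100 Z100]])
    then have "11 * (Z * Z) + 22 * Z + 21 \<le> 100 * (Z * Z)" by linarith
    also have "\<dots> \<le> Z * (Z * Z)" using Z100 by (rule mult_le_mono1)
    finally show ?thesis by (simp add: eval_nat_numeral)
  qed
  have coord: "6 * B + (\<Delta> + 1) * (3 * c + 5 * lidx B (Suc v) (Suc k) (Suc i) + 3 * K + 13) +
      3 * param_weight B K c (\<Delta> + 1) (Suc v) (Suc k) (Suc i) + 21 \<le> Z ^ 3"
    if c: "c < Z" "v < n" "i < d + 1" "k < d" for c v i k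
  proof -
    have "lidx B (Suc v) (Suc k) (Suc i) < Suc (Suc i) * B * B"
      by (rule lidx_less) (use c dB in auto)
    also have "\<dots> \<le> (2 * B) * B * B" using c dB by (intro mult_le_mono) auto
    also have "\<dots> \<le> B * B * B * B" using dB by (simp add: mult.assoc mult_le_mono1)
    also have "\<dots> = B ^ 4" by (simp add: eval_nat_numeral)
    finally have l: "lidx B (Suc v) (Suc k) (Suc i) \<le> Z" using B16 K1 by linarith
    have "param_weight B K c (\<Delta> + 1) (Suc v) (Suc k) (Suc i) + 2 \<le> 2 * K ^ (\<Delta> + 1)"
      unfolding param_weight_def by (rule horner_le) (use K2 in auto)
    also have "\<dots> \<le> K * K ^ (\<Delta> + 1)" using K2 by (intro mult_le_mono1)
    also have "\<dots> = K ^ (\<Delta> + 2)" by simp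
    also have "\<dots> \<le> Z" by (rule KZ) simp
    finally have w: "param_weight B K c (\<Delta> + 1) (Suc v) (Suc k) (Suc i) \<le> Z" by simp
    have "(\<Delta> + 1) * (3 * c + 5 * lidx B (Suc v) (Suc k) (Suc i) + 3 * K + 13) \<le> Z * (11 * Z + 13)"
      using D l c K1 by (intro mult_le_mono) auto
    then have "6 * B + (\<Delta> + 1) * (3 * c + 5 * lidx B (Suc v) (Suc k) (Suc i) + 3 * K + 13) +
        3 * param_weight B K c (\<Delta> + 1) (Suc v) (Suc k) (Suc i) + 21 \<le>
        6 * Z + Z * (11 * Z + 13) + 3 * Z + 21"
      using w B16(1) K1 by linarith
    also have "\<dots> = 11 * (Z * Z) + 22 * Z + 21" by (simp add: algebra_simps)
    finally show ?thesis using Z3 by linarith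
  qed
  have init: "3 * s + 3 * d + 3 * B + 3 * B ^ 2 + 3 * B ^ 4 + 3 * B ^ 8 + (2 * \<Delta> + 3) * (3 * K + 6) + 40 \<le> Z ^ 4"
  proof -
    have "(2 * \<Delta> + 3) * (3 * K + 6) \<le> (3 * Z) * (4 * Z)"
      using D K1 Z100 by (intro mult_le_mono) auto
    moreover have "3 * s + 3 * d + 3 * B + 3 * B ^ 2 + 3 * B ^ 4 + 3 * B ^ 8 + 40 \<le> 18 * Z + 40"
      using dB B16 K1 by linarith
    moreover have "18 * Z + 40 \<le> Z * Z" using mult_le_mono1[OF Z100, of Z] Z100 by linarith
    ultimately have "3 * s + 3 * d + 3 * B + 3 * B ^ 2 + 3 * B ^ 4 + 3 * B ^ 8 + (2 * \<Delta> + 3) * (3 * K + 6) + 40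
      \<le> 100 * (Z * Z)" by simp
    also have "\<dots> \<le> (Z * Z) * (Z * Z)" using Z100 mult_le_mono[OF Z100, of 1 Z] by (intro mult_le_mono1) simp
    finally show ?thesis by (simp add: eval_nat_numeral)
  qed
  define W where "W = concat (map (point_code d n) (map (hitting_point F e d n B K (\<Delta> + 1)) [0..<Z]))"
  have "runs F e init_prog (Z ^ 4) (start F [n, s, d, \<Delta>])
      (\<lambda>st. layout n d B K Z (\<Delta> + 1) \<zero>\<^bsub>F\<^esub> st \<and> out st = [])"
    using runs_init_prog[OF B K, of F e \<Delta>] unfolding Z[symmetric] by (rule runs_weaken) (use init in auto)
  then obtain t1 st1 where 1: "exec F e init_prog (start F [n, s, d, \<Delta>]) t1 st1" "t1 \<le> Z ^ 4"
    "layout n d B K Z (\<Delta> + 1) \<zero>\<^bsub>F\<^esub> st1" "out st1 = []"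
    unfolding runs_def by blast
  have "runs F e (for_loop 7 6 (for_loop 8 0
      (Seq (for_loop 9 12 (for_loop 10 12 (for_loop 11 2 coord_prog))) (Emit (Dir 0))))) (Z ^ 13) st1
      (\<lambda>st'. out st' = W)"
    by (rule runs_weaken[OF runs_hitting_loops[OF 1(3) Z100 _ _ order_refl _ coord]])
      (use dB B16 K1 K2 in \<open>auto simp: W_def 1(4) point_code_hitting_point o_def\<close>)
  then obtain t2 st2 where 2: "exec F e (for_loop 7 6 (for_loop 8 0
      (Seq (for_loop 9 12 (for_loop 10 12 (for_loop 11 2 coord_prog))) (Emit (Dir 0))))) st1 t2 st2"
    "t2 \<le> Z ^ 13" "out st2 = W"
    unfolding runs_def by blast
  have "t1 + t2 \<le> Z ^ 4 + Z ^ 13" using 1 2 by linarith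
  also have "\<dots> \<le> Z ^ 13 + Z ^ 13" using Z100 by (intro add_mono power_increasing) auto
  also have "\<dots> \<le> Z * Z ^ 13" using Z100 mult_le_mono1[of 2 Z "Z ^ 13"] by linarith
  also have "\<dots> = Z ^ 14" by (simp add: eval_nat_numeral)
  finally show ?thesis
    unfolding runs_def hitting_prog_def W_def[symmetric] using exec.intros(11)[OF 1(1) 2(1)] 2(3) by blast
qed

theorem mainTheorem4:
  shows "\<exists>(c::nat) (P::prog). \<forall>(F::'a ring) (e::nat \<Rightarrow> 'a) (n::nat) (s::nat) (d::nat) (\<Delta>::nat).
    field F \<longrightarrow> \<one>\<^bsub>F\<^esub> \<oplus>\<^bsub>F\<^esub> \<one>\<^bsub>F\<^esub> \<noteq> \<zero>\<^bsub>F\<^esub> \<longrightarrow>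
    n \<ge> 1 \<longrightarrow> s \<ge> 1 \<longrightarrow> d \<ge> 1 \<longrightarrow> \<Delta> \<ge> 1 \<longrightarrow>
    distinct_elements F (bound c n s d \<Delta>) e \<longrightarrow>
    (\<exists>H. H \<subseteq> points F d n \<and> finite H \<and> card H \<le> bound c n s d \<Delta> \<and>
      (\<forall>\<Psi>. is_circuit F n \<Psi> \<longrightarrow> circuit_size \<Psi> \<le> s \<longrightarrow> product_depth \<Psi> \<le> \<Delta> \<longrightarrow>
        circuit_poly F \<Psi> \<noteq> pzero F \<longrightarrow> pdegree F (circuit_poly F \<Psi>) \<le> d \<longrightarrow>
        (\<exists>b \<in> H. poly_eval F d b (circuit_poly F \<Psi>) \<noteq> alg_zero F d)) \<and>
      (\<exists>hs. set hs = H \<and>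
        outputs_within F e P [n, s, d, \<Delta>] (concat (map (point_code d n) hs)) (bound c n s d \<Delta>)))"
proof (rule exI[of _ 2240], rule exI[of _ hitting_prog], intro allI impI)
  fix F :: "'a ring" and e :: "nat \<Rightarrow> 'a" and n s d \<Delta> :: nat
  assume F: "field F" and two: "\<one>\<^bsub>F\<^esub> \<oplus>\<^bsub>F\<^esub> \<one>\<^bsub>F\<^esub> \<noteq> \<zero>\<^bsub>F\<^esub>"
    and pos: "1 \<le> n" "1 \<le> s" "1 \<le> d" "1 \<le> \<Delta>" and de: "distinct_elements F (bound 2240 n s d \<Delta>) e"
  interpret field_ring F using F by (simp add: field_ring_def)
  let ?bd = "bound 2240 n s d \<Delta>"
  define B where "B = n * s * d + 1"
  define K where "K = B ^ 16"
  define Z where "Z = K ^ (2 * \<Delta> + 3)"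
  let ?p = "hitting_point F e d n B K (\<Delta> + 1)"
  have e: "range e \<subseteq> carrier F" "inj_on e {..<?bd}" using de by (auto simp: distinct_elements_def)
  let ?X = "max 2 (n * s * d)"
  have X: "B \<le> ?X ^ 2"
  proof -
    have "B \<le> 2 * ?X" by (simp add: B_def)
    also have "\<dots> \<le> ?X * ?X" by (rule mult_le_mono1) simp
    finally show ?thesis by (simp add: power2_eq_square)
  qed
  \<comment> \<open>The constant is \<open>2240 = 32 * 70\<close>. From
    \<open>B \<le> ?X ^ 2\<close> follows \<open>K \<le> ?X ^ 32\<close>, and the running time
    \<open>Z ^ 14\<close> is \<open>K\<close> to the power \<open>14 * (2 * \<Delta> + 3)\<close>,
    which is at most \<open>70 * \<Delta>\<close> because \<open>\<Delta> \<ge> 1\<close>.\<close>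
  have K_bound: "K ^ j \<le> ?bd" if "j \<le> 70 * \<Delta>" for j
  proof -
    have "K ^ j \<le> ((?X ^ 2) ^ 16) ^ j" unfolding K_def using X by (intro power_mono) auto
    also have "\<dots> = ?X ^ (32 * j)" by (simp only: power_mult[symmetric]) simp
    also have "\<dots> \<le> ?X ^ (2240 * \<Delta>)" using that by (intro power_increasing) auto
    finally show ?thesis by (simp add: bound_def)
  qed
  have ZB: "Z \<le> ?bd" "K ^ (\<Delta> + 2) \<le> ?bd" unfolding Z_def by (rule K_bound, use pos in simp)+
  have ZB': "Z ^ 14 \<le> ?bd" unfolding Z_def power_mult[symmetric] by (rule K_bound) (use pos in simp)
  let ?hs = "map ?p [0..<Z]"
  show "\<exists>H. H \<subseteq> points F d n \<and> finite H \<and> card H \<le> ?bd \<and>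
      (\<forall>\<Psi>. is_circuit F n \<Psi> \<longrightarrow> circuit_size \<Psi> \<le> s \<longrightarrow> product_depth \<Psi> \<le> \<Delta> \<longrightarrow>
        circuit_poly F \<Psi> \<noteq> pzero F \<longrightarrow> pdegree F (circuit_poly F \<Psi>) \<le> d \<longrightarrow>
        (\<exists>b \<in> H. poly_eval F d b (circuit_poly F \<Psi>) \<noteq> alg_zero F d)) \<and>
      (\<exists>hs. set hs = H \<and>
        outputs_within F e hitting_prog [n, s, d, \<Delta>] (concat (map (point_code d n) hs)) ?bd)"
  proof (intro exI[of _ "set ?hs"] conjI allI impI)
    show "set ?hs \<subseteq> points F d n"
      using e(1) by (auto simp: hitting_point_def intro!: diag_point_in_points)
    show "finite (set ?hs)" by simp
    show "card (set ?hs) \<le> ?bd" using card_length[of ?hs] ZB by simp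
    show "\<exists>hs. set hs = set ?hs \<and>
        outputs_within F e hitting_prog [n, s, d, \<Delta>] (concat (map (point_code d n) hs)) ?bd"
      using runs_hitting_prog[OF pos(1-3) B_def K_def Z_def, of F e] ZB'
      unfolding outputs_within_def runs_def by (intro exI[of _ ?hs]) (auto intro: le_trans)
  next
    fix \<Psi> assume \<Psi>: "is_circuit F n \<Psi>" "circuit_size \<Psi> \<le> s" "product_depth \<Psi> \<le> \<Delta>"
      "circuit_poly F \<Psi> \<noteq> pzero F" "pdegree F (circuit_poly F \<Psi>) \<le> d"
    interpret field_circuit F n \<Psi> by unfold_locales (rule \<Psi>(1))
    have "inj_on e {..<K ^ (\<Delta> + 2)}" by (rule inj_on_subset[OF e(2)]) (use ZB(2) in auto)
    from hitting_point_hits[OF two pos(1-3) B_def K_def _ \<Psi>(3-5) e(1) this] \<Psi>(2)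
    show "\<exists>b \<in> set ?hs. poly_eval F d b (circuit_poly F \<Psi>) \<noteq> alg_zero F d"
      by (auto simp: circuit_size_def Z_def)
  qed
qed

end
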